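(* Let $X\subseteq\mathbb{R}^n$ be a nonempty bounded set that is the intersection of finitely many open half-spaces (a polyhedral Hilbert geometry), equipped with its Hilbert metric $d_X$. Let $\mathrm{Isom}(X)$ be the group of isometries of $(X,d_X)$ onto itself and $\mathrm{Coll}(X)=\{h\in \mathrm{PGL}(n+1,\mathbb{R})\colon h(X)=X\}$ the group of collineations of $X$. Then $\mathrm{Isom}(X)=\mathrm{Coll}(X)$ if and only if $X$ is not an open $n$-simplex with $n\geq 2$.
   Context: For an open bounded convex set $X\subseteq\mathbb{R}^n$, the Hilbert metric is $d_X(x,x)=0$ and, for $x\neq y$ in $X$, $d_X(x,y)=\log\frac{|x'y|\,|y'x|}{|x'x|\,|y'y|}$, where $x',y'$ are the points where the straight line through $x,y$ meets $\partial X$, labelled so that $x',x,y,y'$ lie on the line in this order, and $|ab|$ denotes Euclidean distance. $\mathbb{R}^n$ is regarded as the standard affine chart of real projective space $\mathbb{P}^n$, and collineations are projective transformations of $\mathbb{P}^n$; every collineation mapping $X$ onto $X$ is an isometry of $d_X$. An open $n$-simplex is the interior of the convex hull of $n+1$ affinely independent points of $\mathbb{R}^n$. *)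

theory Defs
  imports "HOL-Analysis.Analysis"
begin

definition polyhedral_domain :: "'a::euclidean_space set \<Rightarrow> bool" where
  "polyhedral_domain X \<longleftrightarrow> X \<noteq> {} \<and> bounded X \<and>
     (\<exists>F. finite F \<and> X = \<Inter>F \<and>
        (\<forall>H\<in>F. \<exists>a b. a \<noteq> 0 \<and> H = {x. inner a x < b}))"

definition hilbert_end :: "'a::euclidean_space set \<Rightarrow> 'a \<Rightarrow> 'a \<Rightarrow> 'a" where
  "hilbert_end X x y = (THE p. p \<in> frontier X \<and> (\<exists>s>0. p = x + s *\<^sub>R (x - y)))"

definition hilbert_dist :: "'a::euclidean_space set \<Rightarrow> 'a \<Rightarrow> 'a \<Rightarrow> real" where
  "hilbert_dist X x y =
     (if x = y then 0
      else (let x' = hilbert_end X x y; y' = hilbert_end X y x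
            in ln ((dist x' y * dist y' x) / (dist x' x * dist y' y))))"

definition hilbert_isometries :: "'a::euclidean_space set \<Rightarrow> ('a \<Rightarrow> 'a) set" where
  "hilbert_isometries X =
     {f. f \<in> extensional X \<and> f ` X = X \<and>
         (\<forall>x\<in>X. \<forall>y\<in>X. hilbert_dist X (f x) (f y) = hilbert_dist X x y)}"

text \<open>A collineation of P^n is given by an invertible linear map M of
  R^(n+1) = 'a \<times> real (an element of GL(n+1,R)); it acts on the affine chart
  by x \<mapsto> y / t where M (x,1) = (y,t), provided t \<noteq> 0.\<close>
definition proj_apply :: "('a::euclidean_space \<times> real \<Rightarrow> 'a \<times> real) \<Rightarrow> 'a \<Rightarrow> 'a" where
  "proj_apply M x = (1 / snd (M (x, 1))) *\<^sub>R fst (M (x, 1))"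

text \<open>h(X) = X: X avoids the hyperplane mapped to infinity and is mapped onto X.\<close>
definition collineation_of :: "'a::euclidean_space set \<Rightarrow> ('a \<times> real \<Rightarrow> 'a \<times> real) \<Rightarrow> bool" where
  "collineation_of X M \<longleftrightarrow> linear M \<and> bij M \<and>
     (\<forall>x\<in>X. snd (M (x, 1)) \<noteq> 0) \<and> proj_apply M ` X = X"

definition hilbert_collineations :: "'a::euclidean_space set \<Rightarrow> ('a \<Rightarrow> 'a) set" where
  "hilbert_collineations X = {restrict (proj_apply M) X | M. collineation_of X M}"

definition open_simplex :: "'a::euclidean_space set \<Rightarrow> bool" where
  "open_simplex X \<longleftrightarrow> (\<exists>S. finite S \<and> card S = DIM('a) + 1 \<and> \<not> affine_dependent S \<and>
                          X = interior (convex hull S))"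

end

theory Submission
  imports Defs
begin

text \<open>
  Let \<open>X\<close> be cut out by an irredundant finite family of affine functions \<open>\<phi>\<^sub>k > 0\<close>. Then
  \<open>d x y = max\<^sub>i\<^sub>j (L\<^sub>i\<^sub>j x - L\<^sub>i\<^sub>j y)\<close> with \<open>L\<^sub>i\<^sub>j = ln \<phi>\<^sub>i - ln \<phi>\<^sub>j\<close>, and for generic \<open>x, y\<close> the maximising pair
  \<open>(i, j)\<close> is unique and can be read off from the set of points \<open>z\<close> with \<open>d x z = d x y + d y z\<close>. Hence an
  isometry \<open>f\<close> permutes the pairs: there are \<open>\<sigma>\<close> and constants \<open>c\<close> with \<open>L\<^bsub>\<sigma>(i,j)\<^esub> (f x) = L\<^sub>i\<^sub>j x + c\<^sub>i\<^sub>j\<close> whenever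
  \<open>x\<close> lies on an open segment joining the facets \<open>i\<close> and \<open>j\<close>.

  If the facets \<open>i\<close> and \<open>j\<close> are adjacent, the regions belonging to the pairs from \<open>i, j, k\<close> have a common
  point, where \<open>L\<^sub>i\<^sub>j + L\<^sub>j\<^sub>k = L\<^sub>i\<^sub>k\<close>; unique factorisation then forces \<open>\<sigma>\<close> to preserve or to reverse such a
  triple. In dimension at least 2 it follows that either \<open>\<sigma>(i,j) = (\<pi> i, \<pi> j)\<close> throughout or
  \<open>\<sigma>(i,j) = (\<pi> j, \<pi> i)\<close> throughout, for a permutation \<open>\<pi>\<close> of the facets. In the first case \<open>c\<^sub>i\<^sub>j = \<kappa> i - \<kappa> j\<close>
  by connectedness of the adjacency graph, and \<open>f\<close> agrees with a collineation. In the second case \<open>f\<close>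
  inverts the ratios \<open>\<phi>\<^sub>k / \<phi>\<^sub>i\<close>, which is compatible with a linear relation between the \<open>\<phi>\<^sub>k\<close> only if
  that relation is trivial, so \<open>X\<close> is a simplex. Conversely, on a simplex of dimension at least 2 inversion
  of the barycentric coordinates is an isometry that is not projective.
\<close>

text \<open>Facet functionals are vectors of type \<open>'a \<times> real\<close> that should never be split into components.\<close>

declare split_paired_All [simp del] split_paired_Ex [simp del]

section \<open>Facet functionals and the metric\<close>

text \<open>The half-space \<open>inner a x < b\<close> is \<open>0 < aff (- a, b) x\<close>.\<close>

definition aff :: "'a::euclidean_space \<times> real \<Rightarrow> 'a \<Rightarrow> real" where
  "aff k x = inner k (x, 1)"

lemma aff_add: "aff k (x + s *\<^sub>R u) = aff k x + s * inner (fst k) u"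
  by (cases k) (simp add: aff_def inner_Pair inner_add_right)

lemma aff_segment: "aff k ((1 - t) *\<^sub>R x + t *\<^sub>R y) = (1 - t) * aff k x + t * aff k y"
  by (cases k) (simp add: aff_def inner_Pair inner_add_right algebra_simps)

lemma aff_beyond: "aff k (x + s *\<^sub>R (x - y)) = (1 + s) * aff k x - s * aff k y"
  by (cases k) (simp add: aff_def inner_Pair inner_add_right inner_diff_right algebra_simps)

lemma inner_fst_diff: "inner (fst k) (x - y) = aff k x - aff k y"
  by (cases k) (simp add: aff_def inner_Pair inner_diff_right)

lemma inner_scale_aff:
  assumes "snd v \<noteq> 0"
  shows "inner k v = snd v * aff k (fst v /\<^sub>R snd v)"
proof -
  have "v = snd v *\<^sub>R (fst v /\<^sub>R snd v, 1)"
    using assms by (cases v) simp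
  then show ?thesis
    unfolding aff_def by (metis inner_scaleR_right)
qed

lemma continuous_on_aff [continuous_intros]: "continuous_on A (aff k)"
  unfolding aff_def by (intro continuous_intros)

lemma tendsto_aff [tendsto_intros]: "(g \<longlongrightarrow> a) F \<Longrightarrow> ((\<lambda>x. aff k (g x)) \<longlongrightarrow> aff k a) F"
  unfolding aff_def by (intro tendsto_intros)

text \<open>The exit parameter is the smallest parameter at which a decreasing functional reaches
  zero. The family \<open>J\<close> is arbitrary because \<open>adjacency_connected\<close> also
  traverses the polyhedron cut out by only some of the facets.\<close>

lemma exit_point:
  assumes "finite J" and pos: "\<And>k. k \<in> J \<Longrightarrow> 0 < aff k x"
    and "k0 \<in> J" "inner (fst k0) u < 0"
  obtains s i where "0 < s" "i \<in> J" "aff i (x + s *\<^sub>R u) = 0"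
    "\<And>k. k \<in> J \<Longrightarrow> 0 \<le> aff k (x + s *\<^sub>R u)"
proof -
  define B where "B = {k \<in> J. inner (fst k) u < 0}"
  define r where "r k = aff k x / - inner (fst k) u" for k
  have B: "finite B" "B \<noteq> {}"
    using assms(1,3,4) unfolding B_def by (simp, blast)
  then obtain i where i: "i \<in> B" "r i = Min (r ` B)"
    using Min_in[of "r ` B"] by fastforce
  have min: "r i \<le> r k" if "k \<in> B" for k
    using i B that by simp
  have "0 < r i"
    using i(1) pos[of i] by (simp add: r_def B_def divide_pos_neg)
  moreover have "aff i (x + r i *\<^sub>R u) = 0"
    unfolding aff_add using i(1) by (simp add: r_def B_def)
  moreover have "0 \<le> aff k (x + r i *\<^sub>R u)" if "k \<in> J" for k
  proof (cases "k \<in> B")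
    case True
    then have "r i * - inner (fst k) u \<le> aff k x"
      using min[OF True] unfolding r_def[of k]
      by (subst (asm) pos_le_divide_eq) (simp_all add: B_def)
    then show ?thesis by (simp add: aff_add)
  next
    case False
    then show ?thesis
      using that pos[OF that] \<open>0 < r i\<close> by (simp add: B_def aff_add not_less)
  qed
  ultimately show ?thesis
    using i(1) by (intro that) (simp_all add: B_def)
qed

definition lr :: "'a::euclidean_space \<times> real \<Rightarrow> 'a \<times> real \<Rightarrow> 'a \<Rightarrow> real" where
  "lr i j x = ln (aff i x) - ln (aff j x)"

lemma lr_swap: "lr j i x = - lr i j x"
  by (simp add: lr_def)

lemma lr_same [simp]: "lr i i x = 0"
  by (simp add: lr_def)

text \<open>A facet is identified with its functional, so \<open>I\<close> is a set of vectors
  rather than an indexed family. Irredundancy is stated in the form in which it is used: each facet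
  has a point at which its functional alone vanishes.\<close>

locale polytope =
  fixes X :: "'a::euclidean_space set" and I :: "('a \<times> real) set"
  assumes finite_I: "finite I"
    and X_eq: "X = {x. \<forall>k\<in>I. 0 < aff k x}"
    and X_nonempty: "X \<noteq> {}"
    and bounded_X: "bounded X"
    and irredundant: "\<And>k. k \<in> I \<Longrightarrow> \<exists>p. aff k p = 0 \<and> (\<forall>l\<in>I - {k}. 0 < aff l p)"
begin

lemma aff_pos: "x \<in> X \<Longrightarrow> k \<in> I \<Longrightarrow> 0 < aff k x"
  by (simp add: X_eq)

text \<open>A nonzero direction along which no functional decreases would generate a ray inside
  \<open>X\<close>, against boundedness.\<close>

lemma recession_trivial:
  assumes "\<And>k. k \<in> I \<Longrightarrow> 0 \<le> inner (fst k) u"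
  shows "u = 0"
proof (rule ccontr)
  assume "u \<noteq> 0"
  obtain x where x: "x \<in> X" using X_nonempty by auto
  obtain B where B: "\<And>y. y \<in> X \<Longrightarrow> norm y \<le> B"
    using bounded_X by (auto simp: bounded_iff)
  define s where "s = (norm x + \<bar>B\<bar> + 1) / norm u"
  have "0 \<le> s" by (simp add: s_def)
  then have "x + s *\<^sub>R u \<in> X"
    using x assms by (auto simp: X_eq aff_add intro!: add_pos_nonneg)
  then have "norm (x + s *\<^sub>R u) \<le> B" by (rule B)
  moreover have "norm (s *\<^sub>R u) \<le> norm (x + s *\<^sub>R u) + norm x"
    by (metis add_diff_cancel_left' norm_triangle_ineq4)
  moreover have "norm (s *\<^sub>R u) = norm x + \<bar>B\<bar> + 1"
    using \<open>u \<noteq> 0\<close> \<open>0 \<le> s\<close> by (simp add: s_def)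
  ultimately show False by linarith
qed

text \<open>The vectors on which all of \<open>I\<close> is nonnegative form the cone over
  \<open>closure X\<close> placed at height 1. Since \<open>X\<close> is bounded, this cone meets
  the hyperplane of height 0 only in the origin.\<close>

lemma cone_snd_pos:
  assumes "\<And>k. k \<in> I \<Longrightarrow> 0 \<le> inner k v" "v \<noteq> 0"
  shows "0 < snd v"
proof (rule ccontr)
  assume neg: "\<not> 0 < snd v"
  obtain x where x: "x \<in> X" using X_nonempty by auto
  \<comment> \<open>Subtracting from \<open>v\<close> the multiple \<open>snd v\<close> of the lift
    of \<open>x\<close> leaves a horizontal vector; for \<open>snd v \<le> 0\<close> it is a
    recession direction.\<close>
  define u where "u = fst v - snd v *\<^sub>R x"
  have "inner (fst k) u = inner k v - snd v * aff k x" for k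
    by (cases k; cases v) (simp add: u_def aff_def inner_Pair inner_diff_right algebra_simps)
  moreover have "0 \<le> - snd v * aff k x" if "k \<in> I" for k
    using neg aff_pos[OF x that] by (intro mult_nonneg_nonneg) auto
  ultimately have u: "- snd v * aff k x \<le> inner (fst k) u" "0 \<le> inner (fst k) u" if "k \<in> I" for k
    using assms(1)[OF that] that by (smt (verit, best) mult_minus_left)+
  have "u = 0" using u(2) by (rule recession_trivial)
  obtain b :: 'a where "b \<in> Basis" using nonempty_Basis by blast
  then obtain k where k: "k \<in> I" using recession_trivial[of b] nonzero_Basis by auto
  have "\<not> 0 < - snd v" using u(1)[OF k] \<open>u = 0\<close> aff_pos[OF x k] mult_pos_pos[of "- snd v" "aff k x"] by auto
  with neg have "snd v = 0" by simp
  then have "v = 0" using \<open>u = 0\<close> by (cases v) (simp add: u_def zero_prod_def)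
  with assms(2) show False by simp
qed

text \<open>Otherwise \<open>v\<close> and \<open>- v\<close> would both have positive
  height.\<close>

lemma inner_separates: "(\<And>k. k \<in> I \<Longrightarrow> inner k v = 0) \<Longrightarrow> v = 0"
  using cone_snd_pos[of v] cone_snd_pos[of "- v"] by force

lemma open_X: "open X"
proof -
  have "X = (\<Inter>k\<in>I. {x. 0 < aff k x})" by (auto simp: X_eq)
  then show ?thesis
    using finite_I by (auto intro!: open_INT open_Collect_less continuous_intros)
qed

lemma closure_X: 
  assumes "x \<in> closure X" "k \<in> I" shows "0 \<le> aff k x"
proof -
  have "closure X \<subseteq> {x. 0 \<le> aff k x}"
    using assms(2) by (intro closure_minimal closed_Collect_le continuous_intros) (force simp: X_eq)
  with assms show ?thesis by auto
qed

lemma segment_in_X: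
  assumes "x \<in> X" "\<And>k. k \<in> I \<Longrightarrow> 0 \<le> aff k y" "0 \<le> t" "t < 1"
  shows "(1 - t) *\<^sub>R x + t *\<^sub>R y \<in> X"
  using assms by (auto simp: X_eq aff_segment intro!: add_pos_nonneg)

lemma nonneg_in_closure:
  assumes "\<And>k. k \<in> I \<Longrightarrow> 0 \<le> aff k y"
  shows "y \<in> closure X"
proof -
  obtain x where x: "x \<in> X" using X_nonempty by auto
  define g where "g n = (1 / real (Suc n)) *\<^sub>R x + (1 - 1 / real (Suc n)) *\<^sub>R y" for n
  have "g n \<in> X" for n
    using segment_in_X[OF x assms, of "1 - 1 / real (Suc n)"] by (simp add: g_def)
  moreover have "g \<longlonglongrightarrow> 0 *\<^sub>R x + (1 - 0) *\<^sub>R y"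
    unfolding g_def by (intro tendsto_intros LIMSEQ_Suc lim_const_over_n)
  ultimately show ?thesis by (auto simp: closure_sequential)
qed

lemma closure_eq: "closure X = {x. \<forall>k\<in>I. 0 \<le> aff k x}"
  using closure_X nonneg_in_closure by blast

lemma frontier_eq: "frontier X = {x. (\<forall>k\<in>I. 0 \<le> aff k x) \<and> (\<exists>k\<in>I. aff k x = 0)}"
proof -
  have "frontier X = {x. \<forall>k\<in>I. 0 \<le> aff k x} - {x. \<forall>k\<in>I. 0 < aff k x}"
    using open_X by (simp add: frontier_def interior_open closure_eq flip: X_eq)
  then show ?thesis by (auto simp: less_le simp del: split_paired_All split_paired_Ex)
qed

section \<open>The Hilbert distance as a maximum of logarithmic ratios\<close>

lemma hilbert_end_props:
  assumes x: "x \<in> X" and y: "y \<in> X" and "x \<noteq> y"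
  obtains s i where "0 < s" "hilbert_end X x y = x + s *\<^sub>R (x - y)" "i \<in> I"
    "aff i (x + s *\<^sub>R (x - y)) = 0" "\<And>k. k \<in> I \<Longrightarrow> 0 \<le> aff k (x + s *\<^sub>R (x - y))"
proof -
  obtain k0 where k0: "k0 \<in> I" "inner (fst k0) (x - y) < 0"
    using recession_trivial[of "x - y"] \<open>x \<noteq> y\<close> by (force simp: not_le)
  obtain s i where s: "0 < s" "i \<in> I" "aff i (x + s *\<^sub>R (x - y)) = 0"
    "\<And>k. k \<in> I \<Longrightarrow> 0 \<le> aff k (x + s *\<^sub>R (x - y))"
    using exit_point[OF finite_I aff_pos[OF x] k0] by metis
  \<comment> \<open>The functional that vanishes at the first boundary point is positive at
    \<open>x\<close>, hence decreasing along the ray and negative at every later point. So the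
    description in \<open>hilbert_end\<close> is definite.\<close>
  have uniq: "\<not> (0 < a \<and> a < b \<and> x + a *\<^sub>R (x - y) \<in> frontier X \<and> x + b *\<^sub>R (x - y) \<in> frontier X)"
    for a b
  proof
    assume *: "0 < a \<and> a < b \<and> x + a *\<^sub>R (x - y) \<in> frontier X \<and> x + b *\<^sub>R (x - y) \<in> frontier X"
    then obtain k where k: "k \<in> I" "aff k (x + a *\<^sub>R (x - y)) = 0" "0 \<le> aff k (x + b *\<^sub>R (x - y))"
      by (auto simp: frontier_eq)
    have "aff k x + a * inner (fst k) (x - y) = 0" "0 \<le> aff k x + b * inner (fst k) (x - y)" "0 < aff k x"
      using k aff_pos[OF x] by (simp_all add: aff_add)
    moreover have "inner (fst k) (x - y) < 0"
      using calculation * by (smt (verit) mult_nonneg_nonneg)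
    then have "(b - a) * inner (fst k) (x - y) < 0"
      using * by (simp add: mult_pos_neg)
    ultimately show False by (simp add: algebra_simps)
  qed
  have "hilbert_end X x y = x + s *\<^sub>R (x - y)"
    unfolding hilbert_end_def
  proof (rule the_equality)
    show "x + s *\<^sub>R (x - y) \<in> frontier X \<and> (\<exists>sa>0. x + s *\<^sub>R (x - y) = x + sa *\<^sub>R (x - y))"
      using s by (auto simp: frontier_eq)
    then show "p = x + s *\<^sub>R (x - y)" if "p \<in> frontier X \<and> (\<exists>sa>0. p = x + sa *\<^sub>R (x - y))" for p
      using that uniq s(1) by (metis linorder_neqE_linordered_idom)
  qed
  then show ?thesis using s that by metis
qed

text \<open>With \<open>x' = x + s (x - y)\<close>, the number \<open>(1 + s) / s\<close> is the
  Euclidean ratio \<open>|x'y| / |x'x|\<close>, one of the two factors of the cross-ratio; the bound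
  is nonnegativity at \<open>x'\<close> rearranged.\<close>

lemma ratio_beyond:
  assumes "0 < s" "0 < aff k x" "0 < aff k y" "0 \<le> aff k (x + s *\<^sub>R (x - y))"
  shows "ln (aff k y) - ln (aff k x) \<le> ln ((1 + s) / s)"
proof -
  have "aff k y / aff k x \<le> (1 + s) / s"
    using assms(1,2) assms(4)[unfolded aff_beyond] by (simp add: field_simps)
  then have "ln (aff k y / aff k x) \<le> ln ((1 + s) / s)"
    using assms by (subst ln_le_cancel_iff) auto
  then show ?thesis using assms by (simp add: ln_div)
qed

lemma ratio_beyond_eq:
  assumes "0 < s" "0 < aff k x" "0 < aff k y" "aff k (x + s *\<^sub>R (x - y)) = 0"
  shows "ln (aff k y) - ln (aff k x) = ln ((1 + s) / s)"
proof -
  have "aff k y / aff k x = (1 + s) / s"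
    using assms(1,2) assms(4)[unfolded aff_beyond] by (simp add: field_simps)
  then show ?thesis using assms by (metis ln_divide_pos)
qed

text \<open>The cross-ratio splits into one factor for each end of the chord, and each factor is the
  ratio of values of a functional vanishing at that end: \<open>j\<close> behind \<open>x\<close>,
  \<open>i\<close> beyond \<open>y\<close>.\<close>

lemma hilbert_dist_ends:
  assumes x: "x \<in> X" and y: "y \<in> X" and ne: "x \<noteq> y"
  obtains s t i j where "0 < s" "0 < t" "i \<in> I" "j \<in> I"
    "aff j (x + s *\<^sub>R (x - y)) = 0" "\<And>k. k \<in> I \<Longrightarrow> 0 \<le> aff k (x + s *\<^sub>R (x - y))"
    "aff i (y + t *\<^sub>R (y - x)) = 0" "\<And>k. k \<in> I \<Longrightarrow> 0 \<le> aff k (y + t *\<^sub>R (y - x))"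
    "hilbert_dist X x y = ln ((1 + s) / s) + ln ((1 + t) / t)"
    "hilbert_dist X x y = lr i j x - lr i j y"
proof -
  obtain s j where s: "0 < s" "hilbert_end X x y = x + s *\<^sub>R (x - y)" "j \<in> I"
    "aff j (x + s *\<^sub>R (x - y)) = 0" "\<And>k. k \<in> I \<Longrightarrow> 0 \<le> aff k (x + s *\<^sub>R (x - y))"
    using hilbert_end_props[OF x y ne] by metis
  obtain t i where t: "0 < t" "hilbert_end X y x = y + t *\<^sub>R (y - x)" "i \<in> I"
    "aff i (y + t *\<^sub>R (y - x)) = 0" "\<And>k. k \<in> I \<Longrightarrow> 0 \<le> aff k (y + t *\<^sub>R (y - x))"
    using hilbert_end_props[OF y x ne[symmetric]] by metis
  define r where "r = norm (x - y)"
  have "0 < r" using ne by (simp add: r_def)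
  have far: "dist (a + c *\<^sub>R (a - b)) b = (1 + c) * norm (a - b)" if "0 < c" for a b :: 'a and c
  proof -
    have "a + c *\<^sub>R (a - b) - b = (1 + c) *\<^sub>R (a - b)" by (simp add: algebra_simps)
    then show ?thesis using that by (simp add: dist_norm)
  qed
  have near: "dist (a + c *\<^sub>R (a - b)) a = c * norm (a - b)" if "0 < c" for a b :: 'a and c
    using that by (simp add: dist_norm)
  have "hilbert_dist X x y = ln (((1 + s) * r * ((1 + t) * r)) / (s * r * (t * r)))"
    using ne s(1,2) t(1,2) by (simp add: hilbert_dist_def Let_def far near r_def norm_minus_commute[of y x])
  also have "((1 + s) * r * ((1 + t) * r)) / (s * r * (t * r)) = ((1 + s) / s) * ((1 + t) / t)"
    using \<open>0 < r\<close> by simp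
  also have "ln (((1 + s) / s) * ((1 + t) / t)) = ln ((1 + s) / s) + ln ((1 + t) / t)"
    using s(1) t(1) by (intro ln_mult_pos) simp_all
  finally have d: "hilbert_dist X x y = ln ((1 + s) / s) + ln ((1 + t) / t)" .
  have "ln (aff j y) - ln (aff j x) = ln ((1 + s) / s)" "ln (aff i x) - ln (aff i y) = ln ((1 + t) / t)"
    using s(1,3,4) t(1,3,4) x y by (intro ratio_beyond_eq aff_pos; simp)+
  then have "hilbert_dist X x y = lr i j x - lr i j y"
    by (simp add: d lr_def)
  with d s t that show ?thesis by metis
qed

lemma lr_le_dist_general:
  assumes \<psi>: "\<And>z. z \<in> X \<Longrightarrow> 0 < aff \<psi> z" and \<eta>: "\<And>z. z \<in> X \<Longrightarrow> 0 < aff \<eta> z"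
    and x: "x \<in> X" and y: "y \<in> X"
  shows "lr \<psi> \<eta> x - lr \<psi> \<eta> y \<le> hilbert_dist X x y"
proof (cases "x = y")
  case True
  then show ?thesis by (simp add: hilbert_dist_def)
next
  case False
  obtain s t where st: "0 < s" "0 < t"
    "\<And>k. k \<in> I \<Longrightarrow> 0 \<le> aff k (x + s *\<^sub>R (x - y))"
    "\<And>k. k \<in> I \<Longrightarrow> 0 \<le> aff k (y + t *\<^sub>R (y - x))"
    "hilbert_dist X x y = ln ((1 + s) / s) + ln ((1 + t) / t)"
    using hilbert_dist_ends[OF x y False] by metis
  have nonneg: "0 \<le> aff \<omega> z" if \<omega>: "\<And>z. z \<in> X \<Longrightarrow> 0 < aff \<omega> z" and z: "\<And>k. k \<in> I \<Longrightarrow> 0 \<le> aff k z"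
    for \<omega> z
  proof (rule ccontr)
    assume neg: "\<not> 0 \<le> aff \<omega> z"
    \<comment> \<open>The zero of \<open>aff \<omega>\<close> on the segment from \<open>x\<close>
      to \<open>z\<close>, a point that still lies in \<open>X\<close>.\<close>
    define \<theta> where "\<theta> = aff \<omega> x / (aff \<omega> x - aff \<omega> z)"
    have "(1 - \<theta>) * aff \<omega> x + \<theta> * aff \<omega> z = 0" "0 \<le> \<theta>" "\<theta> < 1"
      using neg \<omega>[OF x] by (auto simp: \<theta>_def field_simps)
    then show False
      using \<omega>[OF segment_in_X[OF x z, of \<theta>]] by (simp add: aff_segment)
  qed
  have "ln (aff \<eta> y) - ln (aff \<eta> x) \<le> ln ((1 + s) / s)" "ln (aff \<psi> x) - ln (aff \<psi> y) \<le> ln ((1 + t) / t)"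
    using st(1,2) nonneg[of \<psi>, OF \<psi> st(4)] nonneg[of \<eta>, OF \<eta> st(3)] \<psi>[OF x] \<psi>[OF y] \<eta>[OF x] \<eta>[OF y]
    by (intro ratio_beyond; simp)+
  then show ?thesis by (simp add: st(5) lr_def)
qed

lemma lr_le_dist:
  assumes "i \<in> I" "j \<in> I" "x \<in> X" "y \<in> X"
  shows "lr i j x - lr i j y \<le> hilbert_dist X x y"
  using assms by (intro lr_le_dist_general aff_pos)

lemma I_nonempty: "I \<noteq> {}"
proof -
  obtain b :: 'a where "b \<in> Basis" using nonempty_Basis by blast
  then show ?thesis using recession_trivial[of b] nonzero_Basis by auto
qed

lemma dist_attained:
  assumes "x \<in> X" "y \<in> X"
  obtains i j where "i \<in> I" "j \<in> I" "hilbert_dist X x y = lr i j x - lr i j y"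
proof (cases "x = y")
  case True
  then show ?thesis using that I_nonempty by (auto simp: hilbert_dist_def)
next
  case False
  then show ?thesis using hilbert_dist_ends[OF assms] that by metis
qed

section \<open>Comparison with the Euclidean topology\<close>

lemma euclidean_le_dist:
  obtains R where "0 < R"
    "\<And>x y. x \<in> X \<Longrightarrow> y \<in> X \<Longrightarrow> dist x y \<le> R * (exp (hilbert_dist X x y) - 1)"
proof -
  obtain B where B: "0 < B" "\<And>y. y \<in> closure X \<Longrightarrow> norm y \<le> B"
    using bounded_closure[OF bounded_X] by (auto simp: bounded_pos)
  have "dist x y \<le> (2 * B) * (exp (hilbert_dist X x y) - 1)" if xy: "x \<in> X" "y \<in> X" for x y
  proof (cases "x = y")
    case True
    then show ?thesis by (simp add: hilbert_dist_def)
  next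
    case False
    obtain s t where st: "0 < s" "0 < t"
      "\<And>k. k \<in> I \<Longrightarrow> 0 \<le> aff k (x + s *\<^sub>R (x - y))"
      "hilbert_dist X x y = ln ((1 + s) / s) + ln ((1 + t) / t)"
      using hilbert_dist_ends[OF xy False] by metis
    have "norm (x + s *\<^sub>R (x - y)) \<le> B" "norm x \<le> B"
      using B(2) nonneg_in_closure[OF st(3)] xy(1) closure_subset by auto
    moreover have "s * norm (x - y) = norm ((x + s *\<^sub>R (x - y)) - x)" using st by simp
    ultimately have "s * dist x y \<le> 2 * B"
      using norm_triangle_ineq4[of "x + s *\<^sub>R (x - y)" x] unfolding dist_norm by linarith
    then have "dist x y \<le> 2 * B * (1 / s)"
      using st(1) by (simp add: field_simps)
    also have "1 / s \<le> exp (hilbert_dist X x y) - 1"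
    proof -
      have "exp (hilbert_dist X x y) = ((1 + s) / s) * ((1 + t) / t)"
        using st by (simp add: exp_add)
      moreover have "((1 + s) / s) * 1 \<le> ((1 + s) / s) * ((1 + t) / t)"
        using st by (intro mult_left_mono) (auto simp: field_simps)
      moreover have "(1 + s) / s = 1 / s + 1" using st by (simp add: field_simps)
      ultimately show ?thesis by linarith
    qed
    finally show ?thesis using B(1) by simp
  qed
  then show ?thesis using B(1) that[of "2 * B"] by simp
qed

lemma dist_eq_0:
  assumes "x \<in> X" "y \<in> X" "hilbert_dist X x y = 0"
  shows "x = y"
proof (rule euclidean_le_dist)
  fix R :: real
  assume "\<And>x y. x \<in> X \<Longrightarrow> y \<in> X \<Longrightarrow> dist x y \<le> R * (exp (hilbert_dist X x y) - 1)"
  from this[OF assms(1,2)] assms(3) show ?thesis by simp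
qed

lemma continuous_on_lr: "i \<in> I \<Longrightarrow> j \<in> I \<Longrightarrow> continuous_on X (lr i j)"
  unfolding lr_def by (intro continuous_intros) (simp_all add: X_eq less_imp_neq[THEN not_sym])

lemma dist_tendsto_0:
  assumes x: "x \<in> X"
  shows "((\<lambda>y. hilbert_dist X x y) \<longlongrightarrow> 0) (at x within X)"
proof -
  \<comment> \<open>Summing over all pairs majorises the maximum by a function that is visibly
    continuous and vanishes at \<open>x\<close>.\<close>
  define G where "G y = (\<Sum>i\<in>I. \<Sum>j\<in>I. \<bar>lr i j x - lr i j y\<bar>)" for y
  have lim: "((\<lambda>y. lr i j y) \<longlongrightarrow> lr i j x) (at x within X)" if "i \<in> I" "j \<in> I" for i j
    using continuous_on_lr[OF that] x unfolding continuous_on_def by blast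
  have "(G \<longlongrightarrow> (\<Sum>i\<in>I. \<Sum>j\<in>I. \<bar>lr i j x - lr i j x\<bar>)) (at x within X)"
    unfolding G_def by (intro tendsto_sum tendsto_rabs tendsto_diff tendsto_const lim)
  then have G: "(G \<longlongrightarrow> 0) (at x within X)" by simp
  have le: "0 \<le> hilbert_dist X x y \<and> hilbert_dist X x y \<le> G y" if y: "y \<in> X" for y
  proof
    obtain k where "k \<in> I" using I_nonempty by blast
    then show "0 \<le> hilbert_dist X x y" using lr_le_dist[of k k x y] x y by simp
    obtain i j where ij: "i \<in> I" "j \<in> I" "hilbert_dist X x y = lr i j x - lr i j y"
      using dist_attained[OF x y] by blast
    have "\<bar>lr i j x - lr i j y\<bar> \<le> (\<Sum>j\<in>I. \<bar>lr i j x - lr i j y\<bar>)"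
      by (rule member_le_sum[OF ij(2) _ finite_I]) simp
    also have "\<dots> \<le> G y"
      unfolding G_def by (rule member_le_sum[OF ij(1) _ finite_I]) (simp add: sum_nonneg)
    finally show "hilbert_dist X x y \<le> G y" using ij by linarith
  qed
  have "eventually (\<lambda>y. y \<in> X) (at x within X)" by (simp add: eventually_at_filter)
  then show ?thesis
    by (intro tendsto_sandwich[OF _ _ tendsto_const G]) (use le in \<open>auto elim!: eventually_mono\<close>)
qed

lemma isometry_continuous:
  assumes f: "\<And>x. x \<in> X \<Longrightarrow> f x \<in> X"
    and iso: "\<And>x y. x \<in> X \<Longrightarrow> y \<in> X \<Longrightarrow> hilbert_dist X (f x) (f y) = hilbert_dist X x y"
  shows "continuous_on X f"
  unfolding continuous_on_def
proof
  fix x assume x: "x \<in> X"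
  obtain R where R: "\<And>x y. x \<in> X \<Longrightarrow> y \<in> X \<Longrightarrow> dist x y \<le> R * (exp (hilbert_dist X x y) - 1)"
    by (rule euclidean_le_dist) blast
  have "((\<lambda>y. R * (exp (hilbert_dist X x y) - 1)) \<longlongrightarrow> R * (exp 0 - 1)) (at x within X)"
    by (intro tendsto_intros dist_tendsto_0 x)
  then have lim: "((\<lambda>y. R * (exp (hilbert_dist X x y) - 1)) \<longlongrightarrow> 0) (at x within X)" by simp
  have le: "dist (f y) (f x) \<le> R * (exp (hilbert_dist X x y) - 1)" if "y \<in> X" for y
    using R[OF f[OF x] f[OF that]] iso[OF x that] by (simp add: dist_commute)
  have "eventually (\<lambda>y. y \<in> X) (at x within X)" by (simp add: eventually_at_filter)
  then have "((\<lambda>y. dist (f y) (f x)) \<longlongrightarrow> 0) (at x within X)"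
    by (intro tendsto_sandwich[OF _ _ tendsto_const lim]) (use le in \<open>auto elim!: eventually_mono\<close>)
  then show "(f \<longlongrightarrow> f x) (at x within X)"
    by (rule tendsto_dist_iff[THEN iffD2])
qed

end

section \<open>Generic points and polynomial identities\<close>

lemma aff_zero_open:
  assumes "open W" "W \<noteq> {}" "\<And>x. x \<in> W \<Longrightarrow> aff m x = 0"
  shows "m = 0"
proof -
  obtain x where x: "x \<in> W" using assms by blast
  obtain e where e: "0 < e" "ball x e \<subseteq> W" using assms(1) x open_contains_ball by blast
  \<comment> \<open>Short enough to stay in the ball; the added 1 covers the case
    \<open>fst m = 0\<close>.\<close>
  define s where "s = e / 2 / (norm (fst m) + 1)"
  have pos: "0 < norm (fst m) + 1" by (intro add_nonneg_pos) simp_all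
  then have "0 < s" using e by (simp add: s_def)
  have "norm (s *\<^sub>R fst m) = e / 2 * (norm (fst m) / (norm (fst m) + 1))"
    using e(1) by (simp add: s_def)
  also have "\<dots> \<le> e / 2 * 1" using e(1) by (intro mult_left_mono) (simp_all add: divide_le_eq_1 pos)
  finally have "x + s *\<^sub>R fst m \<in> W" using e by (intro subsetD[OF e(2)]) (simp add: dist_norm)
  then have "s * inner (fst m) (fst m) = 0"
    using assms(3)[of "x + s *\<^sub>R fst m"] assms(3)[OF x] by (simp add: aff_add)
  then have "fst m = 0" using \<open>0 < s\<close> by simp
  then have "snd m = 0" using assms(3)[OF x] by (cases m) (simp add: aff_def inner_Pair)
  with \<open>fst m = 0\<close> show ?thesis by (simp add: prod_eq_iff)
qed

text \<open>On the segment from a point good for \<open>M\<close> to a point good for the new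
  \<open>m\<close>, each functional has at most one zero, so all but finitely many parameters give a
  common good point.\<close>

lemma aff_generic:
  assumes "finite M" "convex C" "C \<noteq> {}" "\<And>m. m \<in> M \<Longrightarrow> \<exists>x\<in>C. aff m x \<noteq> 0"
  shows "\<exists>x\<in>C. \<forall>m\<in>M. aff m x \<noteq> 0"
  using assms(1,4)
proof (induction M rule: finite_induct)
  case empty
  then show ?case using assms(3) by blast
next
  case (insert m M)
  obtain a where a: "a \<in> C" "\<forall>m\<in>M. aff m a \<noteq> 0" using insert by blast
  obtain b where b: "b \<in> C" "aff m b \<noteq> 0" using insert.prems by blast
  define T where "T k = {t. (1 - t) * aff k a + t * aff k b = 0}" for k
  have "finite (T k)" if "aff k a \<noteq> 0 \<or> aff k b \<noteq> 0" for k
  proof (rule finite_subset)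
    show "T k \<subseteq> {aff k a / (aff k a - aff k b)}"
    proof
      fix t assume "t \<in> T k"
      then have t: "t * (aff k a - aff k b) = aff k a" by (simp add: T_def algebra_simps)
      then have "aff k a - aff k b \<noteq> 0" using that by auto
      with t show "t \<in> {aff k a / (aff k a - aff k b)}" by (simp add: eq_divide_eq)
    qed
  qed simp
  then have "finite (\<Union>k\<in>insert m M. T k)" using insert.hyps a b by blast
  moreover have "infinite {0<..<1::real}" by (simp add: infinite_Ioo)
  ultimately obtain t where t: "t \<in> {0<..<1}" "t \<notin> (\<Union>k\<in>insert m M. T k)"
    by (meson finite_subset subsetI)
  then have "(1 - t) *\<^sub>R a + t *\<^sub>R b \<in> C"
    using assms(2) a b by (intro convexD_alt) auto
  then show ?case using t(2) unfolding T_def by (intro bexI[of _ "(1 - t) *\<^sub>R a + t *\<^sub>R b"]) (simp_all add: aff_segment)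
qed

text \<open>Being polynomial along every line is enough for the identity principle and stands in for
  multivariate polynomials.\<close>

definition line_poly :: "('a::real_vector \<Rightarrow> real) \<Rightarrow> bool" where
  "line_poly g \<longleftrightarrow> (\<forall>w u. \<exists>p. \<forall>t. g (w + t *\<^sub>R u) = poly p t)"

lemma line_poly_const [intro]: "line_poly (\<lambda>x. c)"
  unfolding line_poly_def by (intro allI exI[of _ "[:c:]"]) simp

lemma line_poly_aff [intro]: "line_poly (aff k)"
  unfolding line_poly_def
proof (intro allI exI)
  show "aff k (w + t *\<^sub>R u) = poly [:aff k w, inner (fst k) u:] t" for w u t
    by (simp add: aff_add)
qed

lemma line_poly_add [intro]: "line_poly g \<Longrightarrow> line_poly h \<Longrightarrow> line_poly (\<lambda>x. g x + h x)"
  unfolding line_poly_def by (metis poly_add)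

lemma line_poly_diff [intro]: "line_poly g \<Longrightarrow> line_poly h \<Longrightarrow> line_poly (\<lambda>x. g x - h x)"
  unfolding line_poly_def by (metis poly_diff)

lemma line_poly_mult [intro]: "line_poly g \<Longrightarrow> line_poly h \<Longrightarrow> line_poly (\<lambda>x. g x * h x)"
  unfolding line_poly_def by (metis poly_mult)

lemma line_poly_sum: "(\<And>i. i \<in> A \<Longrightarrow> line_poly (g i)) \<Longrightarrow> line_poly (\<lambda>x. \<Sum>i\<in>A. g i x)"
  by (induction A rule: infinite_finite_induct) auto

lemma line_poly_prod: "(\<And>i. i \<in> A \<Longrightarrow> line_poly (g i)) \<Longrightarrow> line_poly (\<lambda>x. \<Prod>i\<in>A. g i x)"
  by (induction A rule: infinite_finite_induct) auto

text \<open>Restricted to the line from a point of \<open>W\<close> to \<open>y\<close>, the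
  polynomial has infinitely many roots near the start, so it is zero.\<close>

lemma line_poly_zero:
  fixes g :: "'a::real_normed_vector \<Rightarrow> real"
  assumes "line_poly g" "open W" "W \<noteq> {}" "\<And>x. x \<in> W \<Longrightarrow> g x = 0"
  shows "g y = 0"
proof -
  obtain w where w: "w \<in> W" using assms by blast
  obtain p where p: "\<And>t. g (w + t *\<^sub>R (y - w)) = poly p t"
    using assms(1) unfolding line_poly_def by blast
  have "((\<lambda>t. w + t *\<^sub>R (y - w)) \<longlongrightarrow> w + 0 *\<^sub>R (y - w)) (at_right 0)"
    by (intro tendsto_intros)
  then have "eventually (\<lambda>t. w + t *\<^sub>R (y - w) \<in> W) (at_right 0)"
    using topological_tendstoD[OF _ assms(2)] w by simp
  then obtain b where b: "0 < b" "\<And>t. 0 < t \<Longrightarrow> t < b \<Longrightarrow> w + t *\<^sub>R (y - w) \<in> W"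
    unfolding eventually_at_right_field by blast
  have "{0<..<b} \<subseteq> {t. poly p t = 0}"
    using b(2) assms(4) by (auto simp flip: p)
  then have "infinite {t. poly p t = 0}"
    using b(1) infinite_Ioo finite_subset by blast
  then have "p = 0" using poly_roots_finite by blast
  then show ?thesis using p[of 1] by simp
qed

lemma line_poly_eq:
  fixes g :: "'a::real_normed_vector \<Rightarrow> real"
  assumes "line_poly g" "line_poly h" "open W" "W \<noteq> {}" "\<And>x. x \<in> W \<Longrightarrow> g x = h x"
  shows "g y = h y"
  using line_poly_zero[of "\<lambda>x. g x - h x" W y] assms by (simp add: line_poly_diff)

context polytope
begin

section \<open>Bridges between facets\<close>

text \<open>The relative interior of a facet: the strict inequalities leave out the
  lower-dimensional faces.\<close>

definition facet :: "'a \<times> real \<Rightarrow> 'a set" where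
  "facet k = {p. aff k p = 0 \<and> (\<forall>l\<in>I - {k}. 0 < aff l p)}"

text \<open>The union of the open segments from \<open>facet i\<close> to \<open>facet j\<close>, written so that it is visibly open:
  for \<open>q\<close> as below the line from \<open>q\<close> through \<open>y\<close> leaves \<open>X\<close> in the relative interior of \<open>facet i\<close>.\<close>

definition bridge :: "'a \<times> real \<Rightarrow> 'a \<times> real \<Rightarrow> 'a set" where
  "bridge i j = {y \<in> X. \<exists>q\<in>facet j. \<forall>l\<in>I - {i}. aff l q * aff i y < aff i q * aff l y}"

text \<open>By the maximum formula the distance of \<open>x\<close> and \<open>y\<close> is the
  largest of these numbers minus the smallest.\<close>

definition gap :: "'a \<times> real \<Rightarrow> 'a \<Rightarrow> 'a \<Rightarrow> real" where
  "gap k x y = ln (aff k x) - ln (aff k y)"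

text \<open>Among all pairs of facet functionals, \<open>(i, j)\<close> is the only one realising the distance of \<open>x\<close> and \<open>y\<close>:
  the line from \<open>x\<close> to \<open>y\<close> leaves \<open>X\<close> through \<open>facet i\<close> and enters it through \<open>facet j\<close>.\<close>

definition strict :: "'a \<times> real \<Rightarrow> 'a \<times> real \<Rightarrow> 'a \<Rightarrow> 'a \<Rightarrow> bool" where
  "strict i j x y \<longleftrightarrow> (\<forall>k\<in>I - {i}. gap k x y < gap i x y) \<and> (\<forall>l\<in>I - {j}. gap j x y < gap l x y)"

lemma mem_X: "x \<in> X \<longleftrightarrow> (\<forall>k\<in>I. 0 < aff k x)"
  by (simp add: X_eq)

lemma facet_zero: "p \<in> facet k \<Longrightarrow> aff k p = 0"
  by (simp add: facet_def)

lemma facet_pos: "p \<in> facet k \<Longrightarrow> l \<in> I \<Longrightarrow> l \<noteq> k \<Longrightarrow> 0 < aff l p"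
  by (simp add: facet_def)

lemma facet_nonneg: "p \<in> facet k \<Longrightarrow> l \<in> I \<Longrightarrow> 0 \<le> aff l p"
  by (cases "l = k") (simp_all add: facet_zero facet_pos less_imp_le)

lemma facet_point:
  assumes "k \<in> I" obtains p where "p \<in> facet k"
  using irredundant[OF assms] unfolding facet_def by blast

lemma convex_facet: "convex (facet k)"
proof (rule convexI)
  fix x y :: 'a and u v :: real
  assume *: "x \<in> facet k" "y \<in> facet k" "0 \<le> u" "0 \<le> v" "u + v = 1"
  then have u: "u = 1 - v" and "v \<le> 1" by simp_all
  have "0 < (1 - v) * aff l x + v * aff l y" if "l \<in> I - {k}" for l
  proof (cases "v = 1")
    case True
    then show ?thesis using * that facet_pos by simp
  next
    case False
    then show ?thesis using * that facet_pos[of _ k l] \<open>v \<le> 1\<close>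
      by (intro add_pos_nonneg mult_pos_pos mult_nonneg_nonneg) (simp_all add: less_imp_le)
  qed
  then show "u *\<^sub>R x + v *\<^sub>R y \<in> facet k"
    using * unfolding facet_def u by (simp add: aff_segment)
qed

lemma facet_not_prop:
  assumes "k \<in> I" "l \<in> I" "k \<noteq> l" "\<And>x. c * aff k x = d * aff l x"
  shows "c = 0 \<and> d = 0"
proof -
  obtain p q where "p \<in> facet k" "q \<in> facet l" using facet_point assms by metis
  then show ?thesis
    using assms(4)[of p] assms(4)[of q] facet_pos[of p k l] facet_pos[of q l k] assms(1,2,3)
    by (simp add: facet_zero)
qed

lemma open_bridge: "open (bridge i j)"
proof -
  have "bridge i j = X \<inter> (\<Union>q\<in>facet j. \<Inter>l\<in>I - {i}. {y. aff l q * aff i y < aff i q * aff l y})"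
    unfolding bridge_def by blast
  moreover have "open (\<Inter>l\<in>I - {i}. {y. aff l q * aff i y < aff i q * aff l y})" for q
    using finite_I by (intro open_INT ballI open_Collect_less continuous_intros) simp
  ultimately show ?thesis using open_X by (simp add: open_Int open_UN)
qed

lemma bridge_subset: "bridge i j \<subseteq> X"
  unfolding bridge_def by blast

lemma segment_in_bridge:
  assumes "i \<in> I" "j \<in> I" "i \<noteq> j" and p: "p \<in> facet i" and q: "q \<in> facet j" and t: "0 < t" "t < 1"
  shows "(1 - t) *\<^sub>R p + t *\<^sub>R q \<in> bridge i j"
proof -
  have iq: "0 < aff i q" using facet_pos[OF q] assms by blast
  have "0 < aff l ((1 - t) *\<^sub>R p + t *\<^sub>R q)" if "l \<in> I" for l
  proof (cases "l = i")
    case True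
    then show ?thesis using t iq by (simp add: aff_segment facet_zero[OF p])
  next
    case False
    then show ?thesis using t facet_pos[OF p that False] facet_nonneg[OF q that]
      by (simp add: aff_segment add_pos_nonneg)
  qed
  moreover have "aff l q * aff i ((1 - t) *\<^sub>R p + t *\<^sub>R q) < aff i q * aff l ((1 - t) *\<^sub>R p + t *\<^sub>R q)"
    if "l \<in> I - {i}" for l
  proof -
    have "0 < aff i q * ((1 - t) * aff l p)"
      using facet_pos[OF p, of l] that t iq by simp
    then show ?thesis
      unfolding aff_segment facet_zero[OF p] by (simp add: algebra_simps)
  qed
  ultimately show ?thesis using q unfolding bridge_def mem_X by blast
qed

lemma bridge_segment:
  assumes "i \<in> I" "j \<in> I" "i \<noteq> j" and y: "y \<in> bridge i j"
  obtains p q t where "p \<in> facet i" "q \<in> facet j" "0 < t" "t < 1" "y = (1 - t) *\<^sub>R p + t *\<^sub>R q"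
proof -
  obtain q where q: "q \<in> facet j" and yX: "y \<in> X"
    and lt: "\<And>l. l \<in> I - {i} \<Longrightarrow> aff l q * aff i y < aff i q * aff l y"
    using y unfolding bridge_def by blast
  have iq: "0 < aff i q" using facet_pos[OF q] assms by blast
  have iy: "0 < aff i y" using aff_pos yX assms by blast
  \<comment> \<open>In \<open>y = (1 - t) p + t q\<close> with \<open>aff i p = 0\<close>, the
    weight of \<open>q\<close> has to be this quotient.\<close>
  define t where "t = aff i y / aff i q"
  have "0 < t" using iq iy by (simp add: t_def)
  have lt': "t * aff l q < aff l y" if "l \<in> I - {i}" for l
    using lt[OF that] iq by (simp add: t_def field_simps)
  have "t < 1"
  proof (rule ccontr)
    assume "\<not> t < 1"
    \<comment> \<open>For \<open>t \<ge> 1\<close> no functional decreases from \<open>q\<close> to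
      \<open>y\<close>, so \<open>y - q\<close> is a recession direction.\<close>
    have "0 \<le> inner (fst l) (y - q)" if "l \<in> I" for l
    proof (cases "l = i")
      case True
      then show ?thesis using \<open>\<not> t < 1\<close> iq by (simp add: inner_fst_diff t_def)
    next
      case False
      then have "1 * aff l q \<le> t * aff l q" "t * aff l q < aff l y"
        using \<open>\<not> t < 1\<close> lt'[of l] that facet_nonneg[OF q that] mult_right_mono[of 1 t "aff l q"] by simp_all
      then show ?thesis by (simp add: inner_fst_diff)
    qed
    then have "y - q = 0" by (rule recession_trivial)
    then show False using facet_zero[OF q] aff_pos[OF yX \<open>j \<in> I\<close>] by simp
  qed
  define p where "p = y + (t / (1 - t)) *\<^sub>R (y - q)"
  have p: "aff l p = (aff l y - t * aff l q) / (1 - t)" for l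
  proof -
    have "1 + t / (1 - t) = 1 / (1 - t)" using \<open>t < 1\<close> by (simp add: field_simps)
    then show ?thesis unfolding p_def aff_beyond by (simp add: diff_divide_distrib)
  qed
  have "p \<in> facet i"
  proof -
    have "aff i p = 0" unfolding p using iq by (simp add: t_def)
    moreover have "0 < aff l p" if "l \<in> I - {i}" for l
      unfolding p using \<open>t < 1\<close> lt'[OF that] by simp
    ultimately show ?thesis unfolding facet_def by blast
  qed
  moreover have "y = (1 - t) *\<^sub>R p + t *\<^sub>R q"
  proof -
    have "(1 - t) *\<^sub>R p = (1 - t) *\<^sub>R y + t *\<^sub>R (y - q)"
      using \<open>t < 1\<close> unfolding p_def scaleR_add_right by simp
    then show ?thesis by (simp add: algebra_simps)
  qed
  ultimately show ?thesis using that q \<open>0 < t\<close> \<open>t < 1\<close> by blast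
qed

text \<open>The definition treats \<open>i\<close> and \<open>j\<close> differently, but a segment
  can be traversed in either direction.\<close>

lemma bridge_sym:
  assumes "i \<in> I" "j \<in> I" "i \<noteq> j"
  shows "bridge i j = bridge j i"
proof -
  have "bridge i j \<subseteq> bridge j i" if ij: "i \<in> I" "j \<in> I" "i \<noteq> j" for i j
  proof
    fix y assume "y \<in> bridge i j"
    obtain p q t where pq: "p \<in> facet i" "q \<in> facet j" "0 < t" "t < 1" "y = (1 - t) *\<^sub>R p + t *\<^sub>R q"
      by (rule bridge_segment[OF ij \<open>y \<in> bridge i j\<close>])
    then show "y \<in> bridge j i"
      using segment_in_bridge[of j i q p "1 - t"] ij by (simp add: add.commute)
  qed
  then show ?thesis using assms by (simp add: subset_antisym)
qed

text \<open>Two facet points and a weight parametrise the bridge by a product of convex sets.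
  Connectedness later makes a locally constant image pair constant on the whole bridge.\<close>

lemma connected_bridge:
  assumes "i \<in> I" "j \<in> I" "i \<noteq> j"
  shows "connected (bridge i j)"
proof -
  define g where "g = (\<lambda>(p, q, t). (1 - t) *\<^sub>R p + t *\<^sub>R q :: 'a)"
  have "bridge i j = g ` (facet i \<times> facet j \<times> {0<..<1})"
  proof (intro equalityI subsetI)
    fix y assume "y \<in> bridge i j"
    obtain p q t where "p \<in> facet i" "q \<in> facet j" "0 < t" "t < 1" "y = (1 - t) *\<^sub>R p + t *\<^sub>R q"
      by (rule bridge_segment[OF assms \<open>y \<in> bridge i j\<close>])
    then show "y \<in> g ` (facet i \<times> facet j \<times> {0<..<1})"
      by (intro image_eqI[of _ _ "(p, q, t)"]) (simp_all add: g_def)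
  next
    fix y assume "y \<in> g ` (facet i \<times> facet j \<times> {0<..<1})"
    then show "y \<in> bridge i j"
      using segment_in_bridge[OF assms] by (auto simp: g_def)
  qed
  moreover have "continuous_on (facet i \<times> facet j \<times> {0<..<1}) g"
    unfolding g_def case_prod_unfold by (intro continuous_intros)
  moreover have "connected (facet i \<times> facet j \<times> {0<..<1::real})"
    by (intro connected_Times convex_connected convex_facet convex_real_interval)
  ultimately show ?thesis using connected_continuous_image by metis
qed

lemma lr_diff_gap: "lr i j x - lr i j y = gap i x y - gap j x y"
  by (simp add: lr_def gap_def)

text \<open>Strictness makes \<open>i\<close> the only maximiser and \<open>j\<close> the only
  minimiser of \<open>gap\<close>.\<close>

lemma strict_attained:
  assumes "i \<in> I" "j \<in> I" "x \<in> X" "y \<in> X" "strict i j x y" "k \<in> I" "l \<in> I"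
  shows "hilbert_dist X x y = lr k l x - lr k l y \<longleftrightarrow> k = i \<and> l = j"
proof -
  have *: "gap k x y \<le> gap i x y" "gap k x y = gap i x y \<Longrightarrow> k = i"
    "gap j x y \<le> gap k x y" "gap j x y = gap k x y \<Longrightarrow> k = j" if "k \<in> I" for k
  proof -
    have "k = i \<or> gap k x y < gap i x y" "k = j \<or> gap j x y < gap k x y"
      using assms(5) that unfolding strict_def by blast+
    then show "gap k x y \<le> gap i x y" "gap k x y = gap i x y \<Longrightarrow> k = i"
      "gap j x y \<le> gap k x y" "gap j x y = gap k x y \<Longrightarrow> k = j"
      by force+
  qed
  obtain a b where ab: "a \<in> I" "b \<in> I" "hilbert_dist X x y = lr a b x - lr a b y"
    using dist_attained assms(3,4) by metis
  have "lr i j x - lr i j y \<le> hilbert_dist X x y"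
    using assms by (intro lr_le_dist)
  then have "hilbert_dist X x y = gap i x y - gap j x y"
    using ab *(1)[OF ab(1)] *(3)[OF ab(2)] unfolding lr_diff_gap by linarith
  then show ?thesis
    unfolding lr_diff_gap using *(1,2)[OF assms(6)] *(3,4)[OF assms(7)] by (smt (verit))
qed

text \<open>Without logarithms the comparison is affine in each of \<open>x\<close> and
  \<open>y\<close>, which shows that strictness is an open condition.\<close>

lemma gap_less_iff:
  assumes "x \<in> X" "y \<in> X" "k \<in> I" "l \<in> I"
  shows "gap k x y < gap l x y \<longleftrightarrow> aff k x * aff l y < aff l x * aff k y"
proof -
  have pos: "0 < aff k x" "0 < aff k y" "0 < aff l x" "0 < aff l y" using assms aff_pos by blast+
  have "gap k x y < gap l x y \<longleftrightarrow> ln (aff k x * aff l y) < ln (aff l x * aff k y)"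
    using pos by (simp add: gap_def ln_mult_pos algebra_simps)
  also have "\<dots> \<longleftrightarrow> aff k x * aff l y < aff l x * aff k y"
    using pos by (intro ln_less_cancel_iff) simp_all
  finally show ?thesis .
qed

text \<open>The parameter is the weight of \<open>q\<close>, so for \<open>s < t\<close> the motion
  from \<open>?x\<close> to \<open>?y\<close> goes from the side of \<open>facet j\<close> towards
  \<open>facet i\<close>.\<close>

lemma strict_segment:
  assumes ij: "i \<in> I" "j \<in> I" "i \<noteq> j" and p: "p \<in> facet i" and q: "q \<in> facet j"
    and st: "0 < s" "s < t" "t < 1"
  shows "strict i j ((1 - t) *\<^sub>R p + t *\<^sub>R q) ((1 - s) *\<^sub>R p + s *\<^sub>R q)" (is "strict i j ?x ?y")
proof -
  have X: "?x \<in> X" "?y \<in> X"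
    using segment_in_bridge[OF ij p q, of t] segment_in_bridge[OF ij p q, of s] bridge_subset[of i j] st
    by (metis less_trans subsetD)+
  have 1: "aff k ?x * aff i ?y < aff i ?x * aff k ?y" if "k \<in> I - {i}" for k
  proof -
    have "0 < (t - s) * (aff i q * aff k p)"
      using st facet_pos[OF q ij(1,3)] facet_pos[OF p, of k] that by simp
    then show ?thesis unfolding aff_segment facet_zero[OF p] by (simp add: algebra_simps)
  qed
  have 2: "aff j ?x * aff l ?y < aff l ?x * aff j ?y" if "l \<in> I - {j}" for l
  proof -
    have "0 < (t - s) * (aff j p * aff l q)"
      using st facet_pos[OF p ij(2)] ij(3) facet_pos[OF q, of l] that by simp
    then show ?thesis unfolding aff_segment facet_zero[OF q] by (simp add: algebra_simps)
  qed
  show ?thesis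
    unfolding strict_def using gap_less_iff[OF X] 1 2 ij(1,2) by (metis DiffD1)
qed

lemma bridge_strict_future:
  assumes "i \<in> I" "j \<in> I" "i \<noteq> j" "y \<in> bridge i j"
  obtains z where "z \<in> X" "strict i j y z"
proof -
  obtain p q t where pq: "p \<in> facet i" "q \<in> facet j" "0 < t" "t < 1" "y = (1 - t) *\<^sub>R p + t *\<^sub>R q"
    by (rule bridge_segment[OF assms])
  show ?thesis
    using strict_segment[OF assms(1-3) pq(1,2), of "t / 2" t] pq(3-5)
      segment_in_bridge[OF assms(1-3) pq(1,2), of "t / 2"] bridge_subset[of i j]
    by (intro that[of "(1 - t / 2) *\<^sub>R p + (t / 2) *\<^sub>R q"]) auto
qed

lemma bridge_strict_past:
  assumes "i \<in> I" "j \<in> I" "i \<noteq> j" "y \<in> bridge i j"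
  obtains x where "x \<in> X" "strict i j x y"
proof -
  obtain p q t where pq: "p \<in> facet i" "q \<in> facet j" "0 < t" "t < 1" "y = (1 - t) *\<^sub>R p + t *\<^sub>R q"
    by (rule bridge_segment[OF assms])
  define r where "r = (1 + t) / 2"
  have r: "t < r" "0 < r" "r < 1" using pq by (simp_all add: r_def)
  show ?thesis
    using strict_segment[OF assms(1-3) pq(1,2,3) r(1,3)] pq(5)
      segment_in_bridge[OF assms(1-3) pq(1,2) r(2,3)] bridge_subset[of i j]
    by (intro that[of "(1 - r) *\<^sub>R p + r *\<^sub>R q"]) auto
qed

lemma between_ends:
  fixes x y :: 'a
  assumes "0 < s" "0 < t"
  defines "p \<equiv> y + t *\<^sub>R (y - x)" and "q \<equiv> x + s *\<^sub>R (x - y)"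
  obtains \<tau> \<tau>' where "0 < \<tau>" "\<tau> < 1" "y = (1 - \<tau>) *\<^sub>R p + \<tau> *\<^sub>R q"
    "0 < \<tau>'" "\<tau>' < 1" "x = (1 - \<tau>') *\<^sub>R p + \<tau>' *\<^sub>R q"
proof -
  \<comment> \<open>The length of the whole chord in units of \<open>x - y\<close>.\<close>
  define \<sigma> where "\<sigma> = 1 + s + t"
  have \<sigma>: "\<sigma> \<noteq> 0" using assms by (simp add: \<sigma>_def)
  have pq: "p + r *\<^sub>R (q - p) = y + (t - r * \<sigma>) *\<^sub>R (y - x)" for r
    by (simp add: p_def q_def \<sigma>_def algebra_simps)
  have conv: "(1 - r) *\<^sub>R p + r *\<^sub>R q = p + r *\<^sub>R (q - p)" for r
    by (simp add: algebra_simps)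
  have "y = (1 - t / \<sigma>) *\<^sub>R p + (t / \<sigma>) *\<^sub>R q" "x = (1 - (1 + t) / \<sigma>) *\<^sub>R p + ((1 + t) / \<sigma>) *\<^sub>R q"
    using \<sigma> unfolding conv pq by simp_all
  moreover have "0 < t / \<sigma>" "t / \<sigma> < 1" "0 < (1 + t) / \<sigma>" "(1 + t) / \<sigma> < 1"
    using assms by (simp_all add: \<sigma>_def)
  ultimately show ?thesis using that by blast
qed

text \<open>Converse to \<open>strict_segment\<close>: the chord ends at zeros of \<open>i\<close>
  and \<open>j\<close> because the maximising pair is unique, and the strict inequalities keep all
  other functionals positive at these ends.\<close>

lemma strict_bridge:
  assumes ij: "i \<in> I" "j \<in> I" "i \<noteq> j" and X: "x \<in> X" "y \<in> X" and st: "strict i j x y"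
  shows "x \<in> bridge i j" "y \<in> bridge i j"
proof -
  have "x \<noteq> y"
  proof
    assume "x = y"
    then have "gap j x y = gap i x y" by (simp add: gap_def)
    moreover have "gap j x y < gap i x y" using st ij unfolding strict_def by blast
    ultimately show False by simp
  qed
  obtain s t a b where e: "0 < s" "0 < t" "a \<in> I" "b \<in> I"
    "aff b (x + s *\<^sub>R (x - y)) = 0" "aff a (y + t *\<^sub>R (y - x)) = 0"
    "hilbert_dist X x y = lr a b x - lr a b y"
    using hilbert_dist_ends[OF X \<open>x \<noteq> y\<close>] by metis
  have "a = i" "b = j"
    using strict_attained[OF ij(1,2) X st e(3,4)] e(7) by simp_all
  define p q where "p = y + t *\<^sub>R (y - x)" and "q = x + s *\<^sub>R (x - y)"
  have "0 < aff k p" if k: "k \<in> I - {i}" for k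
  proof -
    have "aff k x * aff i y < aff i x * aff k y"
      using st k gap_less_iff[OF X _ ij(1), of k] unfolding strict_def by blast
    then have "aff k x * aff i y * t < aff i x * t * aff k y" using e(2) by simp
    also have "aff i x * t = (1 + t) * aff i y"
      using e(6) unfolding \<open>a = i\<close> aff_beyond by (simp add: mult.commute)
    finally have "0 < aff i y * ((1 + t) * aff k y - t * aff k x)" by (simp add: algebra_simps)
    then show ?thesis
      using aff_pos[OF X(2) ij(1)] by (simp add: p_def aff_beyond zero_less_mult_iff)
  qed
  then have p: "p \<in> facet i" using e(6) by (simp add: facet_def p_def \<open>a = i\<close>)
  have "0 < aff k q" if k: "k \<in> I - {j}" for k
  proof -
    have "aff j x * aff k y < aff k x * aff j y"
      using st k gap_less_iff[OF X ij(2), of k] unfolding strict_def by blast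
    then have "aff j x * aff k y * s < aff j y * s * aff k x" using e(1) by (simp add: mult.commute)
    also have "aff j y * s = (1 + s) * aff j x"
      using e(5) unfolding \<open>b = j\<close> aff_beyond by (simp add: mult.commute)
    finally have "0 < aff j x * ((1 + s) * aff k x - s * aff k y)" by (simp add: algebra_simps)
    then show ?thesis
      using aff_pos[OF X(1) ij(2)] by (simp add: q_def aff_beyond zero_less_mult_iff)
  qed
  then have q: "q \<in> facet j" using e(5) by (simp add: facet_def q_def \<open>b = j\<close>)
  show "x \<in> bridge i j" "y \<in> bridge i j"
    using between_ends[OF e(1,2), of y x] segment_in_bridge[OF ij p q] unfolding p_def q_def by metis+
qed

lemma strict_neq: 
  assumes "2 \<le> card I" "i \<in> I" "strict i j x y" shows "i \<noteq> j"
proof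
  assume "i = j"
  obtain k where "k \<in> I" "k \<noteq> i"
    using assms(1,2) by (metis card_1_singleton_iff card_le_Suc0_iff_eq finite_I not_less_eq_eq numeral_2_eq_2 One_nat_def)
  then show False using assms(3) \<open>i = j\<close> unfolding strict_def by (metis Diff_iff less_asym singletonD)
qed

text \<open>The ends of the chord may lie on lower-dimensional faces. Moving them slightly towards
  points of \<open>facet i\<close> and \<open>facet j\<close> gives segments in the bridge that
  converge to the chord.\<close>

lemma attained_in_closure_bridge:
  assumes X: "x \<in> X" "y \<in> X" "x \<noteq> y"
  obtains i j where "i \<in> I" "j \<in> I" "i \<noteq> j" "hilbert_dist X x y = lr i j x - lr i j y"
    "x \<in> closure (bridge i j)" "y \<in> closure (bridge i j)"
proof -
  obtain s t i j where e: "0 < s" "0 < t" "i \<in> I" "j \<in> I"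
    "aff j (x + s *\<^sub>R (x - y)) = 0" "\<forall>k\<in>I. 0 \<le> aff k (x + s *\<^sub>R (x - y))"
    "aff i (y + t *\<^sub>R (y - x)) = 0" "\<forall>k\<in>I. 0 \<le> aff k (y + t *\<^sub>R (y - x))"
    "hilbert_dist X x y = lr i j x - lr i j y"
    using hilbert_dist_ends[OF X] by metis
  define p q where "p = y + t *\<^sub>R (y - x)" and "q = x + s *\<^sub>R (x - y)"
  obtain \<tau> \<tau>' where \<tau>: "0 < \<tau>" "\<tau> < 1" "y = (1 - \<tau>) *\<^sub>R p + \<tau> *\<^sub>R q"
    "0 < \<tau>'" "\<tau>' < 1" "x = (1 - \<tau>') *\<^sub>R p + \<tau>' *\<^sub>R q"
    using between_ends[OF e(1,2), of y x] unfolding p_def q_def by metis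
  have "i \<noteq> j"
  proof
    assume "i = j"
    then have "aff i x = 0"
      using e(5,7) arg_cong[OF \<tau>(6), of "aff i"] unfolding aff_segment p_def q_def by simp
    then show False using aff_pos[OF X(1) e(3)] by simp
  qed
  obtain p' q' where p': "p' \<in> facet i" and q': "q' \<in> facet j" using facet_point e by metis
  have approach: "(1 - r) *\<^sub>R a + r *\<^sub>R a' \<in> facet m"
    if "a' \<in> facet m" "aff m a = 0" "\<forall>k\<in>I. 0 \<le> aff k a" "0 < r" "r \<le> 1" for m a a' r
    using that unfolding facet_def by (simp add: aff_segment add_nonneg_pos)
  define r :: "nat \<Rightarrow> real" where "r n = 1 / real (Suc n)" for n
  have r: "0 < r n" "r n \<le> 1" for n by (simp_all add: r_def)
  have r0: "r \<longlonglongrightarrow> 0" unfolding r_def by (intro LIMSEQ_Suc lim_const_over_n)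
  define P Q where "P n = (1 - r n) *\<^sub>R p + r n *\<^sub>R p'" and "Q n = (1 - r n) *\<^sub>R q + r n *\<^sub>R q'" for n
  have "P n \<in> facet i" "Q n \<in> facet j" for n
    unfolding P_def Q_def using p' q' e(5-8) r by (auto intro!: approach simp: p_def q_def)
  note PQ = this
  have "P \<longlonglongrightarrow> (1 - 0) *\<^sub>R p + 0 *\<^sub>R p'" "Q \<longlonglongrightarrow> (1 - 0) *\<^sub>R q + 0 *\<^sub>R q'"
    unfolding P_def Q_def by (intro tendsto_intros r0)+
  then have lim: "P \<longlonglongrightarrow> p" "Q \<longlonglongrightarrow> q" by simp_all
  have "(1 - c) *\<^sub>R p + c *\<^sub>R q \<in> closure (bridge i j)" if "0 < c" "c < 1" for c
  proof -
    have "(\<lambda>n. (1 - c) *\<^sub>R P n + c *\<^sub>R Q n) \<longlonglongrightarrow> (1 - c) *\<^sub>R p + c *\<^sub>R q"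
      by (intro tendsto_intros lim)
    moreover have "(1 - c) *\<^sub>R P n + c *\<^sub>R Q n \<in> bridge i j" for n
      using segment_in_bridge[OF e(3,4) \<open>i \<noteq> j\<close> PQ that] .
    ultimately show ?thesis unfolding closure_sequential
      by (intro exI[of _ "\<lambda>n. (1 - c) *\<^sub>R P n + c *\<^sub>R Q n"]) blast
  qed
  from this[OF \<tau>(4,5)] this[OF \<tau>(1,2)]
  have "x \<in> closure (bridge i j)" "y \<in> closure (bridge i j)"
    by (simp_all flip: \<tau>(3,6))
  with e \<open>i \<noteq> j\<close> that show ?thesis by blast
qed

lemma card_ge_2: "2 \<le> card I"
proof -
  obtain x where x: "x \<in> X" using X_nonempty by blast
  obtain b :: 'a where b: "b \<in> Basis" using nonempty_Basis by blast
  obtain e where e: "0 < e" "ball x e \<subseteq> X" using open_X x open_contains_ball by blast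
  define y where "y = x + (e / 2) *\<^sub>R b"
  have "y \<in> X" using b e by (intro subsetD[OF e(2)]) (simp add: y_def dist_norm)
  moreover have "x \<noteq> y" using b e nonzero_Basis by (auto simp: y_def)
  ultimately obtain i j where "i \<in> I" "j \<in> I" "i \<noteq> j"
    using attained_in_closure_bridge[OF x] by metis
  then show ?thesis using finite_I by (metis card_2_iff card_mono empty_subsetI insert_subset)
qed

lemma open_strict_past:
  assumes "i \<in> I" "j \<in> I" "y \<in> X" shows "open {x \<in> X. strict i j x y}"
proof -
  have "{x \<in> X. strict i j x y} = X \<inter> (\<Inter>k\<in>I - {i}. {x. aff k x * aff i y < aff i x * aff k y})
    \<inter> (\<Inter>l\<in>I - {j}. {x. aff j x * aff l y < aff l x * aff j y})"
    using gap_less_iff[OF _ assms(3)] assms(1,2) unfolding strict_def by blast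
  then show ?thesis
    using finite_I open_X by (simp add: open_Int open_INT open_Collect_less continuous_on_mult continuous_on_aff continuous_on_const)
qed

lemma open_strict_future:
  assumes "i \<in> I" "j \<in> I" "x \<in> X" shows "open {y \<in> X. strict i j x y}"
proof -
  have "{y \<in> X. strict i j x y} = X \<inter> (\<Inter>k\<in>I - {i}. {y. aff k x * aff i y < aff i x * aff k y})
    \<inter> (\<Inter>l\<in>I - {j}. {y. aff j x * aff l y < aff l x * aff j y})"
    using gap_less_iff[OF assms(3)] assms(1,2) unfolding strict_def by blast
  then show ?thesis
    using finite_I open_X by (simp add: open_Int open_INT open_Collect_less continuous_on_mult continuous_on_aff continuous_on_const)
qed

end

section \<open>Rigidity of logarithmic ratios, and generic pairs of points\<close>

lemma aff_scaled_diff: "aff (c *\<^sub>R k - d *\<^sub>R l) x = c * aff k x - d * aff l x"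
  by (simp add: aff_def inner_diff_left)

context polytope
begin

lemma bridge_nonempty:
  assumes "i \<in> I" "j \<in> I" "i \<noteq> j" shows "bridge i j \<noteq> {}"
proof -
  obtain p q where "p \<in> facet i" "q \<in> facet j" using facet_point assms by metis
  then show ?thesis using segment_in_bridge[OF assms, of p q "1/2"] by auto
qed

text \<open>Exponentiation gives a polynomial identity valid everywhere. On \<open>facet k\<close>
  its left side vanishes while \<open>l\<close> is positive, so \<open>k'\<close> vanishes there
  too; a point of \<open>facet l'\<close> then identifies \<open>l\<close>.\<close>

lemma lr_eq_const:
  assumes I: "k \<in> I" "l \<in> I" "k \<noteq> l" "k' \<in> I" "l' \<in> I" "k' \<noteq> l'"
    and W: "open W" "W \<noteq> {}" "W \<subseteq> X"
    and eq: "\<And>x. x \<in> W \<Longrightarrow> lr k l x = lr k' l' x + c"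
  shows "k = k' \<and> l = l'"
proof -
  have eqW: "aff k x * aff l' x = exp c * (aff l x * aff k' x)" if "x \<in> W" for x
  proof -
    have pos: "0 < aff k x" "0 < aff l x" "0 < aff k' x" "0 < aff l' x"
      using aff_pos[of x] W that I by blast+
    have "ln (aff k x * aff l' x) = ln (exp c * (aff l x * aff k' x))"
      using eq[OF that] pos by (simp add: lr_def ln_mult_pos)
    then show ?thesis using pos by (subst (asm) ln_inj_iff) simp_all
  qed
  have all: "aff k y * aff l' y = exp c * (aff l y * aff k' y)" for y
    by (rule line_poly_eq[of "\<lambda>y. aff k y * aff l' y" "\<lambda>y. exp c * (aff l y * aff k' y)", OF _ _ W(1,2) eqW])
      (intro line_poly_mult line_poly_aff line_poly_const)+
  obtain p where p: "p \<in> facet k" using facet_point I by blast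
  obtain q where q: "q \<in> facet l'" using facet_point I by blast
  have k: "k' = k"
    using all[of p] facet_zero[OF p] facet_pos[OF p, of l] facet_pos[OF p, of k'] I
    by force
  have "l = l'"
    using all[of q] facet_zero[OF q] facet_pos[OF q, of l] facet_pos[OF q, of k] I k
    by force
  with k show ?thesis by simp
qed

text \<open>The instance of unique factorisation that is needed: at a point of
  \<open>facet a\<close> the cubic identity forces \<open>a\<close> to cancel against
  \<open>d\<close> or to match \<open>e\<close>, and the rest is \<open>lr_eq_const\<close>.\<close>

lemma lr_sum_eq_const:
  assumes I: "a \<in> I" "b \<in> I" "c \<in> I" "d \<in> I" "e \<in> I" "g \<in> I" and ne: "a \<noteq> b" "c \<noteq> d" "e \<noteq> g"
    and W: "open W" "W \<noteq> {}" "W \<subseteq> X"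
    and eq: "\<And>x. x \<in> W \<Longrightarrow> lr a b x + lr c d x = lr e g x + C"
  shows "(a = e \<and> c = b \<and> g = d) \<or> (a = d \<and> c = e \<and> g = b)"
proof -
  have eqW: "aff a x * aff c x * aff g x = exp C * (aff b x * aff d x * aff e x)" if "x \<in> W" for x
  proof -
    have pos: "0 < aff a x" "0 < aff b x" "0 < aff c x" "0 < aff d x" "0 < aff e x" "0 < aff g x"
      using aff_pos[of x] W that I by blast+
    have "ln (aff a x * aff c x * aff g x) = ln (exp C * (aff b x * aff d x * aff e x))"
      using eq[OF that] pos by (simp add: lr_def ln_mult_pos)
    then show ?thesis using pos by (subst (asm) ln_inj_iff) simp_all
  qed
  have all: "aff a y * aff c y * aff g y = exp C * (aff b y * aff d y * aff e y)" for y
    by (rule line_poly_eq[of "\<lambda>y. aff a y * aff c y * aff g y" "\<lambda>y. exp C * (aff b y * aff d y * aff e y)", OF _ _ W(1,2) eqW])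
      (intro line_poly_mult line_poly_aff line_poly_const)+
  obtain p where p: "p \<in> facet a" using facet_point I by blast
  have "a = d \<or> a = e"
    using all[of p] facet_zero[OF p] facet_pos[OF p I(2)] facet_pos[OF p I(4)] facet_pos[OF p I(5)] ne(1)
    by fastforce
  then show ?thesis
  proof
    assume "a = d"
    have "lr c b x = lr e g x + C" if "x \<in> W" for x
      using eq[OF that] by (simp add: lr_def \<open>a = d\<close>)
    \<comment> \<open>If the left side cancelled completely, \<open>lr e g\<close> would be
      constant, hence equal to its negative \<open>lr g e\<close> up to a constant.\<close>
    moreover have "c \<noteq> b"
    proof
      assume "c = b"
      have "lr e g x = lr g e x + (- 2 * C)" if "x \<in> W" for x
        using eq[OF that] by (simp add: lr_def \<open>a = d\<close> \<open>c = b\<close>)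
      then show False using lr_eq_const[OF I(5,6) ne(3) I(6,5) ne(3)[symmetric] W] ne by blast
    qed
    ultimately have "c = e \<and> b = g"
      using lr_eq_const[OF I(3,2) _ I(5,6) ne(3) W] by blast
    then show ?thesis using \<open>a = d\<close> by blast
  next
    assume "a = e"
    have *: "lr c d x = lr b g x + C" if "x \<in> W" for x
      using eq[OF that] by (simp add: lr_def \<open>a = e\<close>)
    have "b \<noteq> g"
    proof
      assume "b = g"
      then have "lr c d x = lr d c x + (2 * C)" if "x \<in> W" for x
        using *[OF that] by (simp add: lr_def)
      then show False using lr_eq_const[OF I(3,4) ne(2) I(4,3) ne(2)[symmetric] W] ne by blast
    qed
    then have "c = b \<and> d = g"
      using lr_eq_const[OF I(3,4) ne(2) I(2,6) _ W] * by blast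
    then show ?thesis using \<open>a = e\<close> by blast
  qed
qed

text \<open>For fixed \<open>y\<close>, a tie \<open>gap k x y = gap l x y\<close> is an affine
  equation in \<open>x\<close>. Off these finitely many hyperplanes the largest and the smallest gap
  are unique.\<close>

lemma strict_generic:
  assumes W: "open W" "W \<noteq> {}" "W \<subseteq> X" and y: "y \<in> X"
  obtains x k l where "x \<in> W" "k \<in> I" "l \<in> I" "k \<noteq> l" "strict k l x y"
proof -
  obtain w e where e: "0 < e" "ball w e \<subseteq> W"
    using W(1,2) open_contains_ball by blast
  define M where "M = (\<lambda>(k, l). aff l y *\<^sub>R k - aff k y *\<^sub>R l) ` (I \<times> I - Id)"
  have "finite M" using finite_I by (simp add: M_def)
  moreover have "\<exists>x\<in>ball w e. aff m x \<noteq> 0" if m: "m \<in> M" for m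
  proof (rule ccontr)
    assume "\<not> ?thesis"
    then have "m = 0" using aff_zero_open[of "ball w e" m] e(1) by force
    obtain k l where kl: "k \<in> I" "l \<in> I" "k \<noteq> l" "m = aff l y *\<^sub>R k - aff k y *\<^sub>R l"
      using m unfolding M_def by fast
    have "aff l y * aff k x = aff k y * aff l x" for x
      using \<open>m = 0\<close> aff_scaled_diff[of "aff l y" k "aff k y" l x] kl(4) by (simp add: aff_def)
    then have "aff l y = 0" using facet_not_prop[OF kl(1-3)] by blast
    then show False using aff_pos[OF y kl(2)] by simp
  qed
  ultimately obtain x where x: "x \<in> ball w e" "\<forall>m\<in>M. aff m x \<noteq> 0"
    using aff_generic[of M "ball w e"] e(1) by (auto simp del: mem_ball)
  have "x \<in> X" using x(1) e W by blast
  have distinct: "gap k x y \<noteq> gap l x y" if "k \<in> I" "l \<in> I" "k \<noteq> l" for k l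
  proof
    assume eq: "gap k x y = gap l x y"
    have "aff l y *\<^sub>R k - aff k y *\<^sub>R l \<in> M"
      unfolding M_def using that by (intro image_eqI[of _ _ "(k, l)"]) simp_all
    then have "aff l y * aff k x \<noteq> aff k y * aff l x"
      using x(2) by (metis aff_scaled_diff right_minus_eq)
    moreover have "aff k x * aff l y = aff l x * aff k y"
      using eq gap_less_iff[OF \<open>x \<in> X\<close> y that(1,2)] gap_less_iff[OF \<open>x \<in> X\<close> y that(2,1)] by linarith
    ultimately show False by (simp add: mult.commute)
  qed
  obtain k where k: "k \<in> I" "gap k x y = Max ((\<lambda>k. gap k x y) ` I)"
    using Max_in[of "(\<lambda>k. gap k x y) ` I"] finite_I I_nonempty by fastforce
  obtain l where l: "l \<in> I" "gap l x y = Min ((\<lambda>k. gap k x y) ` I)"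
    using Min_in[of "(\<lambda>k. gap k x y) ` I"] finite_I I_nonempty by fastforce
  have "gap m x y < gap k x y" if "m \<in> I - {k}" for m
    using that distinct[of m k] k finite_I Max_ge[of "(\<lambda>k. gap k x y) ` I" "gap m x y"]
    by (metis DiffD1 DiffD2 finite_imageI imageI insertI1 less_le)
  moreover have "gap l x y < gap m x y" if "m \<in> I - {l}" for m
    using that distinct[of l m] l finite_I Min_le[of "(\<lambda>k. gap k x y) ` I" "gap m x y"]
    by (metis DiffD1 DiffD2 finite_imageI imageI insertI1 less_le)
  ultimately have st: "strict k l x y" by (simp add: strict_def)
  show ?thesis
    using that[OF _ k(1) l(1) strict_neq[OF card_ge_2 k(1) st] st] x(1) e(2) by blast
qed

end

section \<open>The correspondence of facet pairs induced by an isometry\<close>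

locale polytope_isometry = polytope X I
  for X :: "'a::euclidean_space set" and I +
  fixes f :: "'a \<Rightarrow> 'a"
  assumes image_f: "f ` X = X"
    and isometry: "\<And>x y. x \<in> X \<Longrightarrow> y \<in> X \<Longrightarrow> hilbert_dist X (f x) (f y) = hilbert_dist X x y"
begin

lemma f_X: "x \<in> X \<Longrightarrow> f x \<in> X"
  using image_f by blast

lemma inj_f: "inj_on f X"
  using isometry dist_eq_0 f_X by (intro inj_onI) (metis hilbert_dist_def)

lemma inverse_isometry: "polytope_isometry X I (inv_into X f)"
proof
  show "inv_into X f ` X = X"
    using inj_f image_f inv_into_image_cancel[of f X X] by simp
  show "hilbert_dist X (inv_into X f x) (inv_into X f y) = hilbert_dist X x y" if "x \<in> X" "y \<in> X" for x y
    using isometry[of "inv_into X f x" "inv_into X f y"] that image_f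
    by (simp add: f_inv_into_f inv_into_into)
qed

text \<open>Openness comes from continuity of the inverse isometry.\<close>

lemma open_image:
  assumes "open W" "W \<subseteq> X"
  shows "open (f ` W)"
proof -
  interpret g: polytope_isometry X I "inv_into X f" by (rule inverse_isometry)
  have "f ` W = X \<inter> inv_into X f -` W"
  proof (intro equalityI subsetI)
    fix y assume "y \<in> f ` W"
    then obtain x where "x \<in> W" "y = f x" by blast
    then show "y \<in> X \<inter> inv_into X f -` W"
      using assms f_X inj_f by (auto simp: inv_into_f_f subset_iff)
  next
    fix y assume "y \<in> X \<inter> inv_into X f -` W"
    then show "y \<in> f ` W"
      using image_f by (metis IntE f_inv_into_f image_eqI vimageE)
  qed
  moreover have "continuous_on X (inv_into X f)"
    by (rule isometry_continuous[OF g.f_X g.isometry])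
  ultimately show ?thesis
    using continuous_open_preimage[OF _ open_X assms(1)] by simp
qed

text \<open>The points \<open>z\<close> beyond \<open>y\<close> seen in direction \<open>(i, j)\<close> are those for which \<open>y\<close> lies metrically between
  \<open>x\<close> and \<open>z\<close>, where \<open>x\<close> is any strict past of \<open>y\<close>. As the strict past is open, so is its image, and
  \<open>x\<close> can be chosen such that the type of \<open>(f x, f y)\<close> is again strict.\<close>

lemma local_correspondence:
  assumes ij: "i \<in> I" "j \<in> I" "i \<noteq> j" and y: "y \<in> bridge i j"
  shows "\<exists>k l. k \<in> I \<and> l \<in> I \<and> k \<noteq> l \<and> f y \<in> bridge k l \<and>
    (\<forall>z\<in>X. hilbert_dist X y z = lr i j y - lr i j z \<longrightarrow> hilbert_dist X y z = lr k l (f y) - lr k l (f z))"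
proof -
  have yX: "y \<in> X" using y bridge_subset by blast
  define P where "P = {x \<in> X. strict i j x y}"
  have "open P" "P \<subseteq> X" using open_strict_past[OF ij(1,2) yX] by (auto simp: P_def)
  moreover obtain x0 where "x0 \<in> X" "strict i j x0 y" by (rule bridge_strict_past[OF ij y])
  then have "P \<noteq> {}" by (auto simp: P_def)
  ultimately have W: "open (f ` P)" "f ` P \<noteq> {}" "f ` P \<subseteq> X"
    using open_image f_X by auto
  obtain x' k l where *: "x' \<in> f ` P" "k \<in> I" "l \<in> I" "k \<noteq> l" "strict k l x' (f y)"
    by (rule strict_generic[OF W f_X[OF yX]])
  then obtain x where x: "x \<in> P" "x' = f x" by blast
  have xX: "x \<in> X" and st: "strict i j x y" using x by (simp_all add: P_def)
  have "f y \<in> bridge k l"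
    using strict_bridge(2)[OF *(2-4) _ f_X[OF yX] *(5)] W(3) *(1) by blast
  moreover have "hilbert_dist X y z = lr k l (f y) - lr k l (f z)"
    if z: "z \<in> X" and d: "hilbert_dist X y z = lr i j y - lr i j z" for z
  proof -
    have "hilbert_dist X x y = lr i j x - lr i j y"
      using strict_attained[OF ij(1,2) xX yX st ij(1,2)] by simp
    then have "hilbert_dist X x y + hilbert_dist X y z \<le> hilbert_dist X x z"
      using d lr_le_dist[OF ij(1,2) xX z] by simp
    then have ge: "hilbert_dist X x' (f y) + hilbert_dist X (f y) (f z) \<le> hilbert_dist X x' (f z)"
      using x(2) isometry xX yX z by simp
    have X': "x' \<in> X" "f y \<in> X" "f z \<in> X" using x(2) xX yX z f_X by simp_all
    \<comment> \<open>A pair realising the long distance must realise both parts, since the triangle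
      inequality leaves no slack; strictness of the first part identifies it as
      \<open>(k, l)\<close>.\<close>
    obtain a b where ab: "a \<in> I" "b \<in> I" "hilbert_dist X x' (f z) = lr a b x' - lr a b (f z)"
      using dist_attained[OF X'(1,3)] by blast
    have le: "lr a b x' - lr a b (f y) \<le> hilbert_dist X x' (f y)"
      "lr a b (f y) - lr a b (f z) \<le> hilbert_dist X (f y) (f z)"
      using lr_le_dist[OF ab(1,2)] X' by blast+
    then have eq: "hilbert_dist X x' (f y) = lr a b x' - lr a b (f y)"
      "hilbert_dist X (f y) (f z) = lr a b (f y) - lr a b (f z)"
      using ge ab(3) by linarith+
    have "a = k \<and> b = l"
      using strict_attained[OF *(2,3) X'(1,2) *(5) ab(1,2)] eq(1) by blast
    then show ?thesis using eq(2) isometry[OF yX z] by simp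
  qed
  ultimately show ?thesis using *(2-4) by blast
qed

text \<open>The statement \<open>\<sigma>(i,j) = (k,l)\<close> with additive constant
  \<open>c\<close>, kept as a relation until existence and uniqueness are proved.\<close>

definition corr :: "'a \<times> real \<Rightarrow> 'a \<times> real \<Rightarrow> 'a \<times> real \<Rightarrow> 'a \<times> real \<Rightarrow> real \<Rightarrow> bool" where
  "corr i j k l c \<longleftrightarrow> k \<in> I \<and> l \<in> I \<and> k \<noteq> l \<and>
     (\<forall>y\<in>bridge i j. f y \<in> bridge k l \<and> lr k l (f y) = lr i j y + c)"

text \<open>\<open>local_correspondence\<close> gives a pair at each point separately. The pair and
  its constant turn out to be locally constant on the connected bridge.\<close>

lemma corr_exists:
  assumes ij: "i \<in> I" "j \<in> I" "i \<noteq> j"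
  shows "\<exists>k l c. corr i j k l c"
proof -
  define good where "good y kl \<longleftrightarrow> fst kl \<in> I \<and> snd kl \<in> I \<and> fst kl \<noteq> snd kl \<and> f y \<in> bridge (fst kl) (snd kl) \<and>
    (\<forall>z\<in>X. hilbert_dist X y z = lr i j y - lr i j z \<longrightarrow>
       hilbert_dist X y z = lr (fst kl) (snd kl) (f y) - lr (fst kl) (snd kl) (f z))" for y kl
  define S where "S y = (SOME kl. good y kl)" for y
  have good: "good y (S y)" if y: "y \<in> bridge i j" for y
  proof -
    obtain k l where "good y (k, l)"
      using local_correspondence[OF ij y] unfolding good_def by (simp, blast)
    then show ?thesis unfolding S_def by (rule someI)
  qed
  define F where "F y = (S y, lr (fst (S y)) (snd (S y)) (f y) - lr i j y)" for y
  have local_const: "\<forall>\<^sub>F y in at y0 within bridge i j. F y0 = F y" if y0: "y0 \<in> bridge i j" for y0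
  proof -
    have y0X: "y0 \<in> X" using y0 bridge_subset by blast
    obtain z0 where z0: "z0 \<in> X" "strict i j y0 z0" by (rule bridge_strict_future[OF ij y0])
    \<comment> \<open>\<open>y0\<close> and \<open>y\<close> have an open set \<open>Q\<close> of
      common strict futures. On its image the ratios of both pairs agree up to a constant, so
      rigidity identifies the pairs.\<close>
    have same: "F y0 = F y" if y: "y \<in> bridge i j" "strict i j y z0" for y
    proof -
      have yX: "y \<in> X" using y bridge_subset by blast
      define Q where "Q = {z \<in> X. strict i j y0 z} \<inter> {z \<in> X. strict i j y z}"
      have Q: "open Q" "z0 \<in> Q" "Q \<subseteq> X"
        using open_strict_future[OF ij(1,2)] y0X yX z0 y by (auto simp: Q_def)
      have val: "lr (fst (S u)) (snd (S u)) (f z) - lr i j z = snd (F u)"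
        if u: "u \<in> bridge i j" "strict i j u z" and z: "z \<in> X" for u z
      proof -
        have uX: "u \<in> X" using u bridge_subset by blast
        have d: "hilbert_dist X u z = lr i j u - lr i j z"
          using strict_attained[OF ij(1,2) uX z u(2) ij(1,2)] by simp
        have "hilbert_dist X u z = lr (fst (S u)) (snd (S u)) (f u) - lr (fst (S u)) (snd (S u)) (f z)"
          using good[OF u(1)] d z unfolding good_def by blast
        with d show ?thesis by (simp add: F_def)
      qed
      have "lr (fst (S y0)) (snd (S y0)) w = lr (fst (S y)) (snd (S y)) w + (snd (F y0) - snd (F y))"
        if "w \<in> f ` Q" for w
        using that val[OF y0] val[OF y(1)] unfolding Q_def by force
      then have "fst (S y0) = fst (S y) \<and> snd (S y0) = snd (S y)"
        using good[OF y0] good[OF y(1)] open_image[OF Q(1,3)] Q f_X unfolding good_def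
        by (intro lr_eq_const[of _ _ _ _ "f ` Q"]) blast+
      then have S: "S y0 = S y" by (simp add: prod_eq_iff)
      have "snd (F y0) = snd (F y)"
        using val[OF y0 z0(2,1)] val[OF y z0(1)] S by simp
      then show ?thesis using S by (simp add: F_def)
    qed
    have "\<forall>\<^sub>F y in nhds y0. y \<in> {y \<in> X. strict i j y z0}"
      using open_strict_past[OF ij(1,2) z0(1)] z0(2) y0X by (intro eventually_nhds_in_open) simp_all
    then show ?thesis
      unfolding eventually_at_filter by (rule eventually_mono) (use same in blast)
  qed
  obtain y0 where y0: "y0 \<in> bridge i j" using bridge_nonempty[OF ij] by blast
  have const: "F y = F y0" if "y \<in> bridge i j" for y
    using connected_local_const[OF connected_bridge[OF ij] that y0] local_const by blast
  have "corr i j (fst (S y0)) (snd (S y0)) (snd (F y0))"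
    unfolding corr_def
  proof (intro conjI ballI)
    show "fst (S y0) \<in> I" "snd (S y0) \<in> I" "fst (S y0) \<noteq> snd (S y0)"
      using good[OF y0] unfolding good_def by blast+
    fix y assume y: "y \<in> bridge i j"
    have S: "S y = S y0" and c: "snd (F y) = snd (F y0)"
      using arg_cong[OF const[OF y], of fst] arg_cong[OF const[OF y], of snd] by (simp_all add: F_def)
    show "f y \<in> bridge (fst (S y0)) (snd (S y0))"
      using good[OF y] S unfolding good_def by metis
    show "lr (fst (S y0)) (snd (S y0)) (f y) = lr i j y + snd (F y0)"
      using c unfolding F_def S snd_conv by linarith
  qed
  then show ?thesis by blast
qed

lemma corr_unique:
  assumes ij: "i \<in> I" "j \<in> I" "i \<noteq> j" and "corr i j k l c" "corr i j k' l' c'"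
  shows "k = k' \<and> l = l' \<and> c = c'"
proof -
  have W: "open (f ` bridge i j)" "f ` bridge i j \<noteq> {}" "f ` bridge i j \<subseteq> X"
    using open_image[OF open_bridge bridge_subset] bridge_nonempty[OF ij] bridge_subset f_X by blast+
  have eq: "lr k l w = lr k' l' w + (c - c')" if "w \<in> f ` bridge i j" for w
    using that assms(4,5) unfolding corr_def by force
  have "k = k' \<and> l = l'"
    using assms(4,5) eq unfolding corr_def by (intro lr_eq_const[OF _ _ _ _ _ _ W]) blast+
  with eq W(2) show ?thesis by force
qed

lemma corr_swap:
  assumes "i \<in> I" "j \<in> I" "i \<noteq> j" "corr i j k l c"
  shows "corr j i l k (- c)"
  using assms(4) bridge_sym[OF assms(1-3)] bridge_sym[of k l]
  unfolding corr_def lr_swap[of i j] lr_swap[of k l] by auto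

text \<open>The inverse isometry sends \<open>(k, l)\<close> back to one pair, which by rigidity
  equals both \<open>(i, j)\<close> and \<open>(i', j')\<close>.\<close>

lemma corr_inj:
  assumes ij: "i \<in> I" "j \<in> I" "i \<noteq> j" "i' \<in> I" "j' \<in> I" "i' \<noteq> j'"
    and c: "corr i j k l c" "corr i' j' k l c'"
  shows "i = i' \<and> j = j'"
proof -
  interpret g: polytope_isometry X I "inv_into X f" by (rule inverse_isometry)
  have kl: "k \<in> I" "l \<in> I" "k \<noteq> l" using c(1) unfolding corr_def by blast+
  obtain i0 j0 c0 where g: "g.corr k l i0 j0 c0" using g.corr_exists[OF kl] by blast
  have back_eq: "i0 = i \<and> j0 = j" if ij: "i \<in> I" "j \<in> I" "i \<noteq> j" and c: "corr i j k l c" for i j c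
  proof -
    have "lr i0 j0 y = lr i j y + (c + c0)" if y: "y \<in> bridge i j" for y
    proof -
      have "inv_into X f (f y) = y" using y bridge_subset inj_f by (intro inv_into_f_f) blast+
      then have "lr i0 j0 y = lr k l (f y) + c0"
        using g c y unfolding corr_def g.corr_def by metis
      then show ?thesis using c y unfolding corr_def by simp
    qed
    then show ?thesis
      using g ij bridge_nonempty[OF ij] unfolding g.corr_def
      by (intro lr_eq_const[OF _ _ _ _ _ _ open_bridge _ bridge_subset]) blast+
  qed
  show ?thesis using back_eq[OF ij(1-3) c(1)] back_eq[OF ij(4-6) c(2)] by simp
qed

end

section \<open>Adjacent facets\<close>

lemma aff_tendsto_start: "((\<lambda>t. aff k ((1 - t) *\<^sub>R p + t *\<^sub>R q)) \<longlongrightarrow> aff k p) (at_right 0)"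
proof -
  have "((\<lambda>t. aff k ((1 - t) *\<^sub>R p + t *\<^sub>R q)) \<longlongrightarrow> aff k ((1 - 0) *\<^sub>R p + 0 *\<^sub>R q)) (at_right 0)"
    by (intro tendsto_intros)
  then show ?thesis by simp
qed

lemma eventually_at_right_unit: "\<forall>\<^sub>F t in at_right (0::real). 0 < t \<and> t < 1"
  unfolding eventually_at_right_field by (intro exI[of _ 1]) simp

context polytope
begin

text \<open>The two facets share a face of codimension 2, with \<open>p\<close> in its relative
  interior.\<close>

definition adj :: "'a \<times> real \<Rightarrow> 'a \<times> real \<Rightarrow> bool" where
  "adj i j \<longleftrightarrow> i \<noteq> j \<and> (\<exists>p. aff i p = 0 \<and> aff j p = 0 \<and> (\<forall>l\<in>I - {i, j}. 0 < aff l p))"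

text \<open>In effect \<open>m\<close> is a multiple of \<open>k\<close>: a small move from
  \<open>(p, 1)\<close> along a vector annihilated by \<open>k\<close> stays in the cone over the
  facet, where \<open>m\<close> vanishes.\<close>

lemma facet_span:
  assumes "k \<in> I" "\<And>x. x \<in> facet k \<Longrightarrow> aff m x = 0" "inner k v = 0"
  shows "inner m v = 0"
proof -
  obtain p where p: "p \<in> facet k" using facet_point assms(1) by blast
  have lim: "((\<lambda>s. inner l ((p, 1) + s *\<^sub>R v)) \<longlongrightarrow> inner l ((p, 1) + 0 *\<^sub>R v)) (at_right 0)" for l
    by (intro tendsto_intros)
  have "\<forall>\<^sub>F s in at_right 0. \<forall>l\<in>I - {k}. 0 < inner l ((p, 1) + s *\<^sub>R v)"
  proof (intro eventually_ball_finite ballI)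
    show "finite (I - {k})" using finite_I by simp
    fix l assume "l \<in> I - {k}"
    then have "0 < inner l ((p, 1) + 0 *\<^sub>R v)"
      using facet_pos[OF p, of l] by (simp add: aff_def)
    then show "\<forall>\<^sub>F s in at_right 0. 0 < inner l ((p, 1) + s *\<^sub>R v)"
      by (rule order_tendstoD[OF lim])
  qed
  \<comment> \<open>The functional \<open>(0, 1)\<close> reads off the height, which must stay
    positive for the return to the affine chart.\<close>
  moreover have "\<forall>\<^sub>F s in at_right 0. 0 < inner (0, 1) ((p, 1) + s *\<^sub>R v)"
    by (rule order_tendstoD[OF lim]) (simp add: inner_Pair)
  ultimately have "\<forall>\<^sub>F s in at_right 0. (\<forall>l\<in>I - {k}. 0 < inner l ((p, 1) + s *\<^sub>R v)) \<and>
      0 < inner (0, 1) ((p, 1) + s *\<^sub>R v) \<and> 0 < s \<and> s < 1"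
    using eventually_at_right_unit by eventually_elim simp
  then obtain s where s: "\<forall>l\<in>I - {k}. 0 < inner l ((p, 1) + s *\<^sub>R v)"
    "0 < inner (0, 1) ((p, 1) + s *\<^sub>R v)" "0 < s"
    using eventually_happens trivial_limit_at_right_real by blast
  define w where "w = (p, 1) + s *\<^sub>R v"
  have sw: "0 < snd w" using s(2) by (cases w) (simp add: w_def inner_Pair)
  then have scale: "inner l w = snd w * aff l (fst w /\<^sub>R snd w)" for l
    by (intro inner_scale_aff) simp
  have "aff k (fst w /\<^sub>R snd w) = 0"
    using scale[of k] assms(3) facet_zero[OF p] sw by (simp add: w_def inner_add_right aff_def)
  moreover have "0 < aff l (fst w /\<^sub>R snd w)" if "l \<in> I - {k}" for l
  proof -
    have "0 < snd w * aff l (fst w /\<^sub>R snd w)"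
      using s(1) that unfolding w_def[symmetric] scale[symmetric] by blast
    then show ?thesis using sw by (simp only: zero_less_mult_iff) simp
  qed
  ultimately have "fst w /\<^sub>R snd w \<in> facet k" unfolding facet_def by blast
  then have "inner m w = 0" using scale[of m] assms(2) by simp
  moreover have "inner m (p, 1) = 0" using assms(2)[OF p] by (simp add: aff_def)
  ultimately show ?thesis using s(3) by (simp add: w_def inner_add_right)
qed

text \<open>If \<open>aff l x < 0\<close>, a segment from a generic point of \<open>facet i\<close> to \<open>x\<close> leaves the facet where exactly one
  further functional vanishes, and that one is adjacent to \<open>i\<close> and negative at \<open>x\<close>.\<close>

lemma facet_by_adjacent:
  assumes i: "i \<in> I" and x: "aff i x = 0" and nonneg: "\<And>k. k \<in> I \<Longrightarrow> adj i k \<Longrightarrow> 0 \<le> aff k x"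
    and l: "l \<in> I"
  shows "0 \<le> aff l x"
proof (rule ccontr)
  assume neg: "\<not> 0 \<le> aff l x"
  define B where "B = {l \<in> I. aff l x < 0}"
  have B: "finite B" "B \<noteq> {}" using finite_I neg l by (auto simp: B_def)
  \<comment> \<open>Such a functional vanishes at \<open>b\<close> exactly when two members of
    \<open>B\<close> reach zero at the same point of the segment from \<open>b\<close> to
    \<open>x\<close>; a generic \<open>b\<close> avoids all these ties.\<close>
  define M where "M = (\<lambda>(l, m). aff m x *\<^sub>R l - aff l x *\<^sub>R m) ` (B \<times> B - Id)"
  have "finite M" using B by (simp add: M_def)
  moreover have "\<exists>b\<in>facet i. aff n b \<noteq> 0" if n: "n \<in> M" for n
  proof (rule ccontr)
    assume zero: "\<not> ?thesis"
    obtain l m where lm: "l \<in> B" "m \<in> B" "l \<noteq> m" "n = aff m x *\<^sub>R l - aff l x *\<^sub>R m"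
      using n unfolding M_def by fast
    have I: "l \<in> I" "m \<in> I" and lmx: "aff l x < 0" "aff m x < 0" using lm by (simp_all add: B_def)
    then have li: "l \<noteq> i" "m \<noteq> i" using x by auto
    obtain u where u: "u \<in> facet l" using facet_point I by blast
    obtain v where v: "v \<in> facet m" using facet_point I by blast
    \<comment> \<open>This vector is annihilated by \<open>i\<close>, while \<open>l\<close> is
      positive and \<open>m\<close> negative on it. As \<open>aff l x\<close> and
      \<open>aff m x\<close> are both negative, \<open>n\<close> cannot vanish on it.\<close>
    define w where "w = aff i u *\<^sub>R (v, 1::real) - aff i v *\<^sub>R (u, 1)"
    have w: "inner k w = aff i u * aff k v - aff i v * aff k u" for k
      unfolding w_def aff_def inner_diff_right inner_scaleR_right ..
    have "inner i w = 0" by (simp add: w)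
    have "inner n w = 0"
      by (rule facet_span[OF i _ \<open>inner i w = 0\<close>]) (use zero in blast)
    moreover have "0 < inner l w" "inner m w < 0"
      using facet_pos[OF u i] facet_pos[OF v i] facet_pos[OF u I(2)] facet_pos[OF v I(1)]
        li lm(3) facet_zero[OF u] facet_zero[OF v] by (simp_all add: w)
    then have "aff m x * inner l w < 0" "0 < aff l x * inner m w"
      using lmx by (simp_all add: mult_neg_pos mult_neg_neg)
    ultimately show False by (simp add: lm(4) inner_diff_left)
  qed
  moreover have "facet i \<noteq> {}" using facet_point[OF i] by blast
  ultimately obtain b where b: "b \<in> facet i" "\<forall>n\<in>M. aff n b \<noteq> 0"
    using aff_generic[OF _ convex_facet] by blast
  \<comment> \<open>The parameter at which \<open>k\<close> vanishes on the segment from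
    \<open>b\<close> to \<open>x\<close>.\<close>
  define \<theta> where "\<theta> k = aff k b / (aff k b - aff k x)" for k
  have Bprops: "k \<in> I" "k \<noteq> i" "aff k x < 0" "0 < aff k b" "0 < \<theta> k" "\<theta> k < 1" if "k \<in> B" for k
  proof -
    show "k \<in> I" "aff k x < 0" using that by (simp_all add: B_def)
    then show "k \<noteq> i" using x by auto
    then show "0 < aff k b" using facet_pos[OF b(1) \<open>k \<in> I\<close>] by simp
    then show "0 < \<theta> k" "\<theta> k < 1" using \<open>aff k x < 0\<close> by (simp_all add: \<theta>_def)
  qed
  obtain k where k: "k \<in> B" "\<theta> k = Min (\<theta> ` B)"
    using Min_in[of "\<theta> ` B"] B by fastforce
  define p where "p = (1 - \<theta> k) *\<^sub>R b + \<theta> k *\<^sub>R x"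
  note kB = Bprops[OF k(1)]
  have pk: "aff m p = aff m b - \<theta> k * (aff m b - aff m x)" for m
    unfolding p_def aff_segment by (simp add: algebra_simps)
  have "aff k p = 0" using kB by (simp add: pk \<theta>_def)
  moreover have "aff i p = 0" using x facet_zero[OF b(1)] by (simp add: pk)
  moreover have "0 < aff m p" if m: "m \<in> I - {i, k}" for m
  proof (cases "m \<in> B")
    case True
    note mB = Bprops[OF True]
    have "\<theta> k \<noteq> \<theta> m"
    proof
      assume "\<theta> k = \<theta> m"
      then have "aff k b * (aff m b - aff m x) = aff m b * (aff k b - aff k x)"
        using kB(3,4) mB(3,4) unfolding \<theta>_def by (subst (asm) frac_eq_eq) simp_all
      then have "aff m x * aff k b - aff k x * aff m b = 0" by (simp add: algebra_simps)
      moreover have "aff m x *\<^sub>R k - aff k x *\<^sub>R m \<in> M"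
        unfolding M_def using k(1) True m by (intro image_eqI[of _ _ "(k, m)"]) auto
      ultimately show False using b(2) by (metis aff_scaled_diff)
    qed
    then have "\<theta> k < \<theta> m" using k B True by (simp add: less_le)
    then have "\<theta> k * (aff m b - aff m x) < \<theta> m * (aff m b - aff m x)"
      using mB by (intro mult_strict_right_mono) simp_all
    then show ?thesis using mB unfolding pk \<theta>_def[of m] by simp
  next
    case False
    then have "0 \<le> aff m x" "0 < aff m b" using m facet_pos[OF b(1), of m] by (simp_all add: B_def)
    then show ?thesis using kB unfolding p_def aff_segment by (simp add: add_pos_nonneg)
  qed
  ultimately have "adj i k" using kB(2) unfolding adj_def by blast
  then show False using nonneg[OF kB(1)] kB(3) by simp
qed

text \<open>If at most one facet \<open>k0\<close> were adjacent, a direction parallel to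
  \<open>facet i\<close> along which \<open>k0\<close> does not decrease would be a recession
  direction by \<open>facet_by_adjacent\<close>. Dimension at least 2 supplies a nonzero parallel
  direction.\<close>

lemma two_adjacent:
  assumes "2 \<le> DIM('a)" and i: "i \<in> I"
  obtains k k' where "k \<in> I" "k' \<in> I" "k \<noteq> k'" "adj i k" "adj i k'"
proof (rule ccontr)
  assume none: "\<not> thesis"
  have "\<exists>k0. \<forall>k\<in>I. adj i k \<longrightarrow> k = k0" by (metis none that)
  then obtain k0 where k0: "\<And>k. k \<in> I \<Longrightarrow> adj i k \<Longrightarrow> k = k0" by blast
  obtain u0 where "u0 \<noteq> 0" "inner (fst i) u0 = 0"
    using orthogonal_to_vector_exists[OF assms(1), of "fst i"] unfolding orthogonal_def by blast
  define u where "u = (if 0 \<le> inner (fst k0) u0 then u0 else - u0)"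
  have u: "u \<noteq> 0" "inner (fst i) u = 0" "0 \<le> inner (fst k0) u"
    using \<open>u0 \<noteq> 0\<close> \<open>inner (fst i) u0 = 0\<close> by (simp_all add: u_def)
  obtain p where p: "p \<in> facet i" using facet_point i by blast
  have "0 \<le> inner (fst l) u" if l: "l \<in> I" for l
  proof (rule ccontr)
    assume neg: "\<not> 0 \<le> inner (fst l) u"
    have ge: "0 \<le> aff l (p + s *\<^sub>R u)" if "0 \<le> s" for s
    proof (rule facet_by_adjacent[OF i _ _ l])
      show "aff i (p + s *\<^sub>R u) = 0" by (simp add: aff_add facet_zero[OF p] u)
      show "0 \<le> aff k (p + s *\<^sub>R u)" if "k \<in> I" "adj i k" for k
        using k0[OF that] facet_nonneg[OF p that(1)] u(3) \<open>0 \<le> s\<close> by (simp add: aff_add)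
    qed
    have "0 \<le> aff l p" using facet_nonneg[OF p l] .
    define s where "s = (aff l p + 1) / - inner (fst l) u"
    have "0 \<le> s" using neg \<open>0 \<le> aff l p\<close> unfolding s_def by (intro divide_nonneg_pos) simp_all
    moreover have "aff l (p + s *\<^sub>R u) = -1" unfolding aff_add s_def using neg by simp
    ultimately show False using ge[of s] by simp
  qed
  then have "u = 0" by (rule recession_trivial)
  with u(1) show False by simp
qed

text \<open>Otherwise take a point just beyond a facet outside \<open>S\<close>. A suitable line through it leaves the polyhedron
  cut out by \<open>S\<close> on both sides, each time at a point of a facet from \<open>S\<close>; so the point lies between two
  points of \<open>closure X\<close>.\<close>

lemma adjacency_connected:
  assumes dim: "2 \<le> DIM('a)" and S: "S \<subseteq> I" "S \<noteq> {}"
    and closed: "\<And>i k. i \<in> S \<Longrightarrow> k \<in> I \<Longrightarrow> adj i k \<Longrightarrow> k \<in> S"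
  shows "S = I"
proof (rule ccontr)
  assume "S \<noteq> I"
  then obtain j where j: "j \<in> I" "j \<notin> S" using S by blast
  obtain i where i: "i \<in> S" using S by blast
  then have iI: "i \<in> I" using S by blast
  obtain i' where "i' \<in> I" "adj i i'" using two_adjacent[OF dim iI] by metis
  then have i': "i' \<in> S" "i' \<in> I" "i \<noteq> i'" using closed[OF i] unfolding adj_def by blast+
  obtain p where p: "p \<in> facet i" using facet_point iI by blast
  obtain p' where p': "p' \<in> facet i'" using facet_point i' by blast
  \<comment> \<open>\<open>i'\<close> decreases along \<open>v\<close> and \<open>i\<close> along
    \<open>- v\<close>, so a line in this direction leaves the polyhedron of \<open>S\<close> on
    both sides.\<close>
  define v where "v = p' - p"
  have v: "0 < inner (fst i) v" "inner (fst i') v < 0"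
    using facet_pos[OF p i'(2)] facet_pos[OF p' iI] i'(3)
    by (simp_all add: v_def inner_fst_diff facet_zero[OF p] facet_zero[OF p'])
  obtain pj where pj: "pj \<in> facet j" using facet_point j by blast
  obtain c where c: "c \<in> X" using X_nonempty by blast
  \<comment> \<open>The segment from \<open>pj\<close> to the reflection of \<open>c\<close> in
    \<open>pj\<close>: its points near \<open>pj\<close> are negative for \<open>j\<close> and still
    positive for all of \<open>S\<close>.\<close>
  define g where "g t = (1 - t) *\<^sub>R pj + t *\<^sub>R (2 *\<^sub>R pj - c)" for t :: real
  have "\<forall>\<^sub>F t in at_right 0. \<forall>k\<in>S. 0 < aff k (g t)"
  proof (intro eventually_ball_finite ballI)
    show "finite S" using finite_I S finite_subset by blast
    fix k assume "k \<in> S"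
    then have "0 < aff k pj" using facet_pos[OF pj, of k] j S by blast
    then show "\<forall>\<^sub>F t in at_right 0. 0 < aff k (g t)"
      unfolding g_def by (rule order_tendstoD[OF aff_tendsto_start])
  qed
  then have "\<forall>\<^sub>F t in at_right 0. (\<forall>k\<in>S. 0 < aff k (g t)) \<and> 0 < t \<and> t < 1"
    using eventually_at_right_unit by eventually_elim simp
  then obtain t where t: "\<forall>k\<in>S. 0 < aff k (g t)" "0 < t"
    using eventually_happens trivial_limit_at_right_real by blast
  define x where "x = g t"
  have "x = pj + t *\<^sub>R (pj - c)" by (simp add: x_def g_def algebra_simps scaleR_2)
  then have "aff j x = aff j (pj + t *\<^sub>R (pj - c))" by simp
  then have "aff j x = - (t * aff j c)" unfolding aff_beyond facet_zero[OF pj] by simp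
  then have neg: "aff j x < 0" using aff_pos[OF c j(1)] t(2) by simp
  have finS: "finite S" using finite_I S finite_subset by blast
  have xpos: "0 < aff k x" if "k \<in> S" for k using t(1) that by (simp add: x_def)
  have exits: "\<exists>s>0. 0 \<le> aff j (x + s *\<^sub>R u)" if k0: "k0 \<in> S" "inner (fst k0) u < 0" for k0 u
  proof -
    obtain s m where s: "0 < s" "m \<in> S" "aff m (x + s *\<^sub>R u) = 0"
      "\<And>k. k \<in> S \<Longrightarrow> 0 \<le> aff k (x + s *\<^sub>R u)"
      using exit_point[OF finS xpos k0] by metis
    have "0 \<le> aff j (x + s *\<^sub>R u)"
      by (rule facet_by_adjacent[OF _ s(3) _ j(1)]) (use s closed S in blast)+
    then show ?thesis using s(1) by blast
  qed
  obtain s1 where s1: "0 < s1" "0 \<le> aff j (x + s1 *\<^sub>R v)" using exits[OF i'(1) v(2)] by blast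
  obtain s2 where s2: "0 < s2" "0 \<le> aff j (x + s2 *\<^sub>R - v)" using exits[OF i, of "- v"] v(1) by auto
  \<comment> \<open>An affine function on a line cannot be negative at \<open>x\<close> and
    nonnegative on both sides of it.\<close>
  have "0 < s1 * inner (fst j) v" "0 < s2 * inner (fst j) (- v)"
    using s1 s2 neg unfolding aff_add by linarith+
  then have "0 < inner (fst j) v" "0 < inner (fst j) (- v)"
    using s1(1) s2(1) zero_less_mult_pos by blast+
  then show False by simp
qed

text \<open>Near a point of \<open>facet i\<close> the value of \<open>aff i\<close> tends to 0
  while the other functionals stay positive, so the inequalities of all bridges at \<open>i\<close>
  hold together.\<close>

lemma bridge_hub:
  assumes i: "i \<in> I"
  shows "\<exists>y\<in>X. \<forall>k\<in>I - {i}. y \<in> bridge i k"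
proof -
  obtain p where p: "p \<in> facet i" using facet_point i by blast
  obtain c where c: "c \<in> X" using X_nonempty by blast
  have "\<forall>k. \<exists>q. k \<in> I \<longrightarrow> q \<in> facet k" by (meson facet_point)
  then obtain q where q: "\<And>k. k \<in> I \<Longrightarrow> q k \<in> facet k" by metis
  define y where "y t = (1 - t) *\<^sub>R p + t *\<^sub>R c" for t :: real
  have lim: "((\<lambda>t. aff k (y t)) \<longlongrightarrow> aff k p) (at_right 0)" for k
    unfolding y_def by (rule aff_tendsto_start)
  have "\<forall>\<^sub>F t in at_right 0. \<forall>k\<in>I - {i}. \<forall>l\<in>I - {i}. 0 < aff i (q k) * aff l (y t) - aff l (q k) * aff i (y t)"
  proof (intro eventually_ball_finite ballI)
    show "finite (I - {i})" "finite (I - {i})" using finite_I by simp_all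
    fix k l assume k: "k \<in> I - {i}" and l: "l \<in> I - {i}"
    have "((\<lambda>t. aff i (q k) * aff l (y t) - aff l (q k) * aff i (y t)) \<longlongrightarrow>
        aff i (q k) * aff l p - aff l (q k) * aff i p) (at_right 0)"
      by (intro tendsto_intros lim)
    moreover have "0 < aff i (q k) * aff l p - aff l (q k) * aff i p"
    proof -
      have "0 < aff i (q k)" using facet_pos[OF q i] k by blast
      moreover have "0 < aff l p" using facet_pos[OF p] l by blast
      ultimately show ?thesis by (simp add: facet_zero[OF p])
    qed
    ultimately show "\<forall>\<^sub>F t in at_right 0. 0 < aff i (q k) * aff l (y t) - aff l (q k) * aff i (y t)"
      by (rule order_tendstoD)
  qed
  then have "\<forall>\<^sub>F t in at_right 0. (\<forall>k\<in>I - {i}. \<forall>l\<in>I - {i}. 0 < aff i (q k) * aff l (y t) - aff l (q k) * aff i (y t))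
      \<and> 0 < t \<and> t < 1"
    using eventually_at_right_unit by eventually_elim simp
  then obtain t where t: "\<forall>k\<in>I - {i}. \<forall>l\<in>I - {i}. 0 < aff i (q k) * aff l (y t) - aff l (q k) * aff i (y t)"
    "0 < t" "t < 1"
    using eventually_happens trivial_limit_at_right_real by blast
  have yX: "y t \<in> X"
    unfolding mem_X y_def aff_segment using t(2,3) facet_nonneg[OF p] aff_pos[OF c]
    by (intro ballI add_nonneg_pos mult_pos_pos mult_nonneg_nonneg) simp_all
  moreover have "y t \<in> bridge i k" if k: "k \<in> I - {i}" for k
    unfolding bridge_def using yX q[of k] t(1) k by (intro CollectI conjI bexI[of _ "q k"]) simp_all
  ultimately show ?thesis by blast
qed

text \<open>A constant ratio would make a combination of \<open>i\<close> and \<open>j\<close>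
  vanish on \<open>facet k\<close>, hence be a multiple of \<open>k\<close>. It vanishes at a common
  point of the facets \<open>i\<close> and \<open>j\<close>, where \<open>k\<close> is positive, so
  it would be zero; a point of \<open>facet j\<close> excludes this.\<close>

lemma ratio_varies_on_facet:
  assumes "i \<in> I" "j \<in> I" "k \<in> I" "k \<noteq> i" "k \<noteq> j" and adj: "adj i j"
  obtains q q' where "q \<in> facet k" "q' \<in> facet k" "aff j q * aff i q' < aff j q' * aff i q"
proof (rule ccontr)
  assume none: "\<not> thesis"
  note witness = that
  have ge: "aff j q' * aff i q \<le> aff j q * aff i q'" if "q \<in> facet k" "q' \<in> facet k" for q q'
    using none witness[OF that] by linarith
  obtain q where q: "q \<in> facet k" using facet_point assms by blast
  define m where "m = aff i q *\<^sub>R j - aff j q *\<^sub>R i"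
  have zero: "aff m x = 0" if "x \<in> facet k" for x
    using ge[OF that q] ge[OF q that] unfolding m_def aff_scaled_diff by (simp add: mult.commute)
  obtain p where p: "aff i p = 0" "aff j p = 0" "0 < aff k p"
    using adj assms unfolding adj_def by blast
  obtain pj where pj: "pj \<in> facet j" using facet_point assms by blast
  define v where "v = aff k pj *\<^sub>R (p, 1::real) - aff k p *\<^sub>R (pj, 1)"
  have v: "inner l v = aff k pj * aff l p - aff k p * aff l pj" for l
    unfolding v_def aff_def inner_diff_right inner_scaleR_right ..
  have "inner k v = 0" by (simp add: v)
  then have "inner m v = 0" using facet_span[OF assms(3) zero] by blast
  moreover have "inner m v = aff j q * (aff k p * aff i pj)"
    unfolding v unfolding m_def aff_scaled_diff by (simp add: p facet_zero[OF pj])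
  moreover have "0 < aff j q" "0 < aff i pj"
    using facet_pos[OF q assms(2)] facet_pos[OF pj assms(1)] assms(5) adj unfolding adj_def by blast+
  ultimately show False using p(3) by simp
qed

text \<open>Near the common face of \<open>i\<close> and \<open>j\<close> only these two functionals
  have to be compared. Membership in \<open>bridge i k\<close> asks that the ratio
  \<open>aff j / aff i\<close> exceed its value at \<open>q\<close>, membership in
  \<open>bridge j k\<close> that it stay below its value at \<open>q'\<close>.\<close>

lemma bridge_triple:
  assumes I: "i \<in> I" "j \<in> I" "k \<in> I" and ne: "k \<noteq> i" "k \<noteq> j" and adj: "adj i j"
  shows "bridge i j \<inter> bridge i k \<inter> bridge j k \<noteq> {}"
proof -
  have "i \<noteq> j" using adj unfolding adj_def by blast
  obtain q q' where q: "q \<in> facet k" "q' \<in> facet k" "aff j q * aff i q' < aff j q' * aff i q"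
    by (rule ratio_varies_on_facet[OF I ne adj])
  obtain q0 where q0: "q0 \<in> facet j" using facet_point I by blast
  obtain p where p: "aff i p = 0" "aff j p = 0" "\<And>l. l \<in> I - {i, j} \<Longrightarrow> 0 < aff l p"
    using adj unfolding adj_def by blast
  \<comment> \<open>At the midpoint the ratio is a mediant, strictly between the ratios at
    \<open>q\<close> and \<open>q'\<close>.\<close>
  define m where "m = (1 - 1/2) *\<^sub>R q + (1/2) *\<^sub>R q'"
  have m: "aff l m = (aff l q + aff l q') / 2" for l unfolding m_def aff_segment by simp
  have qpos: "0 < aff i q" "0 < aff i q'" "0 < aff j q" "0 < aff j q'" "0 < aff i q0"
    using facet_pos[OF q(1)] facet_pos[OF q(2)] facet_pos[OF q0 I(1)] I ne \<open>i \<noteq> j\<close> by simp_all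
  define y where "y t = (1 - t) *\<^sub>R p + t *\<^sub>R m" for t :: real
  have yt: "aff i (y t) = t * aff i m" "aff j (y t) = t * aff j m" for t
    unfolding y_def aff_segment by (simp_all add: p)
  have lim: "((\<lambda>t. aff k (y t)) \<longlongrightarrow> aff k p) (at_right 0)" for k
    unfolding y_def by (rule aff_tendsto_start)
  have ev: "\<forall>\<^sub>F t in at_right 0. \<forall>l\<in>I - {i, j}. 0 < aff a w * aff l (y t) - aff l w * aff a (y t)"
    if a: "aff a p = 0" "0 < aff a w" for a w
  proof (intro eventually_ball_finite ballI)
    show "finite (I - {i, j})" using finite_I by simp
    fix l assume l: "l \<in> I - {i, j}"
    have "((\<lambda>t. aff a w * aff l (y t) - aff l w * aff a (y t)) \<longlongrightarrow>
        aff a w * aff l p - aff l w * aff a p) (at_right 0)"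
      by (intro tendsto_intros lim)
    moreover have "0 < aff a w * aff l p - aff l w * aff a p"
      using p(3)[OF l] a by simp
    ultimately show "\<forall>\<^sub>F t in at_right 0. 0 < aff a w * aff l (y t) - aff l w * aff a (y t)"
      by (rule order_tendstoD)
  qed
  have "\<forall>\<^sub>F t in at_right 0. (\<forall>l\<in>I - {i, j}. 0 < aff i q * aff l (y t) - aff l q * aff i (y t)) \<and>
      (\<forall>l\<in>I - {i, j}. 0 < aff j q' * aff l (y t) - aff l q' * aff j (y t)) \<and>
      (\<forall>l\<in>I - {i, j}. 0 < aff i q0 * aff l (y t) - aff l q0 * aff i (y t)) \<and> 0 < t \<and> t < 1"
    using ev[OF p(1) qpos(1)] ev[OF p(2) qpos(4)] ev[OF p(1) qpos(5)] eventually_at_right_unit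
    by eventually_elim simp
  then obtain t where t: "\<forall>l\<in>I - {i, j}. 0 < aff i q * aff l (y t) - aff l q * aff i (y t)"
      "\<forall>l\<in>I - {i, j}. 0 < aff j q' * aff l (y t) - aff l q' * aff j (y t)"
      "\<forall>l\<in>I - {i, j}. 0 < aff i q0 * aff l (y t) - aff l q0 * aff i (y t)" "0 < t" "t < 1"
    using eventually_happens trivial_limit_at_right_real by blast
  have yX: "y t \<in> X"
    unfolding mem_X
  proof
    fix l assume l: "l \<in> I"
    show "0 < aff l (y t)"
    proof (cases "l = i \<or> l = j")
      case True
      then show ?thesis using t(4) qpos by (auto simp: yt m)
    next
      case False
      then show ?thesis
        using p(3)[of l] l t(4,5) facet_nonneg[OF q(1) l] facet_nonneg[OF q(2) l]
        unfolding y_def aff_segment m by (intro add_pos_nonneg mult_pos_pos mult_nonneg_nonneg) simp_all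
    qed
  qed
  have "aff j q * (aff i q + aff i q') < aff i q * (aff j q + aff j q')"
    using q(3) by (simp add: algebra_simps)
  then have 1: "aff j q * aff i (y t) < aff i q * aff j (y t)"
    using t(4) by (simp add: yt m)
  have "aff i q' * (aff j q + aff j q') < aff j q' * (aff i q + aff i q')"
    using q(3) by (simp add: algebra_simps)
  then have 2: "aff i q' * aff j (y t) < aff j q' * aff i (y t)"
    using t(4) by (simp add: yt m)
  have 3: "aff j q0 * aff i (y t) < aff i q0 * aff j (y t)"
    using t(4) qpos by (simp add: yt m facet_zero[OF q0])
  have "y t \<in> bridge i k"
    unfolding bridge_def using yX q(1) t(1) 1 by (intro CollectI conjI bexI[of _ q] ballI) auto
  moreover have "y t \<in> bridge j k"
    unfolding bridge_def using yX q(2) t(2) 2 by (intro CollectI conjI bexI[of _ q'] ballI) auto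
  moreover have "y t \<in> bridge i j"
    unfolding bridge_def using yX q0 t(3) 3 by (intro CollectI conjI bexI[of _ q0] ballI) auto
  ultimately show ?thesis by blast
qed

end

lemma aff_sum:
  fixes g :: "'b \<Rightarrow> 'a::euclidean_space"
  assumes "sum u A = 1"
  shows "aff k (\<Sum>x\<in>A. u x *\<^sub>R g x) = (\<Sum>x\<in>A. u x * aff k (g x))"
proof -
  have aff: "aff k x = inner (fst k) x + snd k" for x by (cases k) (simp add: aff_def inner_Pair)
  have "(\<Sum>x\<in>A. u x * snd k) = snd k" using assms by (simp flip: sum_distrib_right)
  then show ?thesis by (simp add: aff inner_sum_right distrib_left sum.distrib)
qed

context polytope
begin

section \<open>Collineations and simplices\<close>

text \<open>A linear map that permutes the functionals up to positive factors preserves the cone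
  over \<open>X\<close>.\<close>

lemma collineationI:
  assumes lin: "linear M" and \<pi>: "bij_betw \<pi> I I" and pos_mu: "\<forall>k\<in>I. 0 < \<mu> k"
    and inner_M: "\<forall>k\<in>I. \<forall>v. inner (\<pi> k) (M v) = \<mu> k * inner k v"
  shows "collineation_of X M"
    and "\<And>x. x \<in> X \<Longrightarrow> 0 < snd (M (x, 1))"
    and "\<And>x k. x \<in> X \<Longrightarrow> k \<in> I \<Longrightarrow> snd (M (x, 1)) * aff (\<pi> k) (proj_apply M x) = \<mu> k * aff k x"
proof -
  note \<mu> = bspec[OF pos_mu] and M = bspec[OF inner_M, THEN spec]
  have pull: "\<exists>k\<in>I. l = \<pi> k" if "l \<in> I" for l
    using \<pi> that unfolding bij_betw_def by blast
  have "inj M"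
    unfolding linear_injective_0[OF lin]
  proof (intro allI impI)
    fix v assume "M v = 0"
    then have "inner k v = 0" if "k \<in> I" for k
      using M[OF that, of v] \<mu>[OF that] by simp
    then show "v = 0" by (rule inner_separates)
  qed
  then have "surj M" using lin linear_injective_imp_surjective by blast
  show pos: "0 < snd (M (x, 1))" if x: "x \<in> X" for x
  proof (rule cone_snd_pos)
    have "0 < inner l (M (x, 1))" if "l \<in> I" for l
    proof -
      obtain k where "k \<in> I" "l = \<pi> k" using pull[OF \<open>l \<in> I\<close>] by blast
      then show ?thesis using M \<mu> aff_pos[OF x] by (simp add: aff_def)
    qed
    then show "0 \<le> inner l (M (x, 1))" if "l \<in> I" for l using that by (simp add: less_imp_le)
    show "M (x, 1) \<noteq> 0"
      using \<open>inj M\<close> linear_0[OF lin] by (metis injD prod.inject zero_neq_one zero_prod_def)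
  qed
  have scale: "snd (M (x, 1)) * aff l (proj_apply M x) = inner l (M (x, 1))" if "x \<in> X" for x l
    using inner_scale_aff[of "M (x, 1)" l] pos[OF that]
    unfolding proj_apply_def divide_inverse_commute by simp
  show aff_proj: "snd (M (x, 1)) * aff (\<pi> k) (proj_apply M x) = \<mu> k * aff k x" if "x \<in> X" "k \<in> I" for x k
    unfolding scale[OF that(1)] M[OF that(2)] by (simp only: aff_def)
  have "proj_apply M ` X = X"
  proof (intro equalityI subsetI)
    fix y assume "y \<in> proj_apply M ` X"
    then obtain x where x: "x \<in> X" "y = proj_apply M x" by blast
    show "y \<in> X"
      unfolding mem_X
    proof
      fix l assume "l \<in> I"
      then obtain k where k: "k \<in> I" "l = \<pi> k" using pull by blast
      have "0 < snd (M (x, 1)) * aff l y"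
        using aff_proj[OF x(1) k(1)] \<mu>[OF k(1)] aff_pos[OF x(1) k(1)] by (simp add: k(2) x(2))
      then show "0 < aff l y" using pos[OF x(1)] zero_less_mult_pos by blast
    qed
  next
    fix y assume y: "y \<in> X"
    obtain v where v: "M v = (y, 1)" using \<open>surj M\<close> by (metis surjD)
    have kv: "0 < inner k v" if "k \<in> I" for k
    proof -
      have "\<pi> k \<in> I" using \<pi> that unfolding bij_betw_def by blast
      then have "0 < \<mu> k * inner k v" using M[OF that, of v] aff_pos[OF y, of "\<pi> k"] by (simp add: v aff_def)
      then show ?thesis using \<mu>[OF that] zero_less_mult_pos by blast
    qed
    have "v \<noteq> 0" using v linear_0[OF lin] by (metis prod.inject zero_neq_one zero_prod_def)
    then have sv: "0 < snd v" using cone_snd_pos[of v] kv by (simp add: less_imp_le)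
    define x where "x = fst v /\<^sub>R snd v"
    have "x \<in> X"
      unfolding mem_X
    proof
      fix k assume "k \<in> I"
      then have "0 < snd v * aff k x"
        using kv[of k] inner_scale_aff[of v k] sv unfolding x_def by simp
      then show "0 < aff k x" using sv zero_less_mult_pos by blast
    qed
    have "(x, 1) = inverse (snd v) *\<^sub>R v" using sv by (cases v) (simp add: x_def)
    then have "M (x, 1) = inverse (snd v) *\<^sub>R (y, 1)" using v linear_scale[OF lin] by simp
    then have "proj_apply M x = y" using sv by (simp add: proj_apply_def)
    then show "y \<in> proj_apply M ` X" using \<open>x \<in> X\<close> by blast
  qed
  then show "collineation_of X M"
    using lin \<open>inj M\<close> \<open>surj M\<close> pos unfolding collineation_of_def bij_def by force
qed

lemma span_of_open:
  assumes "open U" "U \<noteq> {}"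
  shows "span ((\<lambda>x::'a. (x, 1::real)) ` U) = UNIV"
proof (rule ccontr)
  assume "\<not> ?thesis"
  from span_not_UNIV_orthogonal[OF this]
  obtain m where m: "m \<noteq> 0" "\<forall>v\<in>span ((\<lambda>x::'a. (x, 1::real)) ` U). inner m v = 0" by blast
  then have "aff m x = 0" if "x \<in> U" for x
    using that by (simp add: aff_def span_base)
  then show False using aff_zero_open[OF assms] m(1) by blast
qed

section \<open>Simplices from independent facet functionals\<close>

lemma dual_basis:
  assumes ind: "independent I"
  obtains s where "\<And>k. k \<in> I \<Longrightarrow> 0 < aff k (s k)" "\<And>k l. k \<in> I \<Longrightarrow> l \<in> I \<Longrightarrow> l \<noteq> k \<Longrightarrow> aff l (s k) = 0"
proof -
  have "\<exists>x. 0 < aff k x \<and> (\<forall>l\<in>I. l \<noteq> k \<longrightarrow> aff l x = 0)" if k: "k \<in> I" for k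
  proof -
    have "k \<notin> span (I - {k})" using ind k unfolding dependent_def by blast
    then have "span (I - {k}) \<noteq> UNIV" by blast
    then obtain v0 where v0: "v0 \<noteq> 0" "\<And>w. w \<in> span (I - {k}) \<Longrightarrow> inner v0 w = 0"
      using span_not_UNIV_orthogonal by blast
    \<comment> \<open>The sign puts \<open>v\<close> into the cone over the closure; its point in
      the chart is the vertex opposite to \<open>facet k\<close>.\<close>
    define v where "v = (if 0 \<le> inner k v0 then v0 else - v0)"
    have v: "v \<noteq> 0" "0 \<le> inner k v" "\<And>l. l \<in> I \<Longrightarrow> l \<noteq> k \<Longrightarrow> inner l v = 0"
      using v0 by (simp_all add: v_def span_base inner_commute)
    then have ge: "0 \<le> inner l v" if "l \<in> I" for l using that by (cases "l = k") simp_all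
    have sv: "0 < snd v" using cone_snd_pos ge v(1) by blast
    have scale: "inner l v = snd v * aff l (fst v /\<^sub>R snd v)" for l
      by (rule inner_scale_aff) (use sv in simp)
    have zero: "aff l (fst v /\<^sub>R snd v) = 0" if "l \<in> I" "l \<noteq> k" for l
      using scale[of l] v(3)[OF that] sv by simp
    moreover have "0 < aff k (fst v /\<^sub>R snd v)"
    proof -
      have "inner k v \<noteq> 0" using inner_separates[of v] v(1,3) by metis
      then have "0 < inner k v" using v(2) by simp
      then have "0 < snd v * aff k (fst v /\<^sub>R snd v)" by (simp only: scale)
      then show ?thesis using sv zero_less_mult_pos by blast
    qed
    ultimately show ?thesis by blast
  qed
  then obtain s where "\<forall>k\<in>I. 0 < aff k (s k) \<and> (\<forall>l\<in>I. l \<noteq> k \<longrightarrow> aff l (s k) = 0)"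
    by metis
  then show ?thesis using that by blast
qed

lemma independent_imp_simplex:
  assumes ind: "independent I"
  shows "open_simplex X"
proof -
  obtain s where s: "\<And>k. k \<in> I \<Longrightarrow> 0 < aff k (s k)" "\<And>k l. k \<in> I \<Longrightarrow> l \<in> I \<Longrightarrow> l \<noteq> k \<Longrightarrow> aff l (s k) = 0"
    using dual_basis[OF ind] by metis
  \<comment> \<open>No nonzero vector is annihilated by all of \<open>I\<close>, so an independent
    \<open>I\<close> is a basis and has \<open>DIM('a) + 1\<close> elements.\<close>
  have "span I = UNIV"
  proof (rule ccontr)
    assume "span I \<noteq> UNIV"
    then obtain v where "v \<noteq> 0" "\<And>w. w \<in> span I \<Longrightarrow> inner v w = 0"
      using span_not_UNIV_orthogonal by blast
    then show False using inner_separates[of v] by (simp add: span_base inner_commute)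
  qed
  then have "card I = DIM('a \<times> real)"
    using basis_card_eq_dim[OF subset_UNIV _ ind] by simp
  moreover have inj: "inj_on s I"
  proof (rule inj_onI, rule ccontr)
    fix k l assume "k \<in> I" "l \<in> I" "s k = s l" "k \<noteq> l"
    then show False using s(1)[of k] s(2)[of l k] by simp
  qed
  ultimately have card: "card (s ` I) = DIM('a) + 1" by (simp add: card_image)
  have fin: "finite (s ` I)" using finite_I by simp
  have weights: "(\<Sum>x\<in>s ` I. U x *\<^sub>R g x) = (\<Sum>k\<in>I. U (s k) *\<^sub>R g (s k))"
    "sum U (s ` I) = (\<Sum>k\<in>I. U (s k))" for U and g :: "'a \<Rightarrow> 'a"
    using inj by (simp_all add: sum.reindex)
  have pick: "(\<Sum>k\<in>I. U k * aff l (s k)) = U l * aff l (s l)" if "l \<in> I" for U l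
  proof -
    have "(\<Sum>k\<in>I. U k * aff l (s k)) = (\<Sum>k\<in>I. if k = l then U l * aff l (s l) else 0)"
      using s(2) that by (intro sum.cong) auto
    then show ?thesis using finite_I that by simp
  qed
  have indep: "\<not> affine_dependent (s ` I)"
  proof
    assume "affine_dependent (s ` I)"
    then obtain U where U: "sum U (s ` I) = 0" "\<exists>v\<in>s ` I. U v \<noteq> 0" "(\<Sum>v\<in>s ` I. U v *\<^sub>R v) = 0"
      unfolding affine_dependent_explicit_finite[OF fin] by blast
    then obtain l where l: "l \<in> I" "U (s l) \<noteq> 0" by blast
    have zero: "(\<Sum>k\<in>I. U (s k)) = 0" "(\<Sum>k\<in>I. U (s k) *\<^sub>R s k) = 0"
      using U(1,3) weights(2) weights(1)[of U "\<lambda>x. x"] by simp_all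
    have "(\<Sum>k\<in>I. U (s k) * aff l (s k)) = inner l (\<Sum>k\<in>I. U (s k) *\<^sub>R (s k, 1))"
      unfolding inner_sum_right inner_scaleR_right aff_def ..
    also have "(\<Sum>k\<in>I. U (s k) *\<^sub>R (s k, 1::real)) = 0"
      using zero by (simp add: prod_eq_iff fst_sum snd_sum)
    finally have "U (s l) * aff l (s l) = 0" using pick[OF l(1), of "\<lambda>k. U (s k)"] by simp
    then show False using l s(1)[OF l(1)] by simp
  qed
  have "x \<in> X \<longleftrightarrow> (\<exists>u. (\<forall>v\<in>s ` I. 0 < u v) \<and> sum u (s ` I) = 1 \<and> (\<Sum>v\<in>s ` I. u v *\<^sub>R v) = x)" for x
  proof
    assume x: "x \<in> X"
    \<comment> \<open>The barycentric coordinates of \<open>x\<close> with respect to the vertices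
      \<open>s k\<close>.\<close>
    define u where "u k = aff k x / aff k (s k)" for k
    have "inner l ((x, 1::real) - (\<Sum>k\<in>I. u k *\<^sub>R (s k, 1))) = 0" if "l \<in> I" for l
    proof -
      have "inner l (\<Sum>k\<in>I. u k *\<^sub>R (s k, 1)) = (\<Sum>k\<in>I. u k * aff l (s k))"
        unfolding inner_sum_right inner_scaleR_right aff_def ..
      also have "\<dots> = aff l x" using pick[OF that, of u] s(1)[OF that] by (simp add: u_def[of l])
      finally show ?thesis by (simp add: inner_diff_right aff_def)
    qed
    then have "(x, 1::real) - (\<Sum>k\<in>I. u k *\<^sub>R (s k, 1)) = 0" by (rule inner_separates)
    then have eq: "x = (\<Sum>k\<in>I. u k *\<^sub>R s k)" "1 = (\<Sum>k\<in>I. u k)"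
      by (simp_all add: prod_eq_iff fst_sum snd_sum)
    define u' where "u' v = u (inv_into I s v)" for v
    have u': "u' (s k) = u k" if "k \<in> I" for k using inj that by (simp add: u'_def)
    have "(\<Sum>k\<in>I. u' (s k)) = 1" "(\<Sum>k\<in>I. u' (s k) *\<^sub>R s k) = x"
      using eq u' by simp_all
    moreover have "\<forall>v\<in>s ` I. 0 < u' v"
      using u' s(1) aff_pos[OF x] by (simp add: u_def)
    ultimately show "\<exists>u. (\<forall>v\<in>s ` I. 0 < u v) \<and> sum u (s ` I) = 1 \<and> (\<Sum>v\<in>s ` I. u v *\<^sub>R v) = x"
      using weights(2)[of u'] weights(1)[of u' "\<lambda>x. x"] by (intro exI[of _ u']) simp
  next
    assume "\<exists>u. (\<forall>v\<in>s ` I. 0 < u v) \<and> sum u (s ` I) = 1 \<and> (\<Sum>v\<in>s ` I. u v *\<^sub>R v) = x"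
    then obtain u where u: "\<forall>v\<in>s ` I. 0 < u v" "sum u (s ` I) = 1" "(\<Sum>v\<in>s ` I. u v *\<^sub>R v) = x"
      by blast
    then have "(\<Sum>k\<in>I. u (s k)) = 1" "x = (\<Sum>k\<in>I. u (s k) *\<^sub>R s k)"
      using weights(2)[of u] weights(1)[of u "\<lambda>x. x"] by simp_all
    then have "aff l x = u (s l) * aff l (s l)" if "l \<in> I" for l
      using aff_sum[of "\<lambda>k. u (s k)" I l s] pick[OF that, of "\<lambda>k. u (s k)"] by simp
    then show "x \<in> X" unfolding mem_X using u(1) s(1) by simp
  qed
  then have "X = interior (convex hull (s ` I))"
    unfolding interior_convex_hull_explicit_minimal[OF indep] using card by auto
  then show ?thesis unfolding open_simplex_def using fin card indep by blast
qed

end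

context polytope_isometry
begin

section \<open>Global structure of the correspondence\<close>

text \<open>\<open>src\<close> and \<open>tgt\<close> are the components of
  \<open>\<sigma>(i,j)\<close>, and \<open>shift\<close> is the constant belonging to it.\<close>

definition src :: "'a \<times> real \<Rightarrow> 'a \<times> real \<Rightarrow> 'a \<times> real" where
  "src i j = (SOME k. \<exists>l c. corr i j k l c)"

definition tgt :: "'a \<times> real \<Rightarrow> 'a \<times> real \<Rightarrow> 'a \<times> real" where
  "tgt i j = (SOME l. \<exists>k c. corr i j k l c)"

definition shift :: "'a \<times> real \<Rightarrow> 'a \<times> real \<Rightarrow> real" where
  "shift i j = (SOME c. \<exists>k l. corr i j k l c)"

lemma corr_src_tgt:
  assumes "i \<in> I" "j \<in> I" "i \<noteq> j"
  shows "corr i j (src i j) (tgt i j) (shift i j)"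
proof -
  obtain k l c where c: "corr i j k l c" using corr_exists[OF assms] by blast
  have "src i j = k" unfolding src_def
    by (rule some_equality) (use c corr_unique[OF assms c] in blast)+
  moreover have "tgt i j = l" unfolding tgt_def
    by (rule some_equality) (use c corr_unique[OF assms c] in blast)+
  moreover have "shift i j = c" unfolding shift_def
    by (rule some_equality) (use c corr_unique[OF assms c] in blast)+
  ultimately show ?thesis using c by simp
qed

lemma src_tgt:
  assumes "i \<in> I" "j \<in> I" "i \<noteq> j"
  shows "src i j \<in> I" "tgt i j \<in> I" "src i j \<noteq> tgt i j"
  using corr_src_tgt[OF assms] unfolding corr_def by blast+

lemma src_tgt_swap:
  assumes "i \<in> I" "j \<in> I" "i \<noteq> j"
  shows "src j i = tgt i j" "tgt j i = src i j" "shift j i = - shift i j"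
  using corr_unique[OF assms(2,1) assms(3)[symmetric] corr_src_tgt[OF assms(2,1) assms(3)[symmetric]]
      corr_swap[OF assms corr_src_tgt[OF assms]]] by blast+

lemma src_tgt_inj:
  assumes "i \<in> I" "j \<in> I" "i \<noteq> j" "i' \<in> I" "j' \<in> I" "i' \<noteq> j'"
    and "src i j = src i' j'" "tgt i j = tgt i' j'"
  shows "i = i' \<and> j = j'"
  using corr_inj[OF assms(1-6) corr_src_tgt[OF assms(1-3)]] corr_src_tgt[OF assms(4-6)] assms(7,8) by metis

text \<open>On the common part of the three bridges the logarithmic ratios add up. Transported by
  \<open>f\<close>, this is the situation of \<open>lr_sum_eq_const\<close>: the triple is
  preserved, and then the constants add up too, or it is reversed.\<close>

lemma corr_triple:
  assumes I: "i \<in> I" "j \<in> I" "k \<in> I" and ne: "k \<noteq> i" "k \<noteq> j" and adj: "adj i j"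
  shows "src i j = src i k \<and> src j k = tgt i j \<and> tgt i k = tgt j k \<and> shift i k = shift i j + shift j k \<or>
    src i j = tgt j k \<and> src j k = src i k \<and> tgt i k = tgt i j"
proof -
  have ij: "i \<noteq> j" using adj unfolding adj_def by blast
  define W where "W = bridge i j \<inter> bridge i k \<inter> bridge j k"
  have W: "open W" "W \<noteq> {}" "W \<subseteq> X"
    using bridge_triple[OF I ne adj] bridge_subset[of i j] open_bridge unfolding W_def by (blast intro: open_Int)+
  then have fW: "open (f ` W)" "f ` W \<noteq> {}" "f ` W \<subseteq> X"
    using open_image f_X by blast+
  have eq: "lr (src i j) (tgt i j) w + lr (src j k) (tgt j k) w =
      lr (src i k) (tgt i k) w + (shift i j + shift j k - shift i k)" if w: "w \<in> f ` W" for w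
  proof -
    obtain y where y: "y \<in> W" "w = f y" using w by blast
    have "lr (src i j) (tgt i j) w = lr i j y + shift i j" "lr (src j k) (tgt j k) w = lr j k y + shift j k"
      "lr (src i k) (tgt i k) w = lr i k y + shift i k"
      using corr_src_tgt[OF I(1,2) ij] corr_src_tgt[OF I(2,3) ne(2)[symmetric]] corr_src_tgt[OF I(1,3) ne(1)[symmetric]]
        y unfolding W_def corr_def by blast+
    then show ?thesis by (simp add: lr_def)
  qed
  note s = src_tgt[OF I(1,2) ij] src_tgt[OF I(2,3) ne(2)[symmetric]] src_tgt[OF I(1,3) ne(1)[symmetric]]
  have "(src i j = src i k \<and> src j k = tgt i j \<and> tgt i k = tgt j k) \<or>
      (src i j = tgt j k \<and> src j k = src i k \<and> tgt i k = tgt i j)"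
    by (rule lr_sum_eq_const[OF s(1,2,4,5,7,8) s(3,6,9) fW eq])
  moreover have "shift i k = shift i j + shift j k"
    if *: "src i j = src i k" "src j k = tgt i j" "tgt i k = tgt j k"
  proof -
    obtain w where "w \<in> f ` W" using fW(2) by blast
    from eq[OF this] show ?thesis by (simp add: lr_def *)
  qed
  ultimately show ?thesis by blast
qed

text \<open>If \<open>m\<close> is adjacent to \<open>i\<close>, the image of \<open>(i, m)\<close>
  shares its source or its target with the image of every other pair at \<open>i\<close>. For two
  adjacent facets exactly one of the two is shared, by injectivity, and it is then forced on all
  pairs at \<open>i\<close>.\<close>

lemma star_out_or_in:
  assumes dim: "2 \<le> DIM('a)" and i: "i \<in> I"
  shows "(\<exists>a. \<forall>k\<in>I - {i}. src i k = a) \<or> (\<exists>b. \<forall>k\<in>I - {i}. tgt i k = b)"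
proof -
  obtain k k' where k: "k \<in> I" "k' \<in> I" "k \<noteq> k'" "adj i k" "adj i k'"
    using two_adjacent[OF dim i] by metis
  then have ne: "i \<noteq> k" "i \<noteq> k'" unfolding adj_def by blast+
  have share: "src i m = src i l \<or> tgt i m = tgt i l" if "m \<in> I" "adj i m" "l \<in> I - {i, m}" for m l
    using corr_triple[OF i that(1), of l] that by auto
  have diff: "\<not> (src i k = src i k' \<and> tgt i k = tgt i k')"
    using src_tgt_inj[OF i k(1) ne(1) i k(2) ne(2)] k(3) by blast
  have "src i l = src i k \<or> tgt i l = tgt i k" "src i l = src i k' \<or> tgt i l = tgt i k'"
    if "l \<in> I - {i}" for l
    using share[OF k(1,4), of l] share[OF k(2,5), of l] that by (cases "l = k"; cases "l = k'"; force)+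
  note both = this
  have "src i k = src i k' \<or> tgt i k = tgt i k'" using share[OF k(1,4), of k'] k ne by blast
  then show ?thesis
  proof
    assume "src i k = src i k'"
    then have "\<forall>l\<in>I - {i}. src i l = src i k" using both diff by metis
    then show ?thesis by blast
  next
    assume "tgt i k = tgt i k'"
    then have "\<forall>l\<in>I - {i}. tgt i l = tgt i k" using both diff by metis
    then show ?thesis by blast
  qed
qed

text \<open>For a purely outward \<open>i\<close> and a purely inward \<open>k\<close>, the common
  source at \<open>i\<close> equals the common target at \<open>k\<close>. Seen from a third facet
  \<open>l\<close>, this facet \<open>a\<close> is the target for \<open>(l, i)\<close> and the
  source for \<open>(l, k)\<close>, so the star of \<open>l\<close> is of neither type.\<close>

lemma all_out_or_all_in:
  assumes dim: "2 \<le> DIM('a)"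
  shows "(\<forall>i\<in>I. \<exists>a. \<forall>k\<in>I - {i}. src i k = a) \<or> (\<forall>i\<in>I. \<exists>b. \<forall>k\<in>I - {i}. tgt i k = b)"
proof (rule ccontr)
  assume "\<not> ?thesis"
  then obtain i k where i: "i \<in> I" "\<not> (\<exists>b. \<forall>k\<in>I - {i}. tgt i k = b)"
    and k: "k \<in> I" "\<not> (\<exists>a. \<forall>l\<in>I - {k}. src k l = a)" by blast
  obtain a where a: "\<And>l. l \<in> I - {i} \<Longrightarrow> src i l = a" using star_out_or_in[OF dim i(1)] i(2) by blast
  obtain b where b: "\<And>l. l \<in> I - {k} \<Longrightarrow> tgt k l = b" using star_out_or_in[OF dim k(1)] k(2) by blast
  have "i \<noteq> k" using a k(2) by blast
  obtain l where l: "l \<in> I" "l \<noteq> i" "l \<noteq> k"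
  proof (rule two_adjacent[OF dim i(1)])
    fix m m' assume "m \<in> I" "m' \<in> I" "m \<noteq> m'" "adj i m" "adj i m'"
    then show thesis using that unfolding adj_def by (cases "m = k") blast+
  qed
  have "b = a"
    using a[of k] b[of i] src_tgt_swap(2)[OF i(1) k(1) \<open>i \<noteq> k\<close>] i k \<open>i \<noteq> k\<close> by simp
  have li: "src l i = tgt i l" "tgt l i = a"
    using src_tgt_swap[OF i(1) l(1)] l a[of l] by auto
  have lk: "src l k = a" "tgt l k = src k l"
    using src_tgt_swap[OF k(1) l(1)] l b[of l] \<open>b = a\<close> by auto
  have "src l i \<noteq> a" "tgt l k \<noteq> a"
    using src_tgt[OF l(1) i(1) l(2)] src_tgt[OF l(1) k(1) l(3)] li lk by auto
  moreover have "src l i = src l k \<or> tgt l i = tgt l k"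
    using star_out_or_in[OF dim l(1)] i k l by auto
  ultimately show False using li lk by auto
qed

text \<open>A linear relation between the facet functionals, divided by \<open>aff i\<close> and transported by \<open>f\<close>, is a
  relation between a constant and the functions \<open>aff (\<pi> i) / aff (\<pi> k)\<close>, which have poles along pairwise
  distinct hyperplanes.\<close>

lemma inward_star_independent:
  assumes i: "i \<in> I" and inj: "inj_on \<pi> I" and \<pi>: "\<pi> ` I \<subseteq> I"
    and corr: "\<And>k. k \<in> I \<Longrightarrow> k \<noteq> i \<Longrightarrow> corr i k (\<pi> k) (\<pi> i) (c k)"
  shows "independent I"
proof (rule independent_if_scalars_zero[OF finite_I])
  fix \<alpha> :: "'a \<times> real \<Rightarrow> real" and m
  assume rel: "(\<Sum>k\<in>I. \<alpha> k *\<^sub>R k) = 0" and m: "m \<in> I"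
  define J where "J = I - {i}"
  have J: "finite J" "I = insert i J" "i \<notin> J" using finite_I i by (auto simp: J_def)
  define W where "W = X \<inter> (\<Inter>k\<in>J. bridge i k)"
  have "open W" unfolding W_def using J(1) open_bridge open_X by (intro open_Int open_INT) blast+
  moreover have "W \<noteq> {}" using bridge_hub[OF i] unfolding W_def J_def by blast
  ultimately have fW: "open (f ` W)" "f ` W \<noteq> {}" using open_image[of W] unfolding W_def by blast+
  define \<beta> where "\<beta> k = \<alpha> k * exp (c k)" for k
  have \<pi>I: "\<pi> k \<in> I" if "k \<in> I" for k using \<pi> that by blast
  have affine_rel: "(\<Sum>k\<in>I. \<alpha> k * aff k y) = 0" for y
  proof -
    have "(\<Sum>k\<in>I. \<alpha> k * aff k y) = inner (\<Sum>k\<in>I. \<alpha> k *\<^sub>R k) (y, 1)"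
      unfolding inner_sum_left inner_scaleR_left aff_def ..
    then show ?thesis by (simp add: rel)
  qed
  \<comment> \<open>The transported relation multiplied by all \<open>aff (\<pi> l)\<close> with
    \<open>l\<close> in \<open>J\<close>, which makes it polynomial in \<open>z\<close>.\<close>
  define G where "G z = \<alpha> i * (\<Prod>l\<in>J. aff (\<pi> l) z) +
      (\<Sum>k\<in>J. \<beta> k * (aff (\<pi> i) z * (\<Prod>l\<in>J - {k}. aff (\<pi> l) z)))" for z
  have "G z = 0" if "z \<in> f ` W" for z
  proof -
    obtain y where y: "y \<in> W" "z = f y" using \<open>z \<in> f ` W\<close> by blast
    have yX: "y \<in> X" and zX: "z \<in> X" using y f_X unfolding W_def by blast+
    have zpos: "0 < aff (\<pi> k) z" if "k \<in> I" for k using aff_pos[OF zX \<pi>I[OF that]] .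
    have ypos: "0 < aff k y" if "k \<in> I" for k using aff_pos[OF yX that] .
    have ratio: "aff k y * aff (\<pi> k) z = exp (c k) * (aff i y * aff (\<pi> i) z)" if k: "k \<in> J" for k
    proof -
      have kI: "k \<in> I" using k J(2) by blast
      have "lr (\<pi> k) (\<pi> i) z = lr i k y + c k"
        using corr[OF kI] k J(3) y unfolding corr_def W_def by blast
      then have "ln (aff k y * aff (\<pi> k) z) = ln (exp (c k) * (aff i y * aff (\<pi> i) z))"
        using zpos[OF kI] zpos[OF i] ypos[OF kI] ypos[OF i] by (simp add: lr_def ln_mult_pos)
      then show ?thesis
        using zpos[OF kI] zpos[OF i] ypos[OF kI] ypos[OF i] by (subst (asm) ln_inj_iff) simp_all
    qed
    have "aff i y * G z = (\<Prod>l\<in>J. aff (\<pi> l) z) * (\<Sum>k\<in>I. \<alpha> k * aff k y)"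
    proof -
      have "aff i y * (\<beta> k * (aff (\<pi> i) z * (\<Prod>l\<in>J - {k}. aff (\<pi> l) z))) =
          (\<Prod>l\<in>J. aff (\<pi> l) z) * (\<alpha> k * aff k y)" if k: "k \<in> J" for k
      proof -
        have "aff i y * (\<beta> k * (aff (\<pi> i) z * (\<Prod>l\<in>J - {k}. aff (\<pi> l) z))) =
            \<alpha> k * (exp (c k) * (aff i y * aff (\<pi> i) z)) * (\<Prod>l\<in>J - {k}. aff (\<pi> l) z)"
          by (simp add: \<beta>_def)
        also have "\<dots> = \<alpha> k * aff k y * (aff (\<pi> k) z * (\<Prod>l\<in>J - {k}. aff (\<pi> l) z))"
          by (simp add: ratio[OF k, symmetric])
        also have "aff (\<pi> k) z * (\<Prod>l\<in>J - {k}. aff (\<pi> l) z) = (\<Prod>l\<in>J. aff (\<pi> l) z)"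
          using prod.remove[OF J(1) k, of "\<lambda>l. aff (\<pi> l) z"] by simp
        finally show ?thesis by (simp add: mult.commute)
      qed
      then show ?thesis
        using J unfolding G_def distrib_left sum_distrib_left J(2)
        by (simp add: distrib_left sum_distrib_left mult.commute mult.left_commute)
    qed
    then show "G z = 0" using affine_rel ypos[OF i] by simp
  qed
  moreover have "line_poly G"
    unfolding G_def
    by (intro line_poly_add line_poly_mult line_poly_const line_poly_sum line_poly_prod line_poly_aff)
  ultimately have G0: "G z = 0" for z using line_poly_zero[OF _ fW] by blast
  have \<alpha>J: "\<alpha> k = 0" if k: "k \<in> J" for k
  proof -
    have kI: "k \<in> I" "k \<noteq> i" using k unfolding J_def by blast+
    \<comment> \<open>On this facet every product containing the factor of \<open>\<pi> k\<close>
      vanishes, so only the summand of \<open>k\<close> survives.\<close>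
    obtain p where p: "p \<in> facet (\<pi> k)" using facet_point \<pi>I kI by blast
    have pos: "0 < aff (\<pi> l) p" if "l \<in> I" "l \<noteq> k" for l
      using facet_pos[OF p \<pi>I[OF that(1)]] inj that kI unfolding inj_on_def by blast
    have "(\<Prod>l\<in>J. aff (\<pi> l) p) = 0"
      using k J(1) facet_zero[OF p] by (intro prod_zero) blast+
    moreover have "(\<Prod>l\<in>J - {n}. aff (\<pi> l) p) = 0" if "n \<in> J" "n \<noteq> k" for n
      using k that J(1) facet_zero[OF p] by (intro prod_zero) blast+
    then have "(\<Sum>n\<in>J. \<beta> n * (aff (\<pi> i) p * (\<Prod>l\<in>J - {n}. aff (\<pi> l) p))) =
        (\<Sum>n\<in>J. if n = k then \<beta> k * (aff (\<pi> i) p * (\<Prod>l\<in>J - {k}. aff (\<pi> l) p)) else 0)"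
      by (intro sum.cong) simp_all
    then have "(\<Sum>n\<in>J. \<beta> n * (aff (\<pi> i) p * (\<Prod>l\<in>J - {n}. aff (\<pi> l) p))) =
        \<beta> k * (aff (\<pi> i) p * (\<Prod>l\<in>J - {k}. aff (\<pi> l) p))"
      unfolding sum.delta[OF J(1)] using k by (simp only: if_True)
    ultimately have "\<beta> k * (aff (\<pi> i) p * (\<Prod>l\<in>J - {k}. aff (\<pi> l) p)) = 0"
      using G0[of p] unfolding G_def by (simp only:) 
    moreover have "0 < (\<Prod>l\<in>J - {k}. aff (\<pi> l) p)"
      using pos by (intro prod_pos) (simp add: J_def)
    moreover have "0 < aff (\<pi> i) p" using pos[OF i] kI by simp
    ultimately show "\<alpha> k = 0" by (simp add: \<beta>_def)
  qed
  obtain y where "y \<in> X" using X_nonempty by blast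
  then have "\<alpha> i = 0"
    using affine_rel[of y] aff_pos[of y i] i J \<alpha>J by simp
  then show "\<alpha> m = 0" using \<alpha>J m J(2) by blast
qed

text \<open>On the open set \<open>U\<close> the functionals of \<open>\<tau> x (f x, 1)\<close> are
  fixed multiples of those of \<open>(x, 1)\<close>. The linear map \<open>M\<close> prescribed on a
  basis of lifts from \<open>U\<close> therefore scales and permutes the functionals, and its
  collineation obeys on all of \<open>X\<close> the formulas that \<open>f\<close> obeys on
  bridges.\<close>

lemma collineation_of_direct:
  assumes \<pi>: "bij_betw \<pi> I I"
    and corr: "\<And>i j. i \<in> I \<Longrightarrow> j \<in> I \<Longrightarrow> i \<noteq> j \<Longrightarrow> corr i j (\<pi> i) (\<pi> j) (\<kappa> i - \<kappa> j)"
  shows "\<exists>M. collineation_of X M \<and> (\<forall>x\<in>X. f x = proj_apply M x)"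
proof -
  have \<pi>I: "\<pi> k \<in> I" if "k \<in> I" for k using \<pi> that unfolding bij_betw_def by blast
  obtain i where i: "i \<in> I" using I_nonempty by blast
  define U where "U = X \<inter> (\<Inter>k\<in>I - {i}. bridge i k)"
  have U: "open U" unfolding U_def using finite_I open_bridge open_X by (intro open_Int open_INT) blast+
  have "U \<noteq> {}" using bridge_hub[OF i] unfolding U_def by blast
  \<comment> \<open>The scale that makes the equation below hold for \<open>k = i\<close>; the
    correspondence at \<open>i\<close> gives it for every other \<open>k\<close>.\<close>
  define \<tau> where "\<tau> x = exp (\<kappa> i) * aff i x / aff (\<pi> i) (f x)" for x
  have \<tau>: "\<tau> x * aff (\<pi> k) (f x) = exp (\<kappa> k) * aff k x" if x: "x \<in> U" and k: "k \<in> I" for x k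
  proof -
    have xX: "x \<in> X" and fX: "f x \<in> X" using x f_X unfolding U_def by blast+
    have pos: "0 < aff k x" "0 < aff i x" "0 < aff (\<pi> k) (f x)" "0 < aff (\<pi> i) (f x)"
      using aff_pos[OF xX] aff_pos[OF fX] k i \<pi>I by blast+
    have "lr (\<pi> i) (\<pi> k) (f x) = lr i k x + (\<kappa> i - \<kappa> k)"
    proof (cases "k = i")
      case False
      then show ?thesis using corr[OF i k] x k unfolding U_def corr_def by blast
    qed simp
    then have "ln (exp (\<kappa> i) * aff i x * aff (\<pi> k) (f x)) = ln (exp (\<kappa> k) * aff k x * aff (\<pi> i) (f x))"
      using pos by (simp add: lr_def ln_mult_pos)
    then have "exp (\<kappa> i) * aff i x * aff (\<pi> k) (f x) = exp (\<kappa> k) * aff k x * aff (\<pi> i) (f x)"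
      using pos by (subst (asm) ln_inj_iff) simp_all
    then show ?thesis using pos by (simp add: \<tau>_def field_simps)
  qed
  obtain B where B: "B \<subseteq> (\<lambda>x. (x, 1::real)) ` U" "independent B" "(\<lambda>x. (x, 1::real)) ` U \<subseteq> span B"
    by (rule maximal_independent_subset)
  have spanB: "span B = UNIV"
    using span_of_open[OF U \<open>U \<noteq> {}\<close>] span_mono[OF B(3)] unfolding span_span by blast
  obtain M where M: "linear M" "\<forall>v\<in>B. M v = \<tau> (fst v) *\<^sub>R (f (fst v), 1::real)"
    using linear_independent_extend[OF B(2), of "\<lambda>v. \<tau> (fst v) *\<^sub>R (f (fst v), 1::real)"] by blast
  have inner_M: "inner (\<pi> k) (M v) = exp (\<kappa> k) * inner k v" if k: "k \<in> I" for k v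
  proof (rule linear_eq_on[where B = B and f = "\<lambda>v. inner (\<pi> k) (M v)" and g = "\<lambda>v. exp (\<kappa> k) * inner k v"])
    show "linear (\<lambda>v. inner (\<pi> k) (M v))"
      using linear_add[OF M(1)] linear_scale[OF M(1)] by (intro linearI) (simp_all add: inner_add_right)
    show "linear (\<lambda>v. exp (\<kappa> k) * inner k v)"
      by (intro linearI) (simp_all add: inner_add_right algebra_simps)
    show "v \<in> span B" by (simp add: spanB)
    fix b assume b: "b \<in> B"
    then obtain x where x: "x \<in> U" "b = (x, 1)" using B(1) by blast
    have "inner (\<pi> k) (M b) = \<tau> x * aff (\<pi> k) (f x)" using M(2) b x(2) by (simp add: aff_def del: scaleR_Pair)
    then show "inner (\<pi> k) (M b) = exp (\<kappa> k) * inner k b"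
      using \<tau>[OF x(1) k] x(2) by (simp add: aff_def)
  qed
  have "\<forall>k\<in>I. 0 < exp (\<kappa> k)" "\<forall>k\<in>I. \<forall>v. inner (\<pi> k) (M v) = exp (\<kappa> k) * inner k v"
    using inner_M by simp_all
  note coll = collineationI[OF M(1) \<pi> this]
  define h where "h = proj_apply M"
  have hX: "h ` X = X" using coll(1) unfolding collineation_of_def h_def by blast
  have lr_h: "lr (\<pi> i) (\<pi> j) (h x) = lr i j x + (\<kappa> i - \<kappa> j)" if x: "x \<in> X" and ij: "i \<in> I" "j \<in> I" for x i j
  proof -
    have "ln (aff (\<pi> k) (h x)) = \<kappa> k + ln (aff k x) - ln (snd (M (x, 1)))" if k: "k \<in> I" for k
    proof -
      have "0 < aff (\<pi> k) (h x)" using aff_pos[OF _ \<pi>I[OF k]] hX x by blast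
      moreover have "0 < aff k x" using aff_pos[OF x k] .
      moreover have "ln (snd (M (x, 1)) * aff (\<pi> k) (h x)) = ln (exp (\<kappa> k) * aff k x)"
        using coll(3)[OF x k] unfolding h_def by (simp only:)
      ultimately show ?thesis using coll(2)[OF x] by (simp add: ln_mult_pos)
    qed
    then show ?thesis using ij by (simp add: lr_def)
  qed
  \<comment> \<open>Continuity extends the formula from a bridge to its closure, where a
    distance-realising pair for given points can be found.\<close>
  have lr_f: "lr (\<pi> i) (\<pi> j) (f x) = lr i j x + (\<kappa> i - \<kappa> j)"
    if ij: "i \<in> I" "j \<in> I" "i \<noteq> j" and x: "x \<in> X" "x \<in> closure (bridge i j)" for i j x
  proof -
    obtain s where s: "\<And>n. s n \<in> bridge i j" "s \<longlonglongrightarrow> x"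
      using x(2) unfolding closure_sequential by blast
    define F where "F z = lr (\<pi> i) (\<pi> j) (f z) - lr i j z" for z
    have "continuous_on X f" by (rule isometry_continuous[OF f_X isometry])
    then have "continuous_on X F"
      unfolding F_def using continuous_on_lr ij \<pi>I f_X
      by (intro continuous_on_diff continuous_on_compose2[of X "lr (\<pi> i) (\<pi> j)" X f]) blast+
    moreover have "\<forall>\<^sub>F n in sequentially. s n \<in> X" using s(1) bridge_subset by (intro always_eventually) blast
    ultimately have "(\<lambda>n. F (s n)) \<longlonglongrightarrow> F x"
      using s(2) x(1) by (intro continuous_on_tendsto_compose[of X F])
    moreover have "F (s n) = \<kappa> i - \<kappa> j" for n
      using corr[OF ij] s(1)[of n] unfolding corr_def F_def by simp
    ultimately have "F x = \<kappa> i - \<kappa> j" by (simp add: LIMSEQ_const_iff)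
    then show ?thesis by (simp add: F_def)
  qed
  have "f x = h x" if x: "x \<in> X" for x
  proof -
    \<comment> \<open>If \<open>f\<close> takes the value \<open>h x\<close> at some
      \<open>y\<close> other than \<open>x\<close>, then a pair realising the distance of
      \<open>x\<close> and \<open>y\<close> has the same logarithmic ratio at both, and the distance
      is 0.\<close>
    obtain y where y: "y \<in> X" "f y = h x" using x hX image_f by (metis imageE imageI)
    have "x = y"
    proof (rule ccontr)
      assume "x \<noteq> y"
      obtain i j where ij: "i \<in> I" "j \<in> I" "i \<noteq> j" "hilbert_dist X x y = lr i j x - lr i j y"
        "x \<in> closure (bridge i j)" "y \<in> closure (bridge i j)"
        by (rule attained_in_closure_bridge[OF x y(1) \<open>x \<noteq> y\<close>])
      have "lr i j x = lr i j y"
        using lr_f[OF ij(1-3) y(1) ij(6)] lr_h[OF x ij(1,2)] y(2) by simp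
      then show False using dist_eq_0[OF x y(1)] ij(4) \<open>x \<noteq> y\<close> by simp
    qed
    then show ?thesis using y(2) by simp
  qed
  then show ?thesis using coll(1) unfolding h_def by blast
qed

text \<open>Swapping turns common sources into common targets, so
  \<open>\<sigma>(i,j) = (\<pi> i, \<pi> j)\<close>. Injectivity of \<open>\<pi>\<close> excludes
  the reversing case of \<open>corr_triple\<close>, which leaves additivity of the
  constants.\<close>

lemma direct_if_all_out:
  assumes dim: "2 \<le> DIM('a)" and out: "\<And>i. i \<in> I \<Longrightarrow> \<exists>a. \<forall>k\<in>I - {i}. src i k = a"
  shows "\<exists>M. collineation_of X M \<and> (\<forall>x\<in>X. f x = proj_apply M x)"
proof -
  obtain \<pi> where \<pi>: "\<And>i k. i \<in> I \<Longrightarrow> k \<in> I \<Longrightarrow> i \<noteq> k \<Longrightarrow> src i k = \<pi> i"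
  proof -
    have "\<forall>i\<in>I. \<exists>a. \<forall>k\<in>I - {i}. src i k = a" using out by blast
    then obtain \<pi> where "\<forall>i\<in>I. \<forall>k\<in>I - {i}. src i k = \<pi> i" by metis
    then show thesis using that by blast
  qed
  have tgt: "tgt i k = \<pi> k" if "i \<in> I" "k \<in> I" "i \<noteq> k" for i k
    using src_tgt_swap(1)[OF that] \<pi>[of k i] that by simp
  have "\<pi> i \<noteq> \<pi> k" "\<pi> i \<in> I" if "i \<in> I" "k \<in> I" "i \<noteq> k" for i k
    using src_tgt[OF that] \<pi>[OF that] tgt[OF that] by simp_all
  note \<pi>' = this
  have "\<pi> i \<in> I" if "i \<in> I" for i
    using two_adjacent[OF dim that] \<pi>'(2)[OF that] unfolding adj_def by metis
  then have bij: "bij_betw \<pi> I I"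
    using \<pi>'(1) finite_I by (intro bij_betw_imageI endo_inj_surj inj_onI) blast+
  have triple: "shift i k = shift i j + shift j k"
    if "i \<in> I" "j \<in> I" "k \<in> I" "k \<noteq> i" "k \<noteq> j" "adj i j" for i j k
  proof -
    have "i \<noteq> j" using that unfolding adj_def by blast
    then have "src i j \<noteq> tgt j k" using \<pi> tgt \<pi>'(1) that by simp
    then show ?thesis using corr_triple[OF that] by blast
  qed
  obtain o0 where o0: "o0 \<in> I" using I_nonempty by blast
  \<comment> \<open>The potential of the constants, normalised to 0 at \<open>o0\<close>.\<close>
  define \<kappa> where "\<kappa> j = (if j = o0 then 0 else - shift o0 j)" for j
  \<comment> \<open>Additivity is available for triples that start with an adjacent pair, so the
    good facets are shown to be closed under adjacency.\<close>
  define S where "S = {j \<in> I. \<forall>k\<in>I. k \<noteq> j \<longrightarrow> shift j k = \<kappa> j - \<kappa> k}"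
  have "S = I"
  proof (rule adjacency_connected[OF dim])
    show "S \<subseteq> I" by (auto simp: S_def)
    have "o0 \<in> S" using o0 by (simp add: S_def \<kappa>_def)
    then show "S \<noteq> {}" by blast
    fix j m assume j: "j \<in> S" and m: "m \<in> I" and adj: "adj j m"
    have jI: "j \<in> I" "j \<noteq> m" using j adj unfolding S_def adj_def by blast+
    have jk: "shift j k = \<kappa> j - \<kappa> k" if "k \<in> I" "k \<noteq> j" for k using j that unfolding S_def by blast
    have "shift m k = \<kappa> m - \<kappa> k" if k: "k \<in> I" "k \<noteq> m" for k
    proof (cases "k = j")
      case True
      then show ?thesis using src_tgt_swap(3)[OF jI(1) m jI(2)] jk[OF m] jI by simp
    next
      case False
      then show ?thesis using triple[OF jI(1) m k(1) False k(2) adj] jk[OF m] jk[OF k(1) False] jI by simp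
    qed
    then show "m \<in> S" using m unfolding S_def by blast
  qed
  have shift: "shift i j = \<kappa> i - \<kappa> j" if "i \<in> I" "j \<in> I" "i \<noteq> j" for i j
  proof -
    have "i \<in> S" unfolding \<open>S = I\<close> by (rule that(1))
    then have "\<forall>k\<in>I. k \<noteq> i \<longrightarrow> shift i k = \<kappa> i - \<kappa> k" unfolding S_def mem_Collect_eq by (rule conjunct2)
    then show ?thesis using that by simp
  qed
  show ?thesis
    by (rule collineation_of_direct[OF bij, of \<kappa>])
      (use corr_src_tgt \<pi> tgt shift in metis)
qed

lemma simplex_if_all_in:
  assumes dim: "2 \<le> DIM('a)" and inward: "\<And>i. i \<in> I \<Longrightarrow> \<exists>b. \<forall>k\<in>I - {i}. tgt i k = b"
  shows "open_simplex X"
proof -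
  obtain \<pi> where \<pi>: "\<And>i k. i \<in> I \<Longrightarrow> k \<in> I \<Longrightarrow> i \<noteq> k \<Longrightarrow> tgt i k = \<pi> i"
  proof -
    have "\<forall>i\<in>I. \<exists>a. \<forall>k\<in>I - {i}. tgt i k = a" using inward by blast
    then obtain \<pi> where "\<forall>i\<in>I. \<forall>k\<in>I - {i}. tgt i k = \<pi> i" by metis
    then show thesis using that by blast
  qed
  have src: "src i k = \<pi> k" if "i \<in> I" "k \<in> I" "i \<noteq> k" for i k
    using src_tgt_swap(2)[OF that] \<pi>[of k i] that by simp
  have \<pi>': "\<pi> i \<noteq> \<pi> k" "\<pi> i \<in> I" if "i \<in> I" "k \<in> I" "i \<noteq> k" for i k
    using src_tgt[OF that] \<pi>[OF that] src[OF that] by simp_all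
  have \<pi>I: "\<pi> i \<in> I" if "i \<in> I" for i
    using two_adjacent[OF dim that] \<pi>'(2)[OF that] unfolding adj_def by metis
  obtain i where i: "i \<in> I" using I_nonempty by blast
  have "independent I"
  proof (rule inward_star_independent[OF i])
    show "inj_on \<pi> I" using \<pi>'(1) by (intro inj_onI) blast
    show "\<pi> ` I \<subseteq> I" using \<pi>I by blast
    show "corr i k (\<pi> k) (\<pi> i) (shift i k)" if "k \<in> I" "k \<noteq> i" for k
      using corr_src_tgt[of i k] src[of i k] \<pi>[of i k] that i by simp
  qed
  then show ?thesis by (rule independent_imp_simplex)
qed

text \<open>With only one unordered pair of facets, preserving and reversing it are both induced by
  a permutation. This serves dimension 1.\<close>

lemma direct_if_two_facets:
  assumes "card I = 2"
  shows "\<exists>M. collineation_of X M \<and> (\<forall>x\<in>X. f x = proj_apply M x)"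
proof -
  obtain i j where ij: "I = {i, j}" "i \<noteq> j" using assms by (auto simp: card_2_iff)
  define \<pi> where "\<pi> k = (if k = i then src i j else tgt i j)" for k
  define \<kappa> where "\<kappa> k = (if k = i then shift i j else 0)" for k
  have I: "i \<in> I" "j \<in> I" using ij by simp_all
  note s = src_tgt[OF I ij(2)]
  have bij: "bij_betw \<pi> I I"
  proof (rule bij_betw_imageI)
    show "inj_on \<pi> I" using s(3) ij by (auto simp: inj_on_def \<pi>_def)
    then show "\<pi> ` I = I" using s(1,2) ij by (intro endo_inj_surj finite_I) (auto simp: \<pi>_def)
  qed
  show ?thesis
  proof (rule collineation_of_direct[OF bij, of \<kappa>])
    fix k l assume kl: "k \<in> I" "l \<in> I" "k \<noteq> l"
    have "corr i j (\<pi> i) (\<pi> j) (\<kappa> i - \<kappa> j)" "corr j i (\<pi> j) (\<pi> i) (\<kappa> j - \<kappa> i)"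
      using corr_src_tgt[OF I ij(2)] corr_swap[OF I ij(2) corr_src_tgt[OF I ij(2)]] ij(2)
      by (simp_all add: \<pi>_def \<kappa>_def)
    then show "corr k l (\<pi> k) (\<pi> l) (\<kappa> k - \<kappa> l)" using kl ij by blast
  qed
qed

end

section \<open>The theorem\<close>

text \<open>In a representation with fewest functionals, dropping \<open>k\<close> admits a point
  \<open>z\<close> outside \<open>X\<close>. The segment from a point of \<open>X\<close> to
  \<open>z\<close> crosses the zero set of \<open>k\<close> where all other functionals are
  positive.\<close>

lemma polyhedral_domain_imp_polytope:
  fixes X :: "'a::euclidean_space set"
  assumes "polyhedral_domain X"
  obtains I where "polytope X I"
proof -
  define rep where "rep I \<longleftrightarrow> finite I \<and> X = {x. \<forall>k\<in>I. 0 < aff k x}" for I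
  obtain F where F: "finite F" "X = \<Inter>F" "\<forall>H\<in>F. \<exists>a b. a \<noteq> 0 \<and> H = {x. inner a x < b}"
    and X: "X \<noteq> {}" "bounded X"
    using assms unfolding polyhedral_domain_def by blast
  have "\<forall>H\<in>F. \<exists>k. H = {x. 0 < aff k x}"
  proof
    fix H assume "H \<in> F"
    then obtain a b where "H = {x. inner a x < b}" using F(3) by blast
    then have "H = {x. 0 < aff (- a, b) x}" by (simp add: aff_def inner_Pair)
    then show "\<exists>k. H = {x. 0 < aff k x}" by blast
  qed
  then obtain g where "\<And>H. H \<in> F \<Longrightarrow> H = {x. 0 < aff (g H) x}" by metis
  then have "X = (\<Inter>H\<in>F. {x. 0 < aff (g H) x})" using F(2) by blast
  then have "X = {x. \<forall>k\<in>g ` F. 0 < aff k x}" by blast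
  then have "rep (g ` F)" using F(1) unfolding rep_def by blast
  then obtain I where I: "rep I" "\<forall>J. rep J \<longrightarrow> card I \<le> card J"
    using ex_has_least_nat[of rep "g ` F" card] by blast
  have "polytope X I"
  proof
    show "finite I" and X_eq: "X = {x. \<forall>k\<in>I. 0 < aff k x}" using I(1) unfolding rep_def by blast+
    show "X \<noteq> {}" "bounded X" by fact+
    fix k assume k: "k \<in> I"
    have "card (I - {k}) < card I" by (rule card_Diff1_less[OF \<open>finite I\<close> k])
    then have "\<not> rep (I - {k})" using I(2) by (meson not_le)
    then have "X \<noteq> {x. \<forall>l\<in>I - {k}. 0 < aff l x}" using \<open>finite I\<close> unfolding rep_def by blast
    then obtain z where z: "\<forall>l\<in>I - {k}. 0 < aff l z" "z \<notin> X" using X_eq by blast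
    then have kz: "aff k z \<le> 0" using X_eq by fastforce
    obtain x where x: "x \<in> X" using X by blast
    then have xpos: "0 < aff l x" if "l \<in> I" for l using X_eq that by blast
    define t where "t = aff k x / (aff k x - aff k z)"
    have t: "0 < t" "t \<le> 1" using kz xpos[OF k] by (simp_all add: t_def divide_le_eq_1)
    have "aff k ((1 - t) *\<^sub>R x + t *\<^sub>R z) = aff k x - t * (aff k x - aff k z)"
      unfolding aff_segment by (simp add: algebra_simps)
    also have "\<dots> = 0" using kz xpos[OF k] by (simp add: t_def)
    finally have "aff k ((1 - t) *\<^sub>R x + t *\<^sub>R z) = 0" .
    moreover have "0 < aff l ((1 - t) *\<^sub>R x + t *\<^sub>R z)" if "l \<in> I - {k}" for l
      unfolding aff_segment using t z(1) xpos[of l] that by (intro add_nonneg_pos mult_nonneg_nonneg mult_pos_pos) simp_all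
    ultimately show "\<exists>p. aff k p = 0 \<and> (\<forall>l\<in>I - {k}. 0 < aff l p)" by blast
  qed
  then show ?thesis by (rule that)
qed

lemma collineation_inverse:
  assumes "collineation_of X M"
  shows "collineation_of X (inv M)" "\<And>x. x \<in> X \<Longrightarrow> proj_apply (inv M) (proj_apply M x) = x"
proof -
  have M: "linear M" "bij M" "\<And>x. x \<in> X \<Longrightarrow> snd (M (x, 1)) \<noteq> 0" "proj_apply M ` X = X"
    using assms unfolding collineation_of_def by blast+
  have lin: "linear (inv M)"
  proof (rule linearI)
    fix u v :: "'a \<times> real" and c :: real
    obtain u' v' where uv: "u = M u'" "v = M v'" using bij_is_surj[OF M(2)] by (metis surjD)
    have inv: "inv M (M w) = w" for w using bij_is_inj[OF M(2)] by simp
    show "inv M (u + v) = inv M u + inv M v"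
      unfolding uv inv by (simp only: linear_add[OF M(1), symmetric] inv)
    show "inv M (c *\<^sub>R u) = c *\<^sub>R inv M u"
      unfolding uv inv by (simp only: linear_scale[OF M(1), symmetric] inv)
  qed
  have inv: "inv M (proj_apply M x, 1) = (1 / snd (M (x, 1))) *\<^sub>R (x, 1)" if x: "x \<in> X" for x
  proof -
    have "(proj_apply M x, 1) = (1 / snd (M (x, 1))) *\<^sub>R M (x, 1)"
      using M(3)[OF x] by (simp add: proj_apply_def prod_eq_iff)
    also have "\<dots> = M ((1 / snd (M (x, 1))) *\<^sub>R (x, 1))" by (simp only: linear_scale[OF M(1)])
    finally show ?thesis by (simp only: inv_f_f[OF bij_is_inj[OF M(2)]])
  qed
  show inverse: "proj_apply (inv M) (proj_apply M x) = x" if "x \<in> X" for x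
    unfolding proj_apply_def[of "inv M"] inv[OF that] using M(3)[OF that] by simp
  have "snd (inv M (y, 1)) \<noteq> 0" if y: "y \<in> X" for y
  proof -
    obtain x where "x \<in> X" "y = proj_apply M x" using M(4) y by blast
    then show ?thesis using inv[of x] M(3)[of x] by simp
  qed
  moreover have "proj_apply (inv M) ` X = X"
  proof -
    have "proj_apply (inv M) ` X = proj_apply (inv M) ` proj_apply M ` X" by (simp only: M(4))
    then show ?thesis using inverse by (simp add: image_image)
  qed
  ultimately show "collineation_of X (inv M)"
    unfolding collineation_of_def using lin bij_imp_bij_inv[OF M(2)] by blast
qed

section \<open>The one-dimensional case and the two inclusions\<close>

context polytope
begin

text \<open>Of three facet points on a line one lies between the other two, yet its functional is
  zero there and positive at both others.\<close>

lemma card_facets_dim1: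
  assumes dim: "DIM('a) = 1"
  shows "card I = 2"
proof (rule ccontr)
  assume "card I \<noteq> 2"
  then have "3 \<le> card I" using card_ge_2 by simp
  then obtain T where "T \<subseteq> I" "card T = 3" by (rule obtain_subset_with_card_n)
  then obtain i j k where T: "T = {i, j, k}" and ijk: "i \<noteq> j" "i \<noteq> k" "j \<noteq> k"
    unfolding card_3_iff by blast
  then have ijk: "i \<in> I" "j \<in> I" "k \<in> I" "i \<noteq> j" "i \<noteq> k" "j \<noteq> k"
    using \<open>T \<subseteq> I\<close> by blast+
  obtain p where p: "p \<in> facet i" using facet_point ijk by blast
  obtain q where q: "q \<in> facet j" using facet_point ijk by blast
  obtain r where r: "r \<in> facet k" using facet_point ijk by blast
  obtain b :: 'a where b: "Basis = {b}" using dim by (auto simp: card_1_singleton_iff)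
  have coord: "x = inner x b *\<^sub>R b" for x using euclidean_representation[of x] unfolding b by simp
  have no_middle: "\<not> (inner x b \<le> inner y b \<and> inner y b \<le> inner z b)"
    if m: "m \<in> I" "y \<in> facet m" "0 < aff m x" "0 < aff m z" for m x y z
  proof
    assume le: "inner x b \<le> inner y b \<and> inner y b \<le> inner z b"
    then have "inner y b \<in> closed_segment (inner x b) (inner z b)"
      by (simp add: closed_segment_eq_real_ivl)
    then obtain t where t: "0 \<le> t" "t \<le> 1" "inner y b = (1 - t) * inner x b + t * inner z b"
      unfolding closed_segment_def by auto
    have "y = (1 - t) *\<^sub>R x + t *\<^sub>R z"
      by (subst coord[of x], subst coord[of y], subst coord[of z]) (simp add: t(3) scaleR_add_left)
    then have "aff m y = (1 - t) * aff m x + t * aff m z" by (simp only: aff_segment)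
    then have "(1 - t) * aff m x + t * aff m z = 0" using facet_zero[OF m(2)] by simp
    moreover have "0 \<le> (1 - t) * aff m x" "0 \<le> t * aff m z" using t(1,2) m(3,4) by simp_all
    ultimately have "(1 - t) * aff m x = 0" "t * aff m z = 0" by linarith+
    then show False using m(3,4) by simp
  qed
  have pos: "0 < aff i q" "0 < aff i r" "0 < aff j p" "0 < aff j r" "0 < aff k p" "0 < aff k q"
    using facet_pos[OF p] facet_pos[OF q] facet_pos[OF r] ijk by blast+
  show False
    using no_middle[OF ijk(1) p pos(1,2)] no_middle[OF ijk(1) p pos(2,1)]
      no_middle[OF ijk(2) q pos(3,4)] no_middle[OF ijk(2) q pos(4,3)]
      no_middle[OF ijk(3) r pos(5,6)] no_middle[OF ijk(3) r pos(6,5)] by linarith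
qed

text \<open>Functionals pulled back by the adjoint of \<open>M\<close> are positive on
  \<open>X\<close> up to a common sign and have the same logarithmic ratios, so
  \<open>lr_le_dist_general\<close> applies.\<close>

lemma collineation_nonexpansive:
  assumes coll: "collineation_of X M" and x: "x \<in> X" and y: "y \<in> X"
  shows "hilbert_dist X (proj_apply M x) (proj_apply M y) \<le> hilbert_dist X x y"
proof -
  have M: "linear M" "\<And>x. x \<in> X \<Longrightarrow> snd (M (x, 1)) \<noteq> 0" "proj_apply M ` X = X"
    using coll unfolding collineation_of_def by blast+
  \<comment> \<open>A sign change of the denominator would produce a zero of it on a segment inside
    \<open>X\<close>.\<close>
  have same_sign: "\<not> (snd (M (u, 1)) < 0 \<and> 0 < snd (M (v, 1)))" if uv: "u \<in> X" "v \<in> X" for u v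
  proof
    assume *: "snd (M (u, 1)) < 0 \<and> 0 < snd (M (v, 1))"
    define t where "t = - snd (M (u, 1)) / (snd (M (v, 1)) - snd (M (u, 1)))"
    have t: "0 \<le> t" "t < 1"
      using * unfolding t_def by (intro divide_nonneg_pos, simp, simp, subst pos_divide_less_eq, simp_all)
    have "((1 - t) *\<^sub>R u + t *\<^sub>R v, 1) = (1 - t) *\<^sub>R (u, 1::real) + t *\<^sub>R (v, 1)" by simp
    then have eq: "M ((1 - t) *\<^sub>R u + t *\<^sub>R v, 1) = (1 - t) *\<^sub>R M (u, 1) + t *\<^sub>R M (v, 1)"
      by (simp only: linear_add[OF M(1)] linear_scale[OF M(1)])
    have "snd (M ((1 - t) *\<^sub>R u + t *\<^sub>R v, 1)) = snd (M (u, 1)) + t * (snd (M (v, 1)) - snd (M (u, 1)))"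
      unfolding eq by (simp add: left_diff_distrib right_diff_distrib)
    also have "\<dots> = 0" using * by (simp add: t_def)
    finally show False
      using M(2)[OF segment_in_X[OF uv(1) less_imp_le[OF aff_pos[OF uv(2)]] t]] by simp
  qed
  define \<sigma> where "\<sigma> = sgn (snd (M (x, 1)))"
  have sgn: "0 < \<sigma> * snd (M (z, 1))" if "z \<in> X" for z
    using same_sign[OF that x] same_sign[OF x that] M(2)[OF that] M(2)[OF x] by (auto simp: \<sigma>_def sgn_if)
  define pull where "pull k = \<sigma> *\<^sub>R adjoint M k" for k
  have pull: "aff (pull k) z = \<sigma> * snd (M (z, 1)) * aff k (proj_apply M z)" if "z \<in> X" for k z
  proof -
    have "aff (pull k) z = \<sigma> * inner k (M (z, 1))"
      using adjoint_works[OF M(1), of "(z, 1)" k] by (simp add: pull_def aff_def inner_commute)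
    also have "inner k (M (z, 1)) = snd (M (z, 1)) * aff k (proj_apply M z)"
      using inner_scale_aff[of "M (z, 1)" k] M(2)[OF that] unfolding proj_apply_def divide_inverse_commute by simp
    finally show ?thesis by simp
  qed
  have hX: "proj_apply M z \<in> X" if "z \<in> X" for z using M(3) that by blast
  have pull_pos: "0 < aff (pull k) z" if "k \<in> I" "z \<in> X" for k z
    unfolding pull[OF that(2)] using sgn[OF that(2)] aff_pos[OF hX[OF that(2)] that(1)] by simp
  have lr_pull: "lr (pull i) (pull j) z = lr i j (proj_apply M z)" if "i \<in> I" "j \<in> I" "z \<in> X" for i j z
  proof -
    have "ln (aff (pull k) z) = ln (\<sigma> * snd (M (z, 1))) + ln (aff k (proj_apply M z))" if "k \<in> I" for k
      unfolding pull[OF \<open>z \<in> X\<close>] using sgn[OF \<open>z \<in> X\<close>] aff_pos[OF hX[OF \<open>z \<in> X\<close>] that]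
      by (rule ln_mult_pos)
    then show ?thesis using that(1,2) by (simp add: lr_def)
  qed
  obtain i j where ij: "i \<in> I" "j \<in> I"
    "hilbert_dist X (proj_apply M x) (proj_apply M y) = lr i j (proj_apply M x) - lr i j (proj_apply M y)"
    by (rule dist_attained[OF hX[OF x] hX[OF y]])
  note ij(3)
  also have "\<dots> = lr (pull i) (pull j) x - lr (pull i) (pull j) y"
    by (simp only: lr_pull[OF ij(1,2) x] lr_pull[OF ij(1,2) y])
  also have "\<dots> \<le> hilbert_dist X x y"
    by (rule lr_le_dist_general[OF pull_pos[OF ij(1)] pull_pos[OF ij(2)] x y])
  finally show ?thesis .
qed

lemma collineations_subset_isometries: "hilbert_collineations X \<subseteq> hilbert_isometries X"
proof
  fix f assume "f \<in> hilbert_collineations X"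
  then obtain M where M: "f = restrict (proj_apply M) X" "collineation_of X M"
    unfolding hilbert_collineations_def by blast
  have hX: "proj_apply M ` X = X" using M(2) unfolding collineation_of_def by blast
  have "hilbert_dist X (proj_apply M x) (proj_apply M y) = hilbert_dist X x y" if "x \<in> X" "y \<in> X" for x y
  proof (rule antisym)
    show "hilbert_dist X (proj_apply M x) (proj_apply M y) \<le> hilbert_dist X x y"
      by (rule collineation_nonexpansive[OF M(2) that])
    have "proj_apply M x \<in> X" "proj_apply M y \<in> X" using hX that by blast+
    from collineation_nonexpansive[OF collineation_inverse(1)[OF M(2)] this]
    show "hilbert_dist X x y \<le> hilbert_dist X (proj_apply M x) (proj_apply M y)"
      by (simp only: collineation_inverse(2)[OF M(2)] that)
  qed
  then show "f \<in> hilbert_isometries X"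
    unfolding hilbert_isometries_def M(1) using hX by simp
qed

lemma isometries_subset_collineations:
  assumes "\<not> (open_simplex X \<and> 2 \<le> DIM('a))"
  shows "hilbert_isometries X \<subseteq> hilbert_collineations X"
proof
  fix f assume f: "f \<in> hilbert_isometries X"
  interpret f: polytope_isometry X I f
    by unfold_locales (use f in \<open>simp_all add: hilbert_isometries_def\<close>)
  have "\<exists>M. collineation_of X M \<and> (\<forall>x\<in>X. f x = proj_apply M x)"
  proof (cases "2 \<le> DIM('a)")
    case True
    then have "\<not> open_simplex X" using assms by blast
    then show ?thesis
      using f.all_out_or_all_in[OF True] f.direct_if_all_out[OF True] f.simplex_if_all_in[OF True] by blast
  next
    case False
    then have "DIM('a) = 1" using DIM_positive[where 'a='a] by linarith
    then show ?thesis by (intro f.direct_if_two_facets card_facets_dim1)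
  qed
  then obtain M where M: "collineation_of X M" "\<forall>x\<in>X. f x = proj_apply M x" by blast
  have "f \<in> extensional X" using f unfolding hilbert_isometries_def by blast
  then have "f = restrict (proj_apply M) X"
    using M(2) by (intro extensionalityI[of f X]) simp_all
  then show "f \<in> hilbert_collineations X" using M(1) unfolding hilbert_collineations_def by blast
qed

end

section \<open>Inversion of barycentric coordinates on a simplex\<close>

lemma simplex_dual_functionals:
  fixes S :: "'a::euclidean_space set"
  assumes fin: "finite S" and card: "card S = DIM('a) + 1" and indep: "\<not> affine_dependent S"
  obtains k where "\<And>s. s \<in> S \<Longrightarrow> aff (k s) s = 1" "\<And>s t. s \<in> S \<Longrightarrow> t \<in> S \<Longrightarrow> t \<noteq> s \<Longrightarrow> aff (k s) t = 0"
    "\<And>v. v = (\<Sum>s\<in>S. inner (k s) v *\<^sub>R (s, 1))"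
proof -
  define e where "e s = (s, 1::real)" for s :: 'a
  have inj: "inj_on e S" by (simp add: inj_on_def e_def)
  \<comment> \<open>Affine independence of points is linear independence of their lifts.\<close>
  have "independent (e ` S)"
  proof (rule independent_if_scalars_zero)
    show "finite (e ` S)" using fin by simp
    fix c v assume c: "(\<Sum>x\<in>e ` S. c x *\<^sub>R x) = 0" and "v \<in> e ` S"
    then obtain s where s: "s \<in> S" "v = e s" by blast
    have "(\<Sum>s\<in>S. c (e s) *\<^sub>R e s) = 0" using c by (simp add: sum.reindex[OF inj])
    then have "(\<Sum>s\<in>S. c (e s)) = 0" "(\<Sum>s\<in>S. c (e s) *\<^sub>R s) = 0"
      by (simp_all add: e_def prod_eq_iff fst_sum snd_sum)
    then show "c v = 0"
      using indep s unfolding affine_dependent_explicit_finite[OF fin] by blast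
  qed
  note ind = this
  have "dim (e ` S) = DIM('a \<times> real)"
    using dim_eq_card_independent[OF ind] card_image[OF inj] card by simp
  then have span: "span (e ` S) = UNIV" using dim_eq_full by blast
  have "\<exists>k. inner k (e s) = 1 \<and> (\<forall>t\<in>S. t \<noteq> s \<longrightarrow> inner k (e t) = 0)" if s: "s \<in> S" for s
  proof -
    have "e s \<notin> span (e ` S - {e s})" using ind s unfolding dependent_def by blast
    then have "span (e ` S - {e s}) \<noteq> UNIV" by blast
    then obtain v where v: "v \<noteq> 0" "\<forall>w\<in>span (e ` S - {e s}). inner v w = 0"
      using span_not_UNIV_orthogonal by blast
    have vt: "inner v (e t) = 0" if "t \<in> S" "t \<noteq> s" for t
      using v(2) that by (intro bspec[OF v(2)] span_base) (simp add: e_def)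
    have "inner v (e s) \<noteq> 0"
    proof
      assume "inner v (e s) = 0"
      then have "inner v w = 0" if "w \<in> e ` S" for w using that vt by auto
      then have "inner v w = 0" for w
        using linear_eq_on[of "inner v" "\<lambda>_. 0" w "e ` S"] span
        by (simp add: linear_0 bounded_linear.linear[OF bounded_linear_inner_right] module_hom_zero)
      then show False using v(1) by (metis inner_eq_zero_iff)
    qed
    then show ?thesis
      using vt by (intro exI[of _ "v /\<^sub>R inner v (e s)"]) simp
  qed
  \<comment> \<open>The dual basis, that is, the barycentric coordinates as functionals.\<close>
  then obtain k where k: "\<And>s. s \<in> S \<Longrightarrow> inner (k s) (e s) = 1"
    "\<And>s t. s \<in> S \<Longrightarrow> t \<in> S \<Longrightarrow> t \<noteq> s \<Longrightarrow> inner (k s) (e t) = 0" by metis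
  have "v = (\<Sum>s\<in>S. inner (k s) v *\<^sub>R e s)" for v
  proof (rule linear_eq_on[where B = "e ` S" and f = "\<lambda>v. v" and g = "\<lambda>v. \<Sum>s\<in>S. inner (k s) v *\<^sub>R e s"])
    show "linear (\<lambda>v. v)" by (intro linearI) simp_all
    show "linear (\<lambda>v. \<Sum>s\<in>S. inner (k s) v *\<^sub>R e s)"
      by (intro linearI) (simp_all add: inner_add_right scaleR_add_left sum.distrib scaleR_sum_right)
    show "v \<in> span (e ` S)" by (simp add: span)
    fix b assume "b \<in> e ` S"
    then obtain t where t: "t \<in> S" "b = e t" by blast
    have "(\<Sum>s\<in>S. inner (k s) b *\<^sub>R e s) = (\<Sum>s\<in>S. if s = t then e t else 0)"
      using k t by (intro sum.cong) auto
    then show "b = (\<Sum>s\<in>S. inner (k s) b *\<^sub>R e s)" using t fin by simp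
  qed
  then show ?thesis using that[of k] k unfolding e_def aff_def by blast
qed

text \<open>Inversion swaps the two facets in every logarithmic ratio and so preserves the maximum
  over all pairs. If it were projective, its numerators would satisfy polynomial identities that
  make them vanish at all vertices.\<close>

lemma simplex_isometry_not_collineation:
  fixes X :: "'a::euclidean_space set"
  assumes simplex: "open_simplex X" and dim: "2 \<le> DIM('a)"
  shows "hilbert_isometries X \<noteq> hilbert_collineations X"
proof -
  obtain S where S: "finite S" "card S = DIM('a) + 1" "\<not> affine_dependent S" "X = interior (convex hull S)"
    using simplex unfolding open_simplex_def by blast
  obtain k where k: "\<And>s. s \<in> S \<Longrightarrow> aff (k s) s = 1" "\<And>s t. s \<in> S \<Longrightarrow> t \<in> S \<Longrightarrow> t \<noteq> s \<Longrightarrow> aff (k s) t = 0"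
    "\<And>v. v = (\<Sum>s\<in>S. inner (k s) v *\<^sub>R (s, 1))"
    using simplex_dual_functionals[OF S(1-3)] by blast
  have pick: "(\<Sum>t\<in>S. u t * aff (k s) t) = u s" if "s \<in> S" for u s
  proof -
    have "(\<Sum>t\<in>S. u t * aff (k s) t) = (\<Sum>t\<in>S. if t = s then u s else 0)"
      using k that by (intro sum.cong) auto
    then show ?thesis using S(1) that by simp
  qed
  have coords: "x = (\<Sum>s\<in>S. aff (k s) x *\<^sub>R s)" "(\<Sum>s\<in>S. aff (k s) x) = 1" for x
    using k(3)[of "(x, 1)"] by (simp_all add: aff_def prod_eq_iff fst_sum snd_sum)
  have aff_comb: "aff (k s) (\<Sum>t\<in>S. u t *\<^sub>R t) = u s" if "sum u S = 1" "s \<in> S" for u s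
    using aff_sum[OF that(1), of "k s" "\<lambda>t. t"] pick[OF that(2)] by simp
  have X_iff: "x \<in> X \<longleftrightarrow> (\<forall>s\<in>S. 0 < aff (k s) x)" for x
  proof -
    have "x \<in> X \<longleftrightarrow> (\<exists>u. (\<forall>s\<in>S. 0 < u s) \<and> sum u S = 1 \<and> (\<Sum>s\<in>S. u s *\<^sub>R s) = x)"
      unfolding S(4) interior_convex_hull_explicit_minimal[OF S(3)] using S(2) by simp
    also have "\<dots> \<longleftrightarrow> (\<forall>s\<in>S. 0 < aff (k s) x)"
    proof
      show "\<forall>s\<in>S. 0 < aff (k s) x" if "\<exists>u. (\<forall>s\<in>S. 0 < u s) \<and> sum u S = 1 \<and> (\<Sum>s\<in>S. u s *\<^sub>R s) = x"
        using that aff_comb by auto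
      show "\<exists>u. (\<forall>s\<in>S. 0 < u s) \<and> sum u S = 1 \<and> (\<Sum>s\<in>S. u s *\<^sub>R s) = x" if "\<forall>s\<in>S. 0 < aff (k s) x"
        using that coords[of x] by (intro exI[of _ "\<lambda>s. aff (k s) x"]) simp
    qed
    finally show ?thesis .
  qed
  have S_pos: "S \<noteq> {}" "0 < real (card S)" using S(1,2) by auto
  interpret polytope X "k ` S"
  proof
    show "finite (k ` S)" using S(1) by simp
    show "X = {x. \<forall>l\<in>k ` S. 0 < aff l x}" using X_iff by blast
    have "(\<Sum>s\<in>S. (1 / real (card S)) *\<^sub>R s) \<in> X"
      unfolding X_iff using aff_comb[of "\<lambda>_. 1 / real (card S)"] S_pos by simp
    then show "X \<noteq> {}" by blast
    show "bounded X"
      unfolding S(4) using S(1) by (meson bounded_convex_hull bounded_subset finite_imp_bounded interior_subset)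
    fix l assume "l \<in> k ` S"
    then obtain s where s: "s \<in> S" "l = k s" by blast
    \<comment> \<open>The barycentre of the face opposite to \<open>s\<close>, a witness for
      irredundancy.\<close>
    define u where "u t = (if t = s then 0 else 1 / real (DIM('a)))" for t
    have "sum u S = (\<Sum>t\<in>S - {s}. 1 / real (DIM('a)))"
      unfolding u_def using S(1) by (simp add: sum.If_cases Diff_eq)
    also have "\<dots> = 1" using S(1,2) s(1) by simp
    finally have u: "sum u S = 1" .
    have "aff l (\<Sum>t\<in>S. u t *\<^sub>R t) = 0" using aff_comb[OF u s(1)] by (simp add: s(2) u_def)
    moreover have "0 < aff m (\<Sum>t\<in>S. u t *\<^sub>R t)" if m: "m \<in> k ` S - {l}" for m
    proof -
      obtain t where "t \<in> S" "m = k t" "t \<noteq> s" using m s by blast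
      then show ?thesis using aff_comb[OF u \<open>t \<in> S\<close>] by (simp add: u_def)
    qed
    ultimately show "\<exists>p. aff l p = 0 \<and> (\<forall>m\<in>k ` S - {l}. 0 < aff m p)" by blast
  qed
  define Z where "Z x = (\<Sum>s\<in>S. 1 / aff (k s) x)" for x
  \<comment> \<open>coordinatewise inversion in barycentric coordinates\<close>
  define J where "J x = (\<Sum>s\<in>S. (1 / (aff (k s) x * Z x)) *\<^sub>R s)" for x
  have Z_pos: "0 < Z x" if "x \<in> X" for x
    unfolding Z_def using that X_iff S(1) S_pos(1) by (intro sum_pos) simp_all
  have aff_J: "aff (k s) (J x) = 1 / (aff (k s) x * Z x)" if x: "x \<in> X" and s: "s \<in> S" for x s
    unfolding J_def
  proof (rule aff_comb[OF _ s])
    have "(\<Sum>s\<in>S. 1 / (aff (k s) x * Z x)) = Z x / Z x"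
      \<comment> \<open>Expands \<open>Z x\<close> in the numerator of the quotient only; the
        denominators keep it folded.\<close>
      unfolding Z_def[of x, THEN arg_cong[of _ _ "\<lambda>z. z / Z x"]] sum_divide_distrib by simp
    then show "(\<Sum>s\<in>S. 1 / (aff (k s) x * Z x)) = 1" using Z_pos[OF x] by simp
  qed
  have J_X: "J x \<in> X" if "x \<in> X" for x
    unfolding X_iff using aff_J[OF that] Z_pos[OF that] that X_iff by simp
  have Z_J: "Z (J x) = Z x" if x: "x \<in> X" for x
  proof -
    have "Z (J x) = (\<Sum>s\<in>S. aff (k s) x * Z x)"
      unfolding Z_def[of "J x"] using aff_J[OF x] by (intro sum.cong) simp_all
    also have "\<dots> = Z x" using coords(2)[of x] by (simp flip: sum_distrib_right)
    finally show ?thesis .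
  qed
  have J_J: "J (J x) = x" if x: "x \<in> X" for x
  proof -
    have "aff (k s) (J (J x)) = aff (k s) x" if "s \<in> S" for s
      using aff_J[OF J_X[OF x] that] aff_J[OF x that] Z_J[OF x] Z_pos[OF x] by simp
    then show ?thesis using coords(1)[of "J (J x)"] coords(1)[of x] by simp
  qed
  have lr_J: "lr (k s) (k t) (J x) = lr (k t) (k s) x" if x: "x \<in> X" and st: "s \<in> S" "t \<in> S" for x s t
  proof -
    have "ln (aff (k s) (J x)) = - ln (aff (k s) x) - ln (Z x)" if "s \<in> S" for s
    proof -
      have "0 < aff (k s) x" using x that X_iff by blast
      then show ?thesis
        unfolding aff_J[OF x that] using Z_pos[OF x] by (simp add: ln_div ln_mult_pos)
    qed
    then show ?thesis using st by (simp add: lr_def)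
  qed
  have J_le: "hilbert_dist X (J x) (J y) \<le> hilbert_dist X x y" if x: "x \<in> X" and y: "y \<in> X" for x y
  proof -
    obtain i j where ij: "i \<in> k ` S" "j \<in> k ` S" "hilbert_dist X (J x) (J y) = lr i j (J x) - lr i j (J y)"
      by (rule dist_attained[OF J_X[OF x] J_X[OF y]])
    then obtain s t where "s \<in> S" "t \<in> S" "i = k s" "j = k t" by blast
    then have "hilbert_dist X (J x) (J y) = lr j i x - lr j i y" using lr_J x y ij(3) by simp
    then show ?thesis using lr_le_dist[OF ij(2,1) x y] by simp
  qed
  have J_iso: "hilbert_dist X (J x) (J y) = hilbert_dist X x y" if "x \<in> X" "y \<in> X" for x y
    using J_le[OF that] J_le[OF J_X[OF that(1)] J_X[OF that(2)]] J_J that by simp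
  have "J ` X = X" using J_X J_J by (metis equalityI image_eqI image_subsetI subsetI)
  then have iso: "restrict J X \<in> hilbert_isometries X"
    unfolding hilbert_isometries_def using J_iso by simp
  have "restrict J X \<notin> hilbert_collineations X"
  proof
    assume "restrict J X \<in> hilbert_collineations X"
    then obtain M where M: "restrict J X = restrict (proj_apply M) X" "collineation_of X M"
      unfolding hilbert_collineations_def by blast
    have lin: "linear M" and "bij M" and nz: "\<And>x. x \<in> X \<Longrightarrow> snd (M (x, 1)) \<noteq> 0"
      using M(2) unfolding collineation_of_def by blast+
    have J_proj: "proj_apply M x = J x" if "x \<in> X" for x using M(1) that by (metis restrict_apply')
    \<comment> \<open>Up to the denominator of the projective map, \<open>A s\<close> gives the
      barycentric coordinate of the image at \<open>s\<close>.\<close>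
    define A where "A s = adjoint M (k s)" for s
    have aff_A: "aff (A s) x = inner (k s) (M (x, 1))" for s x
      using adjoint_works[OF lin, of "(x, 1)" "k s"] by (simp add: A_def aff_def inner_commute)
    have prod_X: "aff (A s) x * aff (k s) x = snd (M (x, 1)) / Z x" if x: "x \<in> X" and s: "s \<in> S" for x s
    proof -
      have "aff (A s) x = snd (M (x, 1)) * aff (k s) (proj_apply M x)"
        using inner_scale_aff[of "M (x, 1)" "k s"] nz[OF x]
        unfolding aff_A proj_apply_def divide_inverse_commute by simp
      moreover have "0 < aff (k s) x" using x s X_iff by blast
      ultimately show ?thesis
        unfolding J_proj[OF x] aff_J[OF x s] by simp
    qed
    have prods: "aff (A s) x * aff (k s) x = aff (A t) x * aff (k t) x" if st: "s \<in> S" "t \<in> S" for s t x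
      by (rule line_poly_eq[of "\<lambda>x. aff (A s) x * aff (k s) x" "\<lambda>x. aff (A t) x * aff (k t) x",
            OF line_poly_mult[OF line_poly_aff line_poly_aff] line_poly_mult[OF line_poly_aff line_poly_aff]
              open_X X_nonempty])
        (simp only: prod_X st)
    \<comment> \<open>Here dimension at least 2 enters: the simplex has at least three
      vertices.\<close>
    have third: "\<exists>c\<in>S. c \<noteq> a \<and> c \<noteq> b" for a b
    proof -
      have "card {a, b} < card S" using S(2) dim card_insert_le_m1[of 2 "{b}" a] by simp
      then have "\<not> S \<subseteq> {a, b}" using card_mono[of "{a, b}" S] by fastforce
      then show ?thesis by blast
    qed
    have diag: "aff (A a) a = 0" if a: "a \<in> S" for a
    proof -
      obtain c where "c \<in> S" "c \<noteq> a" using third by blast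
      then show ?thesis using prods[OF a \<open>c \<in> S\<close>, of a] k(1,2) a by simp
    qed
    have off: "aff (A a) b = 0" if a: "a \<in> S" and b: "b \<in> S" for a b
    proof (cases "b = a")
      case False
      obtain c where c: "c \<in> S" "c \<noteq> a" "c \<noteq> b" using third by blast
      \<comment> \<open>At the midpoint of the edge the coordinate of \<open>c\<close> is zero and
        that of \<open>a\<close> is not, so \<open>A a\<close> vanishes there; as it vanishes at
        \<open>a\<close>, it also vanishes at \<open>b\<close>.\<close>
      define x where "x = (1 - 1 / 2) *\<^sub>R a + (1 / 2) *\<^sub>R b"
      have x: "aff l x = (aff l a + aff l b) / 2" for l unfolding x_def aff_segment by simp
      have "aff (k c) x = 0" "aff (k a) x = 1 / 2" unfolding x using k a b c False by simp_all
      then have "aff (A a) x = 0" using prods[OF a c(1), of x] by simp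
      then show ?thesis unfolding x using diag[OF a] by simp
    qed (use diag a in simp)
    obtain a where a: "a \<in> S" using S_pos by blast
    obtain v where v: "M v = (a, 1)" using bij_is_surj[OF \<open>bij M\<close>] by (metis surjD)
    \<comment> \<open>\<open>A a\<close> vanishes on all lifted vertices, hence everywhere, although
      \<open>k a\<close> takes the value 1 at \<open>M v\<close>.\<close>
    have "inner (k a) (M v) = inner (A a) v" using adjoint_works[OF lin, of v "k a"] by (simp add: A_def inner_commute)
    also have "\<dots> = (\<Sum>s\<in>S. inner (k s) v * aff (A a) s)"
      by (subst k(3)[of v]) (simp only: inner_sum_right inner_scaleR_right aff_def)
    also have "\<dots> = 0" using off[OF a] by simp
    finally show False using k(1)[OF a] v by (simp add: aff_def)
  qed
  with iso show ?thesis by blast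
qed

theorem theorem1p1:
  fixes X :: "'a::euclidean_space set"
  assumes "polyhedral_domain X"
  shows "hilbert_isometries X = hilbert_collineations X \<longleftrightarrow>
           \<not> (open_simplex X \<and> DIM('a) \<ge> 2)"
proof -
  obtain I where "polytope X I" by (rule polyhedral_domain_imp_polytope[OF assms])
  then show ?thesis
    using polytope.collineations_subset_isometries polytope.isometries_subset_collineations
      simplex_isometry_not_collineation by blast
qed

end
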